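(* Let $\chi$ be a $C$-valued character of $H$ with $\chi^s=\chi$ which does not factor through the determinant, and let $\mathcal A_\chi=\mathrm{End}_G(\mathrm{c\text{-}ind}_I^G\chi)$. Then $\mathcal A_\chi\cong C\langle X,Y\rangle/\big(X^2+(q^2-q)X-q^3,\;Y^2+(1-q)Y-q\big)$ via $X,Y$ below, its center is $C[Z]$ with $Z=X(Y-(q-1))+Y(X-(q-q^2))$, and every finite-dimensional simple right $\mathcal A_\chi$-module is isomorphic either to a character $\mu_{\theta,\theta'}$ with $(\theta,\theta')\in\{-q^2,q\}\times\{-1,q\}$, or to a module $M(\lambda)$ with $\lambda\in C$, $\lambda\ne q^3+q$, $\lambda\ne-2q^2$.
   Context: Setting: $p$ odd prime, $F$ nonarchimedean local field with residue field $\mathbb F_q$, $E=F(\sqrt\epsilon)$ unramified quadratic with conjugation $x\mapsto\bar x$, $\varpi$ a uniformizer of $F$, $G=\{g\in\mathrm{GL}_3(E):\bar g^\top sg=s\}$ with $s$ the antidiagonal permutation matrix, $I$ the Iwahori subgroup (elements of $G\cap\mathrm{GL}_3(\mathfrak o_E)$ upper triangular mod $\mathfrak p_E$), $I(1)$ its pro-$p$ Sylow subgroup, $H=I/I(1)$ identified with $\{\mathrm{diag}(a,\delta,\bar a^{-1}):a\in\mathbb F_{q^2}^\times,\delta^{q+1}=1\}$. For a character $\chi$ of $H$: $\chi^s(\mathrm{diag}(a,\delta,\bar a^{-1}))=\chi(\mathrm{diag}(\bar a^{-1},\delta,a))$; $\chi$ factors through the determinant iff $a\mapsto\chi(\mathrm{diag}(a,\bar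 aa^{-1},\bar a^{-1}))$ is trivial. $C$ is algebraically closed of characteristic not dividing $|H|=(q^2-1)(q+1)$. $n_s=\begin{pmatrix}0&0&-\sqrt\epsilon^{-1}\\0&1&0\\\sqrt\epsilon&0&0\end{pmatrix}$, $n_{s'}=\begin{pmatrix}0&0&-\varpi^{-1}\sqrt\epsilon^{-1}\\0&1&0\\\varpi\sqrt\epsilon&0&0\end{pmatrix}$. In $\mathcal A_\chi$, $X$ (resp. $Y$) is the endomorphism sending $\mathbf 1_I$ (supported on $I$, value 1 at 1, transforming by $\chi$) to the function supported on $In_sI$ (resp. $In_{s'}I$) with value 1 at $n_s$ (resp. $n_{s'}$) transforming on both sides by $\chi$. $\mu_{\theta,\theta'}$ is the character $X\mapsto\theta$, $Y\mapsto\theta'$. $M(\lambda)$ is the right module with basis $v_1,v_2$ and $v_1X=-q^2v_1$, $v_1Y=v_2$, $v_2X=(\lambda+q^2-q^3)v_1+qv_2$, $v_2Y=qv_1+(q-1)v_2$. *)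

theory Defs
  imports Complex_Main "Jordan_Normal_Form.Matrix" "HOL-Library.Product_Plus"
    "HOL-Computational_Algebra.Polynomial"
begin

text \<open>E is the field type 'e; v is the normalized discrete valuation of E (its value
at 0 is irrelevant); sg is the Galois conjugation x -> bar x; F is its fixed field.\<close>

definition oE :: "('e::field \<Rightarrow> int) \<Rightarrow> 'e set" where
  "oE v = {x. x = 0 \<or> 0 \<le> v x}"

definition pEk :: "('e::field \<Rightarrow> int) \<Rightarrow> int \<Rightarrow> 'e set" where
  "pEk v k = {x. x = 0 \<or> k \<le> v x}"

definition fixF :: "('e \<Rightarrow> 'e) \<Rightarrow> 'e set" where
  "fixF sg = {x. sg x = x}"

definition resF :: "('e::field \<Rightarrow> int) \<Rightarrow> ('e \<Rightarrow> 'e) \<Rightarrow> 'e set set" where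
  "resF v sg = (\<lambda>x. {y \<in> oE v \<inter> fixF sg. x - y \<in> pEk v 1}) ` (oE v \<inter> fixF sg)"

definition complete_val :: "('e::field \<Rightarrow> int) \<Rightarrow> bool" where
  "complete_val v \<longleftrightarrow> (\<forall>x::nat \<Rightarrow> 'e.
     (\<forall>k. \<exists>N. \<forall>m\<ge>N. \<forall>n\<ge>N. x m - x n \<in> pEk v k) \<longrightarrow>
     (\<exists>L. \<forall>k. \<exists>N. \<forall>n\<ge>N. x n - L \<in> pEk v k))"

text \<open>F nonarchimedean local field with residue field of q elements (residue
characteristic the odd prime p), E = F(sqrt eps) unramified quadratic, w a uniformizer
of F (hence of E).\<close>
definition unram_local_data ::
  "('e::field \<Rightarrow> int) \<Rightarrow> ('e \<Rightarrow> 'e) \<Rightarrow> 'e \<Rightarrow> 'e \<Rightarrow> 'e \<Rightarrow> nat \<Rightarrow> nat \<Rightarrow> bool" where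
  "unram_local_data v sg eps seps w p q \<longleftrightarrow>
     (\<forall>x y. x \<noteq> 0 \<longrightarrow> y \<noteq> 0 \<longrightarrow> v (x * y) = v x + v y) \<and>
     (\<forall>x y. x \<noteq> 0 \<longrightarrow> y \<noteq> 0 \<longrightarrow> x + y \<noteq> 0 \<longrightarrow> min (v x) (v y) \<le> v (x + y)) \<and>
     complete_val v \<and>
     (\<forall>x y. sg (x + y) = sg x + sg y) \<and> (\<forall>x y. sg (x * y) = sg x * sg y) \<and> sg 1 = 1 \<and>
     (\<forall>x. sg (sg x) = x) \<and> (\<forall>x. x \<noteq> 0 \<longrightarrow> v (sg x) = v x) \<and>
     sg eps = eps \<and> eps \<noteq> 0 \<and> v eps = 0 \<and> seps * seps = eps \<and> sg seps \<noteq> seps \<and>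
     (\<forall>x. \<exists>a b. sg a = a \<and> sg b = b \<and> x = a + b * seps) \<and>
     sg w = w \<and> w \<noteq> 0 \<and> v w = 1 \<and>
     prime p \<and> odd p \<and> of_nat p \<in> pEk v 1 \<and>
     finite (resF v sg) \<and> card (resF v sg) = q"

definition sM :: "'e::field mat" where
  "sM = mat 3 3 (\<lambda>(i, j). if i + j = 2 then 1 else 0)"

definition Ggrp :: "('e::field \<Rightarrow> 'e) \<Rightarrow> 'e mat set" where
  "Ggrp sg = {g \<in> carrier_mat 3 3. transpose_mat (map_mat sg g) * sM * g = sM}"

definition integral_mat :: "('e::field \<Rightarrow> int) \<Rightarrow> 'e mat \<Rightarrow> bool" where
  "integral_mat v g \<longleftrightarrow> (\<forall>i<3. \<forall>j<3. g $$ (i, j) \<in> oE v)"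

definition GL3o :: "('e::field \<Rightarrow> int) \<Rightarrow> 'e mat set" where
  "GL3o v = {g \<in> carrier_mat 3 3. integral_mat v g \<and>
     (\<exists>h \<in> carrier_mat 3 3. integral_mat v h \<and> g * h = 1\<^sub>m 3 \<and> h * g = 1\<^sub>m 3)}"

definition Iw :: "('e::field \<Rightarrow> int) \<Rightarrow> ('e \<Rightarrow> 'e) \<Rightarrow> 'e mat set" where
  "Iw v sg = {g \<in> Ggrp sg \<inter> GL3o v. \<forall>i<3. \<forall>j<3. j < i \<longrightarrow> g $$ (i, j) \<in> pEk v 1}"

definition Iw1 :: "('e::field \<Rightarrow> int) \<Rightarrow> ('e \<Rightarrow> 'e) \<Rightarrow> 'e mat set" where
  "Iw1 v sg = {g \<in> Iw v sg. \<forall>i<3. g $$ (i, i) - 1 \<in> pEk v 1}"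

definition diag3 :: "'e::field \<Rightarrow> 'e \<Rightarrow> 'e \<Rightarrow> 'e mat" where
  "diag3 a b c = mat 3 3 (\<lambda>(i, j). if i = j then (if i = 0 then a else if i = 1 then b else c) else 0)"

definition nS :: "'e::field \<Rightarrow> 'e mat" where
  "nS seps = mat 3 3 (\<lambda>(i, j). if i = 0 \<and> j = 2 then - inverse seps
      else if i = 1 \<and> j = 1 then 1 else if i = 2 \<and> j = 0 then seps else 0)"

definition nS' :: "'e::field \<Rightarrow> 'e \<Rightarrow> 'e mat" where
  "nS' seps w = mat 3 3 (\<lambda>(i, j). if i = 0 \<and> j = 2 then - (inverse w * inverse seps)
      else if i = 1 \<and> j = 1 then 1 else if i = 2 \<and> j = 0 then w * seps else 0)"

definition H_char :: "('e::field \<Rightarrow> int) \<Rightarrow> ('e \<Rightarrow> 'e) \<Rightarrow> ('e mat \<Rightarrow> 'c::field) \<Rightarrow> bool" where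
  "H_char v sg chi \<longleftrightarrow> (\<forall>g \<in> Iw v sg. \<forall>h \<in> Iw v sg. chi (g * h) = chi g * chi h) \<and>
                        (\<forall>g \<in> Iw1 v sg. chi g = 1)"

text \<open>chi^s = chi, tested on the diagonal representatives diag(a, delta, bar a^-1)\<close>
definition chi_s_fixed :: "('e::field \<Rightarrow> int) \<Rightarrow> ('e \<Rightarrow> 'e) \<Rightarrow> ('e mat \<Rightarrow> 'c::field) \<Rightarrow> bool" where
  "chi_s_fixed v sg chi \<longleftrightarrow> (\<forall>a d. a \<noteq> 0 \<and> v a = 0 \<and> d * sg d = 1 \<longrightarrow>
      chi (diag3 a d (inverse (sg a))) = chi (diag3 (inverse (sg a)) d a))"

definition chi_factors_det :: "('e::field \<Rightarrow> int) \<Rightarrow> ('e \<Rightarrow> 'e) \<Rightarrow> ('e mat \<Rightarrow> 'c::field) \<Rightarrow> bool" where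
  "chi_factors_det v sg chi \<longleftrightarrow> (\<forall>a. a \<noteq> 0 \<and> v a = 0 \<longrightarrow>
      chi (diag3 a (sg a * inverse a) (inverse (sg a))) = 1)"

definition cind :: "'e::field mat set \<Rightarrow> 'e mat set \<Rightarrow> ('e mat \<Rightarrow> 'c::field) \<Rightarrow> ('e mat \<Rightarrow> 'c) set" where
  "cind G I chi = {f. (\<forall>g. g \<notin> G \<longrightarrow> f g = 0) \<and>
      (\<forall>k \<in> I. \<forall>g \<in> G. f (k * g) = chi k * f g) \<and>
      (\<exists>S. finite S \<and> S \<subseteq> G \<and> {g \<in> G. f g \<noteq> 0} \<subseteq> (\<Union>h \<in> S. (\<lambda>k. k * h) ` I))}"

definition rtr :: "'e::field mat set \<Rightarrow> 'e mat \<Rightarrow> ('e mat \<Rightarrow> 'c::field) \<Rightarrow> ('e mat \<Rightarrow> 'c)" where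
  "rtr G g f = (\<lambda>x. if x \<in> G then f (x * g) else 0)"

type_synonym ('e, 'c) endo = "('e mat \<Rightarrow> 'c) \<Rightarrow> ('e mat \<Rightarrow> 'c)"

definition Hend :: "'e::field mat set \<Rightarrow> 'e mat set \<Rightarrow> ('e mat \<Rightarrow> 'c::field) \<Rightarrow> ('e, 'c) endo set" where
  "Hend G I chi = {T. (\<forall>f \<in> cind G I chi. T f \<in> cind G I chi) \<and>
      (\<forall>f. f \<notin> cind G I chi \<longrightarrow> T f = (\<lambda>_. 0)) \<and>
      (\<forall>f \<in> cind G I chi. \<forall>h \<in> cind G I chi. T (\<lambda>x. f x + h x) = (\<lambda>x. T f x + T h x)) \<and>
      (\<forall>c. \<forall>f \<in> cind G I chi. T (\<lambda>x. c * f x) = (\<lambda>x. c * T f x)) \<and>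
      (\<forall>g \<in> G. \<forall>f \<in> cind G I chi. T (rtr G g f) = rtr G g (T f))}"

definition eadd :: "('e, 'c::field) endo \<Rightarrow> ('e, 'c) endo \<Rightarrow> ('e, 'c) endo" where
  "eadd S T = (\<lambda>f x. S f x + T f x)"

definition esmul :: "'c::field \<Rightarrow> ('e, 'c) endo \<Rightarrow> ('e, 'c) endo" where
  "esmul c T = (\<lambda>f x. c * T f x)"

definition eid :: "('e mat \<Rightarrow> 'c::field) set \<Rightarrow> ('e, 'c) endo" where
  "eid V = (\<lambda>f. if f \<in> V then f else (\<lambda>_. 0))"

definition ezero :: "('e, 'c::field) endo" where
  "ezero = (\<lambda>f x. 0)"

fun epow :: "('e mat \<Rightarrow> 'c::field) set \<Rightarrow> ('e, 'c) endo \<Rightarrow> nat \<Rightarrow> ('e, 'c) endo" where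
  "epow V Z 0 = eid V"
| "epow V Z (Suc n) = Z \<circ> epow V Z n"

definition oneI :: "'e::field mat set \<Rightarrow> ('e mat \<Rightarrow> 'c::field) \<Rightarrow> 'e mat \<Rightarrow> 'c" where
  "oneI I chi = (\<lambda>g. if g \<in> I then chi g else 0)"

definition is_Tn :: "'e::field mat set \<Rightarrow> 'e mat set \<Rightarrow> ('e mat \<Rightarrow> 'c::field) \<Rightarrow> 'e mat
    \<Rightarrow> ('e, 'c) endo \<Rightarrow> bool" where
  "is_Tn G I chi n T \<longleftrightarrow> T \<in> Hend G I chi \<and>
     (\<forall>g. \<not> (\<exists>k1 \<in> I. \<exists>k2 \<in> I. g = k1 * n * k2) \<longrightarrow> T (oneI I chi) g = 0) \<and>
     T (oneI I chi) n = 1 \<and>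
     (\<forall>k1 \<in> I. \<forall>k2 \<in> I. \<forall>g \<in> G. T (oneI I chi) (k1 * g * k2) = chi k1 * T (oneI I chi) g * chi k2)"

text \<open>noncommutative polynomials: finitely supported functions on words over {X = True, Y = False}\<close>
definition ncpolys :: "(bool list \<Rightarrow> 'c::field) set" where
  "ncpolys = {p. finite {w. p w \<noteq> 0}}"

definition ncadd :: "(bool list \<Rightarrow> 'c::field) \<Rightarrow> (bool list \<Rightarrow> 'c) \<Rightarrow> (bool list \<Rightarrow> 'c)" where
  "ncadd p r = (\<lambda>w. p w + r w)"

definition ncsmul :: "'c::field \<Rightarrow> (bool list \<Rightarrow> 'c) \<Rightarrow> (bool list \<Rightarrow> 'c)" where
  "ncsmul c p = (\<lambda>w. c * p w)"

definition ncmul :: "(bool list \<Rightarrow> 'c::field) \<Rightarrow> (bool list \<Rightarrow> 'c) \<Rightarrow> (bool list \<Rightarrow> 'c)" where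
  "ncmul p r = (\<lambda>w. \<Sum>i\<le>length w. p (take i w) * r (drop i w))"

definition ncword :: "bool list \<Rightarrow> (bool list \<Rightarrow> 'c::field)" where
  "ncword u = (\<lambda>w. if w = u then 1 else 0)"

inductive_set nc_ideal :: "(bool list \<Rightarrow> 'c::field) set \<Rightarrow> (bool list \<Rightarrow> 'c) set"
  for R :: "(bool list \<Rightarrow> 'c::field) set" where
  gen: "r \<in> R \<Longrightarrow> r \<in> nc_ideal R"
| add: "a \<in> nc_ideal R \<Longrightarrow> b \<in> nc_ideal R \<Longrightarrow> ncadd a b \<in> nc_ideal R"
| lmul: "a \<in> nc_ideal R \<Longrightarrow> u \<in> ncpolys \<Longrightarrow> ncmul u a \<in> nc_ideal R"
| rmul: "a \<in> nc_ideal R \<Longrightarrow> u \<in> ncpolys \<Longrightarrow> ncmul a u \<in> nc_ideal R"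

definition relX :: "nat \<Rightarrow> (bool list \<Rightarrow> 'c::field)" where
  "relX q = (\<lambda>w. ncword [True, True] w + (of_nat q ^ 2 - of_nat q) * ncword [True] w
                 - of_nat q ^ 3 * ncword [] w)"

definition relY :: "nat \<Rightarrow> (bool list \<Rightarrow> 'c::field)" where
  "relY q = (\<lambda>w. ncword [False, False] w + (1 - of_nat q) * ncword [False] w
                 - of_nat q * ncword [] w)"

fun wordev :: "('e mat \<Rightarrow> 'c::field) set \<Rightarrow> ('e, 'c) endo \<Rightarrow> ('e, 'c) endo \<Rightarrow> bool list \<Rightarrow> ('e, 'c) endo" where
  "wordev V TX TY [] = eid V"
| "wordev V TX TY (b # w) = (if b then TX else TY) \<circ> wordev V TX TY w"

definition nceval :: "('e mat \<Rightarrow> 'c::field) set \<Rightarrow> ('e, 'c) endo \<Rightarrow> ('e, 'c) endo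
    \<Rightarrow> (bool list \<Rightarrow> 'c) \<Rightarrow> ('e, 'c) endo" where
  "nceval V TX TY p = (\<lambda>f x. \<Sum>w \<in> {w. p w \<noteq> 0}. p w * wordev V TX TY w f x)"

definition hecke_presentation :: "('e mat \<Rightarrow> 'c::field) set \<Rightarrow> ('e, 'c) endo set \<Rightarrow> nat
    \<Rightarrow> ('e, 'c) endo \<Rightarrow> ('e, 'c) endo \<Rightarrow> bool" where
  "hecke_presentation V A q TX TY \<longleftrightarrow>
     nceval V TX TY ` ncpolys = A \<and>
     (\<forall>p \<in> ncpolys. nceval V TX TY p = ezero \<longleftrightarrow> p \<in> nc_ideal {relX q, relY q})"

definition ecenter :: "('e, 'c::field) endo set \<Rightarrow> ('e, 'c) endo set" where
  "ecenter A = {T \<in> A. \<forall>S \<in> A. T \<circ> S = S \<circ> T}"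

definition epolys :: "('e mat \<Rightarrow> 'c::field) set \<Rightarrow> ('e, 'c) endo \<Rightarrow> ('e, 'c) endo set" where
  "epolys V Z = {(\<lambda>f x. \<Sum>i\<le>degree P. coeff P i * epow V Z i f x) | P :: 'c poly. True}"

definition Zelt :: "('e mat \<Rightarrow> 'c::field) set \<Rightarrow> nat \<Rightarrow> ('e, 'c) endo \<Rightarrow> ('e, 'c) endo \<Rightarrow> ('e, 'c) endo" where
  "Zelt V q TX TY = eadd (TX \<circ> eadd TY (esmul (- (of_nat q - 1)) (eid V)))
                         (TY \<circ> eadd TX (esmul (- (of_nat q - of_nat q ^ 2)) (eid V)))"

definition rmod :: "('e mat \<Rightarrow> 'c::field) set \<Rightarrow> ('e, 'c) endo set \<Rightarrow> ('c \<Rightarrow> 'm::ab_group_add \<Rightarrow> 'm)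
    \<Rightarrow> ('m \<Rightarrow> ('e, 'c) endo \<Rightarrow> 'm) \<Rightarrow> bool" where
  "rmod V A scale act \<longleftrightarrow> vector_space scale \<and>
     (\<forall>T \<in> A. \<forall>u w. act (u + w) T = act u T + act w T) \<and>
     (\<forall>T \<in> A. \<forall>c u. act (scale c u) T = scale c (act u T)) \<and>
     (\<forall>S \<in> A. \<forall>T \<in> A. \<forall>u. act u (eadd S T) = act u S + act u T) \<and>
     (\<forall>T \<in> A. \<forall>c u. act u (esmul c T) = scale c (act u T)) \<and>
     (\<forall>S \<in> A. \<forall>T \<in> A. \<forall>u. act u (S \<circ> T) = act (act u S) T) \<and>
     (\<forall>u. act u (eid V) = u)"

definition fin_dim :: "('c::field \<Rightarrow> 'm::ab_group_add \<Rightarrow> 'm) \<Rightarrow> bool" where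
  "fin_dim scale \<longleftrightarrow> (\<exists>B. finite B \<and> module.span scale B = UNIV)"

definition simple_rmod :: "('e, 'c::field) endo set \<Rightarrow> ('c \<Rightarrow> 'm::ab_group_add \<Rightarrow> 'm)
    \<Rightarrow> ('m \<Rightarrow> ('e, 'c) endo \<Rightarrow> 'm) \<Rightarrow> bool" where
  "simple_rmod A scale act \<longleftrightarrow> (UNIV :: 'm set) \<noteq> {0} \<and>
     (\<forall>W. module.subspace scale W \<and> (\<forall>w \<in> W. \<forall>T \<in> A. act w T \<in> W) \<longrightarrow> W = {0} \<or> W = UNIV)"

definition rmod_iso :: "('e, 'c::field) endo set \<Rightarrow> ('c \<Rightarrow> 'm::ab_group_add \<Rightarrow> 'm) \<Rightarrow> ('m \<Rightarrow> ('e, 'c) endo \<Rightarrow> 'm)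
    \<Rightarrow> ('c \<Rightarrow> 'n::ab_group_add \<Rightarrow> 'n) \<Rightarrow> ('n \<Rightarrow> ('e, 'c) endo \<Rightarrow> 'n) \<Rightarrow> bool" where
  "rmod_iso A scale act scale' act' \<longleftrightarrow> (\<exists>f. bij f \<and>
     (\<forall>u w. f (u + w) = f u + f w) \<and> (\<forall>c u. f (scale c u) = scale' c (f u)) \<and>
     (\<forall>T \<in> A. \<forall>u. f (act u T) = act' (f u) T))"

definition scale2 :: "'c::field \<Rightarrow> 'c \<times> 'c \<Rightarrow> 'c \<times> 'c" where
  "scale2 c z = (c * fst z, c * snd z)"

definition iso_to_mu :: "('e mat \<Rightarrow> 'c::field) set \<Rightarrow> ('e, 'c) endo set \<Rightarrow> ('e, 'c) endo \<Rightarrow> ('e, 'c) endo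
    \<Rightarrow> ('c \<Rightarrow> 'm::ab_group_add \<Rightarrow> 'm) \<Rightarrow> ('m \<Rightarrow> ('e, 'c) endo \<Rightarrow> 'm) \<Rightarrow> 'c \<Rightarrow> 'c \<Rightarrow> bool" where
  "iso_to_mu V A TX TY scale act th th' \<longleftrightarrow> (\<exists>act' :: 'c \<Rightarrow> ('e, 'c) endo \<Rightarrow> 'c.
     rmod V A (*) act' \<and> (\<forall>z. act' z TX = th * z) \<and> (\<forall>z. act' z TY = th' * z) \<and>
     rmod_iso A scale act (*) act')"

text \<open>isomorphic to M(lambda); (a, b) stands for a v1 + b v2\<close>
definition iso_to_M :: "('e mat \<Rightarrow> 'c::field) set \<Rightarrow> ('e, 'c) endo set \<Rightarrow> nat \<Rightarrow> ('e, 'c) endo \<Rightarrow> ('e, 'c) endo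
    \<Rightarrow> ('c \<Rightarrow> 'm::ab_group_add \<Rightarrow> 'm) \<Rightarrow> ('m \<Rightarrow> ('e, 'c) endo \<Rightarrow> 'm) \<Rightarrow> 'c \<Rightarrow> bool" where
  "iso_to_M V A q TX TY scale act lam \<longleftrightarrow> (\<exists>act' :: 'c \<times> 'c \<Rightarrow> ('e, 'c) endo \<Rightarrow> 'c \<times> 'c.
     rmod V A scale2 act' \<and>
     act' (1, 0) TX = (- (of_nat q ^ 2), 0) \<and>
     act' (1, 0) TY = (0, 1) \<and>
     act' (0, 1) TX = (lam + of_nat q ^ 2 - of_nat q ^ 3, of_nat q) \<and>
     act' (0, 1) TY = (of_nat q, of_nat q - 1) \<and>
     rmod_iso A scale act scale2 act')"

end

theory Submission
  imports Defs "Jordan_Normal_Form.Determinant"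
begin

text \<open>
  An endomorphism \<open>T\<close> of the induced representation is determined by the bi-equivariant function
  \<open>T delta\<close>, hence, by the Bruhat decomposition \<open>G = \<Union> I n_w I\<close> over the alternating words \<open>w\<close> in two
  letters, by its values \<open>coef w T\<close> at the monomial matrices \<open>n_w\<close>. Left multiplication by a generator
  acts on these values by a two-term recursion with coefficients \<open>concoef b = |I n_b I / I|\<close> and
  \<open>lincoef b\<close>, a character sum over the nontrivial left cosets. The recursion yields the quadratic relations
  and the linear independence of the alternating words, and with it the presentation. The centre
  is found by comparing leading coefficients, and simple modules are read off from an eigenvector
  of \<open>X\<close>, because \<open>Z\<close> acts by a scalar.

  The linear coefficient of \<open>X\<close> is the sum of \<open>PP(y sqrt eps)\<close>, \<open>PP(a) = chi(diag(a, a'/a, 1/a'))\<close>, over the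
  Heisenberg group \<open>y + y' + x x' = 0\<close> (prime denoting conjugation) over the residue field. \<open>PP\<close> is trivial on
  \<open>F\<close> because \<open>chi\<close> is fixed by \<open>s\<close> and norms are surjective, and it is nontrivial by
  assumption. So each nonzero \<open>x\<close> contributes the same number, which is \<open>-1\<close> because \<open>PP\<close> sums to \<open>0\<close>,
  and \<open>x = 0\<close> contributes \<open>q - 1\<close>.
\<close>

section \<open>Endomorphisms of a compactly induced representation\<close>

text \<open>The quadratic relations factor as (X + q^2)(X - q) and (Y + 1)(Y - q), which explains
  the four characters. On the character with eigenvalues theta, theta' the central element Z acts by
  2 theta theta' - (q - 1) theta - (q - q^2) theta'. This is q^3 + q for (q, q) and (-q^2, -1), and
  -2 q^2 for (q, -1) and (-q^2, q): the excluded lambda are exactly the central characters of the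
  one-dimensional modules. Since q may be zero in C, the coefficient \<open>concoef b\<close> is
  never divided by. The algebra relies on the other branch of the recursion, where the shorter word
  enters with coefficient 1. The algebra needs few facts about the group: representatives of cosets
  lying in I(1), the collapse of n_b u n_b into I n_b I, the passage of u through n_w for reduced
  words, and the Bruhat decomposition. They are isolated as locale assumptions and verified for the
  unitary group by computing with matrix entries and valuations.\<close>

text \<open>\<open>I n_b I\<close> is the disjoint union of the cosets \<open>I n_b u\<close>, \<open>u \<in> U b\<close>, and \<open>chi\<close> is fixed by \<open>n_b\<close>.
  The number \<open>cf b u\<close> is the contribution of \<open>u\<close> to the linear coefficient of the quadratic relation.\<close>

locale double_cosets =
  fixes N :: nat and G I :: "'e::field mat set" and chi :: "'e mat \<Rightarrow> 'c::field"
    and iv :: "'e mat \<Rightarrow> 'e mat" and n :: "bool \<Rightarrow> 'e mat" and U :: "bool \<Rightarrow> 'e mat set"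
    and cf :: "bool \<Rightarrow> 'e mat \<Rightarrow> 'c"
  assumes G_carrier: "g \<in> G \<Longrightarrow> g \<in> carrier_mat N N"
    and one_I: "1\<^sub>m N \<in> I"
    and I_sub: "k \<in> I \<Longrightarrow> k \<in> G"
    and G_mult: "g \<in> G \<Longrightarrow> h \<in> G \<Longrightarrow> g * h \<in> G"
    and I_mult: "k \<in> I \<Longrightarrow> l \<in> I \<Longrightarrow> k * l \<in> I"
    and G_iv: "g \<in> G \<Longrightarrow> iv g \<in> G"
    and I_iv: "k \<in> I \<Longrightarrow> iv k \<in> I"
    and iv_left: "g \<in> G \<Longrightarrow> iv g * g = 1\<^sub>m N"
    and iv_right: "g \<in> G \<Longrightarrow> g * iv g = 1\<^sub>m N"
    and chi_one: "chi (1\<^sub>m N) = 1"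
    and chi_mult: "k \<in> I \<Longrightarrow> l \<in> I \<Longrightarrow> chi (k * l) = chi k * chi l"
    and n_G: "n b \<in> G"
    and n_sq_I: "n b * n b \<in> I"
    and chi_n_sq: "chi (n b * n b) = 1"
    and fin_U: "finite (U b)"
    and U_I: "u \<in> U b \<Longrightarrow> u \<in> I"
    and chi_U: "u \<in> U b \<Longrightarrow> chi u = 1"
    and one_U: "1\<^sub>m N \<in> U b"
    and U_cover: "k \<in> I \<Longrightarrow> \<exists>u\<in>U b. \<exists>j\<in>I. chi j = chi k \<and> n b * k = j * (n b * u)"
    and U_unique: "u \<in> U b \<Longrightarrow> u' \<in> U b \<Longrightarrow> j \<in> I \<Longrightarrow> n b * u = j * (n b * u') \<Longrightarrow> u = u'"
    and U_nontriv: "u \<in> U b \<Longrightarrow> u \<noteq> 1\<^sub>m N \<Longrightarrow>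
        \<exists>k\<in>I. \<exists>k'\<in>I. n b * u * n b = k * n b * k' \<and> chi k * chi k' = cf b u"
begin

lemma G_assoc: "a \<in> G \<Longrightarrow> b \<in> G \<Longrightarrow> c \<in> G \<Longrightarrow> a * b * c = a * (b * c)"
  by (meson G_carrier assoc_mult_mat)

lemma one_G: "1\<^sub>m N \<in> G" using one_I I_sub by blast

lemma left_one [simp]: "g \<in> G \<Longrightarrow> 1\<^sub>m N * g = g" using G_carrier by fastforce
lemma right_one [simp]: "g \<in> G \<Longrightarrow> g * 1\<^sub>m N = g" using G_carrier by fastforce

lemma iv_left': "g \<in> G \<Longrightarrow> h \<in> G \<Longrightarrow> iv g * (g * h) = h"
  using G_assoc[of "iv g" g h] by (simp add: G_iv iv_left)

lemma iv_right': "g \<in> G \<Longrightarrow> h \<in> G \<Longrightarrow> g * (iv g * h) = h"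
  using G_assoc[of g "iv g" h] by (simp add: G_iv iv_right)

lemma iv_mult:
  assumes "a \<in> G" "b \<in> G" shows "iv (a * b) = iv b * iv a"
proof -
  have "iv (a * b) = iv b * (iv a * (a * b * iv (a * b)))"
    using assms by (simp add: G_assoc G_mult G_iv iv_left')
  then show ?thesis using assms by (simp add: iv_right G_mult G_iv)
qed

lemma U_G: "u \<in> U b \<Longrightarrow> u \<in> G" using U_I I_sub by blast

section \<open>Compact induction and its algebra of endomorphisms\<close>

abbreviation "V \<equiv> cind G I chi"
abbreviation "A \<equiv> Hend G I chi"
abbreviation "delta \<equiv> oneI I chi"

lemma cind_outside: "f \<in> V \<Longrightarrow> g \<notin> G \<Longrightarrow> f g = 0"
  by (simp add: cind_def)

lemma cind_equiv: "f \<in> V \<Longrightarrow> k \<in> I \<Longrightarrow> g \<in> G \<Longrightarrow> f (k * g) = chi k * f g"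
  by (simp add: cind_def)

lemma cind_supp:
  assumes "f \<in> V"
  obtains S where "finite S" "S \<subseteq> G" "\<And>g. g \<in> G \<Longrightarrow> f g \<noteq> 0 \<Longrightarrow> \<exists>h\<in>S. \<exists>k\<in>I. g = k * h"
proof -
  from assms obtain S where "finite S" "S \<subseteq> G" "{g \<in> G. f g \<noteq> 0} \<subseteq> (\<Union>h \<in> S. (\<lambda>k. k * h) ` I)"
    by (auto simp: cind_def)
  then show ?thesis by (intro that[of S]) blast+
qed

lemma cindI:
  assumes "\<And>g. g \<notin> G \<Longrightarrow> f g = 0"
    and "\<And>k g. k \<in> I \<Longrightarrow> g \<in> G \<Longrightarrow> f (k * g) = chi k * f g"
    and "finite S" "S \<subseteq> G" "\<And>g. g \<in> G \<Longrightarrow> f g \<noteq> 0 \<Longrightarrow> \<exists>h\<in>S. \<exists>k\<in>I. g = k * h"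
  shows "f \<in> V"
proof -
  have "\<exists>S. finite S \<and> S \<subseteq> G \<and> {g \<in> G. f g \<noteq> 0} \<subseteq> (\<Union>h \<in> S. (\<lambda>k. k * h) ` I)"
    using assms(3-5) by (intro exI[of _ S]) blast
  then show ?thesis using assms(1,2) unfolding cind_def by blast
qed

lemma rtr_apply: "rtr G g f x = (if x \<in> G then f (x * g) else 0)"
  by (simp add: rtr_def)

lemma cind_zero: "(\<lambda>_. 0) \<in> V"
  by (rule cindI[of _ "{}"]) auto

lemma cind_add:
  assumes "f \<in> V" "h \<in> V" shows "(\<lambda>x. f x + h x) \<in> V"
proof -
  obtain S where S: "finite S" "S \<subseteq> G" "\<And>g. g \<in> G \<Longrightarrow> f g \<noteq> 0 \<Longrightarrow> \<exists>h\<in>S. \<exists>k\<in>I. g = k * h"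
    using cind_supp[OF assms(1)] by blast
  obtain S' where S': "finite S'" "S' \<subseteq> G" "\<And>g. g \<in> G \<Longrightarrow> h g \<noteq> 0 \<Longrightarrow> \<exists>h\<in>S'. \<exists>k\<in>I. g = k * h"
    using cind_supp[OF assms(2)] by blast
  show ?thesis
  proof (rule cindI[of _ "S \<union> S'"])
    fix g assume g: "g \<in> G" "f g + h g \<noteq> 0"
    then have "f g \<noteq> 0 \<or> h g \<noteq> 0" by auto
    then show "\<exists>h\<in>S \<union> S'. \<exists>k\<in>I. g = k * h" using S(3) S'(3) g(1) by blast
  qed (use assms S(1,2) S'(1,2) in \<open>auto simp: cind_outside cind_equiv algebra_simps\<close>)
qed

lemma cind_smult:
  assumes "f \<in> V" shows "(\<lambda>x. c * f x) \<in> V"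
proof -
  obtain S where S: "finite S" "S \<subseteq> G" "\<And>g. g \<in> G \<Longrightarrow> f g \<noteq> 0 \<Longrightarrow> \<exists>h\<in>S. \<exists>k\<in>I. g = k * h"
    using cind_supp[OF assms(1)] by blast
  show ?thesis
    by (rule cindI[of _ S]) (use assms S in \<open>auto simp: cind_outside cind_equiv\<close>)
qed

lemma cind_sum:
  assumes "finite S" "\<And>i. i \<in> S \<Longrightarrow> F i \<in> V" shows "(\<lambda>x. \<Sum>i\<in>S. c i * F i x) \<in> V"
  using assms by (induction S) (auto intro!: cind_zero cind_add cind_smult)

lemma cind_rtr:
  assumes "f \<in> V" "g0 \<in> G" shows "rtr G g0 f \<in> V"
proof -
  obtain S where S: "finite S" "S \<subseteq> G" "\<And>g. g \<in> G \<Longrightarrow> f g \<noteq> 0 \<Longrightarrow> \<exists>h\<in>S. \<exists>k\<in>I. g = k * h"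
    using cind_supp[OF assms(1)] by blast
  show ?thesis
  proof (rule cindI[of _ "(\<lambda>h. h * iv g0) ` S"])
    fix g assume g: "g \<in> G" "rtr G g0 f g \<noteq> 0"
    then have "f (g * g0) \<noteq> 0" using g(1) by (simp add: rtr_apply)
    then obtain h k where hk: "h \<in> S" "k \<in> I" "g * g0 = k * h"
      using S(3)[OF G_mult] g(1) assms(2) by blast
    have "g = g * g0 * iv g0"
      using g assms by (simp add: G_assoc G_iv iv_right)
    also have "\<dots> = k * (h * iv g0)" using hk S(2) assms(2) by (simp add: G_assoc G_iv I_sub subset_iff)
    finally show "\<exists>h\<in>(\<lambda>h. h * iv g0) ` S. \<exists>k\<in>I. g = k * h" using hk by blast
  next
    fix k g assume "k \<in> I" "g \<in> G"
    then show "rtr G g0 f (k * g) = chi k * rtr G g0 f g"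
      using assms by (simp add: rtr_apply cind_equiv G_assoc I_sub G_mult)
  next
    show "(\<lambda>h. h * iv g0) ` S \<subseteq> G" using S(2) assms G_mult G_iv by blast
  qed (use S(1) in \<open>auto simp: rtr_apply\<close>)
qed

lemma delta_cind: "delta \<in> V"
proof (rule cindI[of _ "{1\<^sub>m N}"])
  fix k g assume kg: "k \<in> I" "g \<in> G"
  have "k * g \<in> I \<longleftrightarrow> g \<in> I"
    using kg by (metis I_iv I_mult I_sub iv_left')
  then show "delta (k * g) = chi k * delta g" using kg by (simp add: oneI_def chi_mult)
qed (auto simp: oneI_def one_G I_sub split: if_splits)

lemma HendI:
  assumes "\<And>f. f \<in> V \<Longrightarrow> T f \<in> V" "\<And>f. f \<notin> V \<Longrightarrow> T f = (\<lambda>_. 0)"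
    and "\<And>f h. f \<in> V \<Longrightarrow> h \<in> V \<Longrightarrow> T (\<lambda>x. f x + h x) = (\<lambda>x. T f x + T h x)"
    and "\<And>c f. f \<in> V \<Longrightarrow> T (\<lambda>x. c * f x) = (\<lambda>x. c * T f x)"
    and "\<And>g f. g \<in> G \<Longrightarrow> f \<in> V \<Longrightarrow> T (rtr G g f) = rtr G g (T f)"
  shows "T \<in> A"
  using assms by (auto simp: Hend_def)

lemma
  assumes "T \<in> A"
  shows Hend_cind: "f \<in> V \<Longrightarrow> T f \<in> V" and Hend_outside: "f \<notin> V \<Longrightarrow> T f = (\<lambda>_. 0)"
    and Hend_add: "f \<in> V \<Longrightarrow> h \<in> V \<Longrightarrow> T (\<lambda>x. f x + h x) = (\<lambda>x. T f x + T h x)"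
    and Hend_smult: "f \<in> V \<Longrightarrow> T (\<lambda>x. c * f x) = (\<lambda>x. c * T f x)"
    and Hend_rtr: "g \<in> G \<Longrightarrow> f \<in> V \<Longrightarrow> T (rtr G g f) = rtr G g (T f)"
  using assms by (auto simp: Hend_def)

text \<open>Elements of \<open>A\<close> are total maps that vanish outside \<open>V\<close> by
  convention, so all their values lie in \<open>V\<close> and equality of maps is equality on
  \<open>V\<close>.\<close>

lemma Hend_range: "T \<in> A \<Longrightarrow> T f \<in> V"
  by (cases "f \<in> V") (simp_all add: Hend_cind Hend_outside cind_zero)

lemma Hend_zero: "T \<in> A \<Longrightarrow> T (\<lambda>_. 0) = (\<lambda>_. 0)"
  using Hend_smult[of T "\<lambda>_. 0" 0] by (simp add: cind_zero)

lemma Hend_sum: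
  assumes "T \<in> A" "finite S" "\<And>i. i \<in> S \<Longrightarrow> F i \<in> V"
  shows "T (\<lambda>x. \<Sum>i\<in>S. c i * F i x) = (\<lambda>x. \<Sum>i\<in>S. c i * T (F i) x)"
  using assms(2,3)
proof (induction S)
  case empty then show ?case using Hend_zero[OF assms(1)] by simp
next
  case (insert i S)
  have "T (\<lambda>x. c i * F i x + (\<Sum>i\<in>S. c i * F i x)) = (\<lambda>x. c i * T (F i) x + T (\<lambda>x. \<Sum>i\<in>S. c i * F i x) x)"
    using insert assms(1) by (subst Hend_add) (auto intro: cind_smult cind_sum simp: Hend_smult)
  then show ?case using insert by simp
qed

lemma eid_Hend: "eid V \<in> A"
  by (rule HendI) (auto simp: eid_def cind_add cind_smult cind_rtr)

lemma ezero_Hend: "ezero \<in> A"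
  by (rule HendI) (auto simp: ezero_def cind_zero rtr_apply)

lemma eadd_Hend: "S \<in> A \<Longrightarrow> T \<in> A \<Longrightarrow> eadd S T \<in> A"
  by (rule HendI)
    (auto simp: eadd_def cind_add Hend_cind Hend_outside Hend_add Hend_smult Hend_rtr algebra_simps rtr_apply)

lemma esmul_Hend: "T \<in> A \<Longrightarrow> esmul c T \<in> A"
  by (rule HendI)
    (auto simp: esmul_def cind_smult Hend_cind Hend_outside Hend_add Hend_smult Hend_rtr algebra_simps rtr_apply)

lemma comp_Hend: "S \<in> A \<Longrightarrow> T \<in> A \<Longrightarrow> S \<circ> T \<in> A"
  by (rule HendI)
    (simp_all add: Hend_cind Hend_outside[of T] Hend_add Hend_smult Hend_rtr Hend_zero)

lemma eid_comp: "T \<in> A \<Longrightarrow> eid V \<circ> T = T"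
  by (rule ext) (simp add: eid_def Hend_range)

lemma comp_eid: "T \<in> A \<Longrightarrow> T \<circ> eid V = T"
  by (rule ext) (auto simp: eid_def Hend_zero Hend_outside)

text \<open>Right translation by \<open>k\<close> in \<open>I\<close> multiplies
  \<open>delta\<close> by \<open>chi k\<close>, and \<open>T\<close> commutes with translations and
  scalars. Together with \<open>Hend_delta_left\<close> this makes \<open>T delta\<close>
  bi-equivariant.\<close>

lemma Hend_delta_right:
  assumes "T \<in> A" "g \<in> G" "k \<in> I" shows "T delta (g * k) = T delta g * chi k"
proof -
  have "rtr G k delta = (\<lambda>x. chi k * delta x)"
  proof
    fix x
    have "x \<in> G \<Longrightarrow> x * k \<in> I \<longleftrightarrow> x \<in> I"
      using assms(3) by (metis G_assoc G_iv I_iv I_mult I_sub iv_right right_one)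
    then show "rtr G k delta x = chi k * delta x"
      using assms(3) I_sub by (auto simp: rtr_apply oneI_def chi_mult)
  qed
  then have "T (rtr G k delta) = (\<lambda>x. chi k * T delta x)"
    using Hend_smult[OF assms(1) delta_cind] by simp
  moreover have "T (rtr G k delta) g = T delta (g * k)"
    using assms I_sub by (simp add: Hend_rtr delta_cind rtr_apply)
  ultimately show ?thesis by (metis mult.commute)
qed

lemma Hend_delta_left:
  assumes "T \<in> A" "g \<in> G" "k \<in> I" shows "T delta (k * g) = chi k * T delta g"
  using assms cind_equiv Hend_cind delta_cind by blast

text \<open>The right translates of \<open>delta\<close> span \<open>V\<close>: a function supported
  on finitely many cosets \<open>I h\<close> is taken apart one coset at a time, by subtracting a
  multiple of \<open>rtr G (iv h) delta\<close>.\<close>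

lemma Hend_eqI:
  assumes T: "T \<in> A" and T': "T' \<in> A" and eq: "T delta = T' delta"
  shows "T = T'"
proof
  fix f
  show "T f = T' f"
  proof (cases "f \<in> V")
    case False then show ?thesis using T T' by (simp add: Hend_outside)
  next
    case True
    have *: "T f = T' f" if "finite S" "S \<subseteq> G" "f \<in> V"
      "\<And>g. g \<in> G \<Longrightarrow> f g \<noteq> 0 \<Longrightarrow> \<exists>h\<in>S. \<exists>k\<in>I. g = k * h" for S f
      using that
    proof (induction S arbitrary: f)
      case empty
      then have "f = (\<lambda>_. 0)" using cind_outside by fastforce
      then show ?case using T T' by (simp add: Hend_zero)
    next
      case (insert h S)
      define d where "d = (\<lambda>x. f h * rtr G (iv h) delta x)"
      define f' where "f' = (\<lambda>x. f x + (-1) * d x)"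
      have h: "h \<in> G" using insert by simp
      have d: "d \<in> V" unfolding d_def by (intro cind_smult cind_rtr delta_cind G_iv h)
      have f': "f' \<in> V" unfolding f'_def by (intro cind_add cind_smult d insert)
      have "T f' = T' f'"
      proof (rule insert.IH)
        fix g assume g: "g \<in> G" "f' g \<noteq> 0"
        have "g \<noteq> k * h" if k: "k \<in> I" for k
        proof
          assume gk: "g = k * h"
          then have "g * iv h = k" using h k by (simp add: G_assoc G_iv I_sub iv_right)
          then have "d g = f h * chi k" using g k by (simp add: d_def rtr_apply oneI_def)
          moreover have "f g = chi k * f h" using gk k h insert.prems(2) by (simp add: cind_equiv)
          ultimately show False using g by (simp add: f'_def)
        qed
        moreover have "f g \<noteq> 0 \<or> g * iv h \<in> I"
          using g by (auto simp: f'_def d_def rtr_apply oneI_def split: if_splits)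
        moreover have "g = (g * iv h) * h" using g h by (simp add: G_assoc G_iv iv_left)
        ultimately show "\<exists>h\<in>S. \<exists>k\<in>I. g = k * h" using insert.prems(3)[OF g(1)] by blast
      qed (use f' insert in auto)
      moreover have "T d = T' d"
        unfolding d_def using T T' eq h
        by (simp add: Hend_smult Hend_rtr cind_rtr delta_cind G_iv)
      moreover have "f = (\<lambda>x. f' x + d x)" by (simp add: f'_def)
      ultimately show ?case using Hend_add[OF T f' d] Hend_add[OF T' f' d] by simp
    qed
    show ?thesis using cind_supp[OF True] *[OF _ _ True] by metis
  qed
qed

text \<open>Convolution with the double coset of \<open>n b\<close> is a sum over the cosets of its inverse; it may be
  written with \<open>n b\<close> itself because the square of \<open>n b\<close> lies in the kernel of \<open>chi\<close>.\<close>

definition hop :: "bool \<Rightarrow> ('e, 'c) endo" where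
  "hop b f = (\<lambda>g. if f \<in> V \<and> g \<in> G then \<Sum>u\<in>U b. f (n b * u * g) else 0)"

text \<open>Right multiplication by \<open>k\<close> permutes the cosets \<open>I n_b u\<close>: one
  has \<open>n_b u k = j n_b (t u)\<close> with \<open>chi j = chi k\<close>, and \<open>t\<close>
  is a permutation because \<open>U_unique\<close> makes it injective on a finite set.\<close>

lemma hop_equiv:
  assumes f: "f \<in> V" and k: "k \<in> I" and g: "g \<in> G"
  shows "(\<Sum>u\<in>U b. f (n b * u * (k * g))) = chi k * (\<Sum>u\<in>U b. f (n b * u * g))"
proof -
  have "\<exists>u'\<in>U b. \<exists>j\<in>I. chi j = chi k \<and> n b * (u * k) = j * (n b * u')" if "u \<in> U b" for u
    using U_cover[of "u * k" b] that k by (metis U_I I_mult chi_U chi_mult mult_1)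
  then obtain t j where tj: "\<And>u. u \<in> U b \<Longrightarrow> t u \<in> U b \<and> j u \<in> I \<and> chi (j u) = chi k \<and>
      n b * (u * k) = j u * (n b * t u)"
    by metis
  have inj: "inj_on t (U b)"
  proof (rule inj_onI)
    fix u1 u2 assume u: "u1 \<in> U b" "u2 \<in> U b" "t u1 = t u2"
    have G: "u1 \<in> G" "u2 \<in> G" "j u1 \<in> G" "j u2 \<in> G" "t u1 \<in> G" "t u2 \<in> G" "k \<in> G"
      using u tj U_G I_sub k by auto
    have e1: "n b * u1 * k = j u1 * (n b * t u1)" and e2: "n b * u2 * k = j u2 * (n b * t u2)"
      using tj u G n_G by (auto simp: G_assoc)
    have "n b * u1 * k = (j u1 * iv (j u2)) * (n b * u2 * k)"
      using G u e1 e2 by (simp add: G_assoc G_mult G_iv n_G iv_left')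
    then have "n b * u1 * k * iv k = (j u1 * iv (j u2)) * (n b * u2 * k) * iv k" by simp
    then have "n b * u1 = (j u1 * iv (j u2)) * (n b * u2)"
      using G by (simp add: G_assoc G_mult G_iv n_G iv_right)
    moreover have "j u1 * iv (j u2) \<in> I" using tj u by (simp add: I_mult I_iv)
    ultimately show "u1 = u2" using U_unique u by blast
  qed
  then have bij: "bij_betw t (U b) (U b)"
    using tj fin_U by (simp add: bij_betw_def endo_inj_surj image_subset_iff)
  have "f (n b * u * (k * g)) = chi k * f (n b * t u * g)" if u: "u \<in> U b" for u
  proof -
    have G: "u \<in> G" "j u \<in> G" "t u \<in> G" "k \<in> G" using u tj U_G I_sub k by auto
    have "n b * u * (k * g) = n b * (u * k) * g" using G g by (simp add: G_assoc G_mult n_G)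
    also have "\<dots> = j u * (n b * t u * g)" using tj[OF u] G g by (simp add: G_assoc G_mult n_G)
    finally show ?thesis using tj[OF u] f G g by (simp add: cind_equiv G_mult n_G)
  qed
  then have "(\<Sum>u\<in>U b. f (n b * u * (k * g))) = (\<Sum>u\<in>U b. chi k * f (n b * t u * g))"
    by (rule sum.cong[OF refl])
  also have "\<dots> = (\<Sum>u\<in>U b. chi k * f (n b * u * g))"
    using sum.reindex_bij_betw[OF bij, of "\<lambda>u. chi k * f (n b * u * g)"] by simp
  finally show ?thesis by (simp add: sum_distrib_left)
qed

text \<open>If \<open>f\<close> lives on cosets \<open>I h\<close>, then \<open>hop b f\<close>
  lives on the sets \<open>u^-1 n_b^-1 I h\<close>. The covering axiom concerns \<open>n_b\<close>
  and not its inverse, so \<open>n_b^-1\<close> is written as \<open>m^-1 n_b\<close> with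
  \<open>m = n_b^2\<close> in \<open>I\<close>.\<close>

lemma hop_cind:
  assumes f: "f \<in> V" shows "hop b f \<in> V"
proof -
  obtain S where S: "finite S" "S \<subseteq> G" "\<And>g. g \<in> G \<Longrightarrow> f g \<noteq> 0 \<Longrightarrow> \<exists>h\<in>S. \<exists>k\<in>I. g = k * h"
    using cind_supp[OF f] by blast
  show ?thesis
  proof (rule cindI[of _ "(\<lambda>(u, h). iv (n b) * (u * h)) ` (U b \<times> S)"])
    fix g assume g: "g \<in> G" "hop b f g \<noteq> 0"
    then have "(\<Sum>u\<in>U b. f (n b * u * g)) \<noteq> 0" using f by (simp add: hop_def)
    then obtain u where u: "u \<in> U b" "f (n b * u * g) \<noteq> 0" by (rule sum.not_neutral_contains_not_neutral)
    have uG: "u \<in> G" using u U_G by simp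
    then have "n b * u * g \<in> G" using g by (simp add: G_mult n_G)
    then obtain h k where hk: "h \<in> S" "k \<in> I" "n b * u * g = k * h"
      using S(3)[OF _ u(2)] by blast
    obtain u' j where j: "u' \<in> U b" "j \<in> I" "n b * k = j * (n b * u')"
      using U_cover hk(2) by blast
    have G: "h \<in> G" "k \<in> G" "u' \<in> G" "j \<in> G" using hk(1,2) j(1,2) S(2) I_sub U_G by auto
    define m where "m = n b * n b"
    have m: "m \<in> I" "m \<in> G" using n_sq_I I_sub by (auto simp: m_def)
    have "g = iv u * (iv (n b) * (n b * u * g))"
      using uG g by (simp add: G_assoc G_mult n_G G_iv iv_left')
    also have "\<dots> = iv u * (iv m * (n b * k) * h)"
      unfolding hk m_def using G uG by (simp add: G_assoc G_mult n_G G_iv iv_left' iv_mult)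
    also have "iv m * (n b * k) * h = iv m * j * (m * (iv (n b) * (u' * h)))"
      unfolding j(3) m_def using G by (simp add: G_assoc G_mult n_G G_iv iv_right' iv_mult)
    also have "iv u * (iv m * j * (m * (iv (n b) * (u' * h)))) =
        (iv u * iv m * j * m) * (iv (n b) * (u' * h))"
      using G uG m by (simp add: G_assoc G_mult n_G G_iv)
    finally have "g = (iv u * iv m * j * m) * (iv (n b) * (u' * h))" .
    moreover have "iv u * iv m * j * m \<in> I" using u m j by (simp add: I_mult I_iv U_I)
    ultimately show "\<exists>h\<in>(\<lambda>(u, h). iv (n b) * (u * h)) ` (U b \<times> S). \<exists>k\<in>I. g = k * h"
      using j(1) hk(1) by (intro bexI[of _ "iv (n b) * (u' * h)"] bexI[of _ "iv u * iv m * j * m"]) (auto)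
  next
    fix k g assume "k \<in> I" "g \<in> G"
    then show "hop b f (k * g) = chi k * hop b f g"
      using f hop_equiv by (simp add: hop_def G_mult I_sub)
  next
    show "(\<lambda>(u, h). iv (n b) * (u * h)) ` (U b \<times> S) \<subseteq> G"
      using S(2) by (auto intro!: G_mult G_iv n_G dest: U_G)
  qed (use S(1) fin_U in \<open>auto simp: hop_def\<close>)
qed

lemma hop_Hend: "hop b \<in> A"
proof (rule HendI)
  fix f h assume "f \<in> V" "h \<in> V"
  then show "hop b (\<lambda>x. f x + h x) = (\<lambda>x. hop b f x + hop b h x)"
    by (auto simp: hop_def cind_add sum.distrib)
next
  fix c f assume "f \<in> V"
  then show "hop b (\<lambda>x. c * f x) = (\<lambda>x. c * hop b f x)"
    by (auto simp: hop_def cind_smult sum_distrib_left)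
next
  fix g f assume "g \<in> G" "f \<in> V"
  moreover have "n b * u * x * g = n b * u * (x * g) \<and> n b * u * x \<in> G"
    if "x \<in> G" "u \<in> U b" for x u
    using that U_G[OF that(2)] \<open>g \<in> G\<close> by (simp add: G_assoc G_mult n_G)
  ultimately show "hop b (rtr G g f) = rtr G g (hop b f)"
    by (simp add: fun_eq_iff hop_def cind_rtr rtr_apply G_mult)
qed (rule hop_cind, assumption, simp add: hop_def)

end

section \<open>Alternating words and the presentation\<close>

primrec word_prod :: "nat \<Rightarrow> (bool \<Rightarrow> 'e::field mat) \<Rightarrow> bool list \<Rightarrow> 'e mat" where
  "word_prod N n [] = 1\<^sub>m N"
| "word_prod N n (b # w) = n b * word_prod N n w"

text \<open>Alternating words are the reduced words of the infinite dihedral group; left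
  multiplication by \<open>b\<close> shortens \<open>w\<close> in the first case and lengthens it in
  the second.\<close>

lemma distinct_adj_Cons_cases:
  fixes w :: "bool list"
  assumes "distinct_adj w"
  obtains w' where "w = b # w'" "distinct_adj (b # w')" "distinct_adj w'" | "distinct_adj (b # w)"
  using assms by (cases w; cases "hd w = b") (auto simp: distinct_adj_Cons)

text \<open>\<open>word_U\<close> expresses that lengths add: when \<open>b # w\<close> is reduced,
  \<open>u\<close> moves past \<open>n_w\<close> into the kernel of \<open>chi\<close>. The other
  two assumptions are the Bruhat decomposition with respect to \<open>I\<close>.\<close>

locale dihedral_cosets = double_cosets N G I chi iv n U cf
  for N :: nat and G I :: "'e::field mat set" and chi :: "'e mat \<Rightarrow> 'c::field"
    and iv :: "'e mat \<Rightarrow> 'e mat" and n :: "bool \<Rightarrow> 'e mat" and U :: "bool \<Rightarrow> 'e mat set"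
    and cf :: "bool \<Rightarrow> 'e mat \<Rightarrow> 'c" +
  assumes word_U: "distinct_adj (b # w) \<Longrightarrow> u \<in> U b \<Longrightarrow>
        \<exists>k\<in>I. chi k = 1 \<and> u * word_prod N n w = word_prod N n w * k"
    and word_disjoint: "distinct_adj w \<Longrightarrow> distinct_adj w' \<Longrightarrow> k \<in> I \<Longrightarrow> k' \<in> I \<Longrightarrow>
        word_prod N n w = k * word_prod N n w' * k' \<Longrightarrow> w = w'"
    and word_cover: "g \<in> G \<Longrightarrow> \<exists>w. \<exists>k\<in>I. \<exists>k'\<in>I. distinct_adj w \<and> g = k * word_prod N n w * k'"
begin

abbreviation "wp \<equiv> word_prod N n"

lemma wp_G: "wp w \<in> G"
  by (induction w) (auto simp: one_G G_mult n_G)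

section \<open>Coefficients at alternating words\<close>

definition coef :: "bool list \<Rightarrow> ('e, 'c) endo \<Rightarrow> 'c" where
  "coef w T = T delta (wp w)"

lemma coef_eadd: "coef w (eadd S T) = coef w S + coef w T"
  and coef_esmul: "coef w (esmul c T) = c * coef w T"
  and coef_ezero: "coef w ezero = 0"
  by (simp_all add: coef_def eadd_def esmul_def ezero_def)

lemma delta_double_coset:
  assumes T: "T \<in> A" and k: "k \<in> I" "k' \<in> I"
  shows "T delta (k * wp w * k') = chi k * coef w T * chi k'"
  using assms by (simp add: Hend_delta_right Hend_delta_left coef_def G_mult I_sub wp_G)

lemma coef_eqI:
  assumes S: "S \<in> A" and T: "T \<in> A" and eq: "\<And>w. distinct_adj w \<Longrightarrow> coef w S = coef w T"
  shows "S = T"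
proof (rule Hend_eqI[OF S T])
  show "S delta = T delta"
  proof
    fix g
    show "S delta g = T delta g"
    proof (cases "g \<in> G")
      case True
      then obtain w k k' where "k \<in> I" "k' \<in> I" "distinct_adj w" "g = k * wp w * k'"
        using word_cover by blast
      then show ?thesis using eq by (simp add: delta_double_coset S T)
    next
      case False
      then show ?thesis using cind_outside Hend_range S T by metis
    qed
  qed
qed

lemma coef_eid: "distinct_adj w \<Longrightarrow> coef w (eid V) = (if w = [] then 1 else 0)"
proof -
  assume w: "distinct_adj w"
  have "w = []" if "wp w \<in> I"
    using word_disjoint[of w "[]" "wp w" "1\<^sub>m N"] w that wp_G[of w] one_I by simp
  then show ?thesis
    using one_I chi_one delta_cind by (auto simp: coef_def eid_def oneI_def)
qed

definition "lincoef b = (\<Sum>u\<in>U b - {1\<^sub>m N}. cf b u)"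
definition "concoef b = (of_nat (card (U b)) :: 'c)"

lemma hop_coef: "T \<in> A \<Longrightarrow> coef w (hop b \<circ> T) = (\<Sum>u\<in>U b. T delta (n b * u * wp w))"
  by (simp add: coef_def hop_def Hend_range wp_G)

lemma delta_word_U:
  assumes T: "T \<in> A" and w: "distinct_adj (b # w)" and u: "u \<in> U b"
  shows "T delta (n b * (u * wp w)) = coef (b # w) T"
proof -
  obtain k where k: "k \<in> I" "chi k = 1" "u * wp w = wp w * k"
    using word_U[OF w u] by blast
  then have "n b * (u * wp w) = wp (b # w) * k"
    by (simp add: G_assoc n_G wp_G I_sub)
  then show ?thesis using k T by (simp only: Hend_delta_right wp_G coef_def) simp
qed

text \<open>All cosets contribute the same value, because each \<open>u\<close> moves past
  \<open>n_w\<close> when \<open>b # w\<close> is reduced.\<close>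

lemma coef_hop_ascend:
  assumes T: "T \<in> A" and w: "distinct_adj (b # w)"
  shows "coef w (hop b \<circ> T) = concoef b * coef (b # w) T"
  using delta_word_U[OF T w]
  by (simp add: hop_coef T concoef_def G_assoc n_G wp_G U_G)

text \<open>The trivial coset leads to \<open>n_b^2 n_w\<close>, which counts as \<open>n_w\<close>.
  A nontrivial \<open>u\<close> stays at the same word: \<open>n_b u n_b = k n_b k'\<close>, then
  \<open>U_cover\<close> pushes \<open>k'\<close> through \<open>n_b\<close>, and the new
  representative is absorbed by \<open>n_w\<close>.\<close>

lemma coef_hop_descend:
  assumes T: "T \<in> A" and w: "distinct_adj (b # w)"
  shows "coef (b # w) (hop b \<circ> T) = coef w T + lincoef b * coef (b # w) T"
proof -
  let ?F = "T delta"
  have 1: "?F (n b * 1\<^sub>m N * wp (b # w)) = coef w T"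
  proof -
    have "n b * 1\<^sub>m N * wp (b # w) = (n b * n b) * wp w"
      by (simp add: n_G G_assoc wp_G)
    then show ?thesis
      using Hend_delta_left[OF T wp_G[of w] n_sq_I[of b]] chi_n_sq[of b] by (simp add: coef_def)
  qed
  have 2: "?F (n b * u * wp (b # w)) = cf b u * coef (b # w) T" if u: "u \<in> U b - {1\<^sub>m N}" for u
  proof -
    obtain k k' where k: "k \<in> I" "k' \<in> I" "n b * u * n b = k * n b * k'" "chi k * chi k' = cf b u"
      using U_nontriv u by blast
    obtain u' j where j: "u' \<in> U b" "j \<in> I" "chi j = chi k'" "n b * k' = j * (n b * u')"
      using U_cover k(2) by blast
    have G: "k \<in> G" "k' \<in> G" "u' \<in> G" "j \<in> G" "u \<in> G" using k(1,2) j(1,2) u I_sub U_G by auto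
    have "n b * u * wp (b # w) = (n b * u * n b) * wp w"
      using G by (simp add: G_assoc n_G wp_G G_mult)
    also have "\<dots> = k * ((n b * k') * wp w)"
      unfolding k(3) using G by (simp add: G_assoc n_G wp_G G_mult)
    also have "\<dots> = (k * j) * (n b * (u' * wp w))"
      unfolding j(4) using G by (simp add: G_assoc n_G wp_G G_mult)
    finally have "?F (n b * u * wp (b # w)) = chi (k * j) * ?F (n b * (u' * wp w))"
      using k j G by (simp add: Hend_delta_left T I_mult G_mult n_G wp_G)
    then show ?thesis using delta_word_U[OF T w j(1)] k j by (simp add: chi_mult)
  qed
  have "coef (b # w) (hop b \<circ> T) = ?F (n b * 1\<^sub>m N * wp (b # w)) +
      (\<Sum>u\<in>U b - {1\<^sub>m N}. ?F (n b * u * wp (b # w)))"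
    unfolding hop_coef[OF T] by (rule sum.remove) (auto simp: fin_U one_U)
  also have "(\<Sum>u\<in>U b - {1\<^sub>m N}. ?F (n b * u * wp (b # w))) =
      (\<Sum>u\<in>U b - {1\<^sub>m N}. cf b u * coef (b # w) T)"
    by (rule sum.cong[OF refl 2])
  finally show ?thesis unfolding 1 lincoef_def sum_distrib_right .
qed

lemma coef_hop:
  assumes "distinct_adj w"
  shows "coef w (hop b) = (if w = [b] then 1 else 0)"
proof -
  have *: "hop b \<circ> eid V = hop b" by (rule comp_eid[OF hop_Hend])
  show ?thesis
  proof (cases rule: distinct_adj_Cons_cases[OF assms, of b])
    case (1 w')
    then show ?thesis using coef_hop_descend[OF eid_Hend 1(2)] by (simp add: * coef_eid)
  next
    case 2
    then show ?thesis using coef_hop_ascend[OF eid_Hend 2] by (auto simp: * coef_eid)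
  qed
qed

text \<open>In the recursion with \<open>T = hop b\<close> only the words \<open>[b]\<close> and
  \<open>[]\<close> survive, since the single nonzero coefficient of \<open>hop b\<close> is the 1
  at \<open>[b]\<close>.\<close>

lemma hop_quadratic: "hop b \<circ> hop b = eadd (esmul (lincoef b) (hop b)) (esmul (concoef b) (eid V))"
proof (rule coef_eqI)
  fix w :: "bool list" assume w: "distinct_adj w"
  show "coef w (hop b \<circ> hop b) = coef w (eadd (esmul (lincoef b) (hop b)) (esmul (concoef b) (eid V)))"
  proof (cases rule: distinct_adj_Cons_cases[OF w, of b])
    case (1 w')
    then show ?thesis using coef_hop_descend[OF hop_Hend 1(2)]
      by (auto simp: coef_eadd coef_esmul coef_hop coef_eid w distinct_adj_Cons)
  next
    case 2
    then show ?thesis using coef_hop_ascend[OF hop_Hend 2]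
      by (auto simp: coef_eadd coef_esmul coef_hop coef_eid w)
  qed
qed (auto intro!: comp_Hend eadd_Hend esmul_Hend hop_Hend eid_Hend)

lemma is_Tn_hop: "is_Tn G I chi (n b) (hop b)"
  unfolding is_Tn_def
proof (intro conjI allI impI ballI hop_Hend)
  have [simp]: "distinct_adj [b]" by simp
  have n: "n b = wp [b]" by (simp add: n_G)
  show "hop b delta (n b) = 1" using coef_hop[of "[b]" b] unfolding n coef_def by simp
  fix g assume *: "\<not> (\<exists>k1\<in>I. \<exists>k2\<in>I. g = k1 * n b * k2)"
  show "hop b delta g = 0"
  proof (cases "g \<in> G")
    case True
    then obtain w k k' where w: "k \<in> I" "k' \<in> I" "distinct_adj w" "g = k * wp w * k'"
      using word_cover by blast
    then have "w \<noteq> [b]" using * n by metis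
    then show ?thesis using w by (simp add: delta_double_coset hop_Hend coef_hop)
  qed (simp add: hop_def)
next
  fix k1 k2 g assume "k1 \<in> I" "k2 \<in> I" "g \<in> G"
  then show "hop b delta (k1 * g * k2) = chi k1 * hop b delta g * chi k2"
    using hop_Hend[of b] by (simp add: Hend_delta_right Hend_delta_left G_mult I_sub)
qed

text \<open>The conditions on support and normalization fix every coefficient. So the endomorphisms
  described in the theorem are the explicit sums \<open>hop b\<close>, and everything may be proved
  for these.\<close>

lemma is_Tn_unique:
  assumes T: "is_Tn G I chi (n b) T" shows "T = hop b"
proof (rule coef_eqI)
  show "T \<in> A" using T by (simp add: is_Tn_def)
  have n: "n b = wp [b]" by (simp add: n_G)
  fix w :: "bool list" assume w: "distinct_adj w"
  show "coef w T = coef w (hop b)"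
  proof (cases "w = [b]")
    case True
    then show ?thesis using T coef_hop[OF w] by (simp add: is_Tn_def coef_def n_G)
  next
    case False
    have "\<not> (\<exists>k1\<in>I. \<exists>k2\<in>I. wp w = k1 * n b * k2)"
      using word_disjoint[of w "[b]"] False w unfolding n by auto
    then show ?thesis using T coef_hop[OF w] False by (simp add: is_Tn_def coef_def)
  qed
qed (rule hop_Hend)

section \<open>Alternating words as a basis\<close>

declare wordev.simps(2) [simp del]

abbreviation "wop \<equiv> wordev V (hop True) (hop False)"

lemma wop_Cons: "wop (b # w) = hop b \<circ> wop w"
  by (cases b) (simp_all add: wordev.simps(2))

lemma wop_Hend: "wop w \<in> A"
proof (induction w)
  case (Cons b w) then show ?case unfolding wop_Cons by (rule comp_Hend[OF hop_Hend])
qed (simp add: eid_Hend)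

lemma wop_append: "wop (u @ v) = wop u \<circ> wop v"
proof (induction u)
  case Nil then show ?case using eid_comp[OF wop_Hend] by simp
next
  case (Cons b u) then show ?case unfolding append_Cons wop_Cons by (simp add: comp_assoc)
qed

text \<open>If \<open>w\<close> starts with \<open>b\<close>, the recursion strips this letter from
  both words, and the linear term vanishes because \<open>v\<close> does not start with
  \<open>b\<close>. Otherwise \<open>b # w\<close> differs from \<open>v\<close>, and both sides are
  zero.\<close>

lemma coef_wop:
  assumes "distinct_adj w" "distinct_adj v"
  shows "coef w (wop v) = (if w = v then 1 else 0)"
  using assms
proof (induction v arbitrary: w)
  case Nil then show ?case by (simp add: coef_eid)
next
  case (Cons b v)
  have v: "distinct_adj v" using Cons.prems by (auto simp: distinct_adj_Cons)
  show ?case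
  proof (cases rule: distinct_adj_Cons_cases[OF Cons.prems(1), of b])
    case (1 w')
    then have "coef w (wop (b # v)) = coef w' (wop v) + lincoef b * coef w (wop v)"
      unfolding wop_Cons using coef_hop_descend[OF wop_Hend 1(2)] by blast
    moreover have "w \<noteq> v" using 1 Cons.prems by (auto simp: distinct_adj_Cons)
    ultimately show ?thesis using 1 Cons.prems(1) v by (simp add: Cons.IH)
  next
    case 2
    then have "coef w (wop (b # v)) = concoef b * coef (b # w) (wop v)"
      unfolding wop_Cons using coef_hop_ascend[OF wop_Hend 2] by blast
    moreover have "b # w \<noteq> v" "w \<noteq> b # v" using 2 Cons.prems by (auto simp: distinct_adj_Cons)
    ultimately show ?thesis using 2 Cons.prems(1) v by (simp add: Cons.IH)
  qed
qed

text \<open>\<open>T delta\<close> is supported on finitely many cosets \<open>I h\<close>, and each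
  of them lies in a single double coset \<open>I n_w I\<close>.\<close>

lemma finite_coef:
  assumes T: "T \<in> A" shows "finite {w. distinct_adj w \<and> coef w T \<noteq> 0}"
proof -
  obtain S where S: "finite S" "S \<subseteq> G"
    "\<And>g. g \<in> G \<Longrightarrow> T delta g \<noteq> 0 \<Longrightarrow> \<exists>h\<in>S. \<exists>k\<in>I. g = k * h"
    using cind_supp[OF Hend_range[OF T]] by blast
  have "\<forall>h\<in>S. \<exists>w. \<exists>k\<in>I. \<exists>k'\<in>I. distinct_adj w \<and> h = k * wp w * k'"
    using S(2) word_cover by blast
  then obtain W where W: "\<And>h. h \<in> S \<Longrightarrow> \<exists>k\<in>I. \<exists>k'\<in>I. distinct_adj (W h) \<and> h = k * wp (W h) * k'"
    by metis
  have "{w. distinct_adj w \<and> coef w T \<noteq> 0} \<subseteq> W ` S"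
  proof
    fix w assume "w \<in> {w. distinct_adj w \<and> coef w T \<noteq> 0}"
    then have w: "distinct_adj w" "T delta (wp w) \<noteq> 0" by (auto simp: coef_def)
    obtain h k where h: "h \<in> S" "k \<in> I" "wp w = k * h" using S(3)[OF wp_G w(2)] by blast
    obtain k1 k2 where k: "k1 \<in> I" "k2 \<in> I" "distinct_adj (W h)" "h = k1 * wp (W h) * k2"
      using W[OF h(1)] by blast
    have "wp w = (k * k1) * wp (W h) * k2"
      using h(2) k(1,2) unfolding h(3) by (subst k(4)) (simp add: G_assoc G_mult I_sub wp_G)
    then have "w = W h" using word_disjoint w k h(2) I_mult by blast
    then show "w \<in> W ` S" using h by blast
  qed
  then show ?thesis using S(1) finite_subset by blast
qed

section \<open>Evaluation of noncommutative polynomials\<close>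

abbreviation "nce \<equiv> nceval V (hop True) (hop False)"

lemma lincomb_Hend:
  assumes "finite S" "\<And>i. i \<in> S \<Longrightarrow> F i \<in> A"
  shows "(\<lambda>f x. \<Sum>i\<in>S. c i * F i f x) \<in> A"
  using assms
proof (induction S)
  case empty then show ?case using ezero_Hend by (simp add: ezero_def)
next
  case (insert i S)
  then have "eadd (esmul (c i) (F i)) (\<lambda>f x. \<Sum>i\<in>S. c i * F i f x) \<in> A"
    by (auto intro!: eadd_Hend esmul_Hend)
  then show ?case using insert by (simp add: eadd_def esmul_def)
qed

lemma coef_lincomb: "coef w (\<lambda>f x. \<Sum>i\<in>S. c i * F i f x) = (\<Sum>i\<in>S. c i * coef w (F i))"
  by (simp add: coef_def)

lemma nceval_superset:
  assumes "finite S" "\<And>w. p w \<noteq> 0 \<Longrightarrow> w \<in> S"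
  shows "nce p = (\<lambda>f x. \<Sum>w\<in>S. p w * wop w f x)"
  unfolding nceval_def using assms by (intro ext sum.mono_neutral_left) auto

lemma nceval_Hend: "p \<in> ncpolys \<Longrightarrow> nce p \<in> A"
  unfolding nceval_def by (rule lincomb_Hend) (auto simp: ncpolys_def wop_Hend)

lemma coef_nceval:
  assumes "p \<in> ncpolys" "\<And>w. p w \<noteq> 0 \<Longrightarrow> distinct_adj w" "distinct_adj w"
  shows "coef w (nce p) = p w"
proof -
  have "coef w (nce p) = (\<Sum>v\<in>{v. p v \<noteq> 0}. p v * (if w = v then 1 else 0))"
    unfolding nceval_def coef_lincomb by (rule sum.cong) (use assms in \<open>auto simp: coef_wop\<close>)
  also have "\<dots> = p w" using assms(1) by (auto simp: ncpolys_def sum.delta if_distrib cong: if_cong)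
  finally show ?thesis .
qed

text \<open>By duality of \<open>coef\<close> and \<open>wop\<close>, the coefficients of
  \<open>T\<close> are themselves the polynomial that evaluates to \<open>T\<close>;
  \<open>finite_coef\<close> makes it finitely supported.\<close>

lemma nceval_coef:
  assumes "T \<in> A"
  defines "p \<equiv> \<lambda>w. if distinct_adj w then coef w T else 0"
  shows "p \<in> ncpolys" "nce p = T"
proof -
  have "{w. p w \<noteq> 0} = {w. distinct_adj w \<and> coef w T \<noteq> 0}" by (auto simp: p_def)
  then show p: "p \<in> ncpolys" using finite_coef[OF assms(1)] by (simp add: ncpolys_def)
  show "nce p = T"
  proof (rule coef_eqI[OF nceval_Hend[OF p] assms(1)])
    fix w :: "bool list" assume w: "distinct_adj w"
    have "coef w (nce p) = p w" by (rule coef_nceval[OF p _ w]) (simp add: p_def split: if_splits)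
    then show "coef w (nce p) = coef w T" using w by (simp add: p_def)
  qed
qed

lemma nceval_image: "nce ` ncpolys = A"
proof
  show "A \<subseteq> nce ` ncpolys" using nceval_coef by (intro subsetI image_eqI[OF sym]) auto
qed (auto intro: nceval_Hend)

lemma ncpolys_lin: "p \<in> ncpolys \<Longrightarrow> r \<in> ncpolys \<Longrightarrow> (\<lambda>w. p w + c * r w) \<in> ncpolys"
  unfolding ncpolys_def
  by (rule CollectI, rule finite_subset[of _ "{w. p w \<noteq> 0} \<union> {w. r w \<noteq> 0}"]) auto

lemma nceval_lin:
  assumes "p \<in> ncpolys" "r \<in> ncpolys"
  shows "nce (\<lambda>w. p w + c * r w) = eadd (nce p) (esmul c (nce r))"
proof -
  let ?S = "{w. p w \<noteq> 0} \<union> {w. r w \<noteq> 0}"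
  have fin: "finite ?S" using assms by (simp add: ncpolys_def)
  have 1: "nce (\<lambda>w. p w + c * r w) = (\<lambda>f x. \<Sum>w\<in>?S. (p w + c * r w) * wop w f x)"
    by (rule nceval_superset[OF fin]) auto
  have 2: "nce p = (\<lambda>f x. \<Sum>w\<in>?S. p w * wop w f x)" by (rule nceval_superset[OF fin]) auto
  have 3: "nce r = (\<lambda>f x. \<Sum>w\<in>?S. r w * wop w f x)" by (rule nceval_superset[OF fin]) auto
  show ?thesis unfolding 1 2 3
    by (simp add: eadd_def esmul_def fun_eq_iff sum.distrib sum_distrib_left algebra_simps)
qed

text \<open>Cut positions of \<open>w\<close> correspond to factorizations of \<open>w\<close>.
  Indexing these by pairs from fixed finite sets lets the sum over all \<open>w\<close> be regrouped
  in \<open>nceval_ncmul\<close>.\<close>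

lemma ncmul_eq_sum:
  assumes "finite P" "finite R" "\<And>u. p u \<noteq> 0 \<Longrightarrow> u \<in> P" "\<And>u. r u \<noteq> 0 \<Longrightarrow> u \<in> R"
  shows "ncmul p r w = (\<Sum>z\<in>{z \<in> P \<times> R. fst z @ snd z = w}. p (fst z) * r (snd z))"
proof -
  have "ncmul p r w = (\<Sum>z\<in>(\<lambda>i. (take i w, drop i w)) ` {..length w}. p (fst z) * r (snd z))"
    unfolding ncmul_def
  proof (subst sum.reindex)
    show "inj_on (\<lambda>i. (take i w, drop i w)) {..length w}"
      by (rule inj_onI) (metis Pair_inject atMost_iff length_take min.absorb2)
  qed simp
  also have "\<dots> = (\<Sum>z\<in>{z \<in> P \<times> R. fst z @ snd z = w}. p (fst z) * r (snd z))"
  proof (rule sum.mono_neutral_right)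
    show "{z \<in> P \<times> R. fst z @ snd z = w} \<subseteq> (\<lambda>i. (take i w, drop i w)) ` {..length w}"
    proof
      fix z assume "z \<in> {z \<in> P \<times> R. fst z @ snd z = w}"
      then show "z \<in> (\<lambda>i. (take i w, drop i w)) ` {..length w}"
        by (intro image_eqI[of _ _ "length (fst z)"]) auto
    qed
  qed (use assms(3,4) in auto)
  finally show ?thesis .
qed

lemma ncmul_ncpolys: "p \<in> ncpolys \<Longrightarrow> r \<in> ncpolys \<Longrightarrow> ncmul p r \<in> ncpolys"
proof -
  assume pr: "p \<in> ncpolys" "r \<in> ncpolys"
  let ?P = "{w. p w \<noteq> 0}" and ?R = "{w. r w \<noteq> 0}"
  have "{w. ncmul p r w \<noteq> 0} \<subseteq> (\<lambda>z. fst z @ snd z) ` (?P \<times> ?R)"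
  proof
    fix w assume "w \<in> {w. ncmul p r w \<noteq> 0}"
    then have "(\<Sum>z\<in>{z \<in> ?P \<times> ?R. fst z @ snd z = w}. p (fst z) * r (snd z)) \<noteq> 0"
      using ncmul_eq_sum[of ?P ?R p r w] pr by (simp add: ncpolys_def)
    then obtain z where "z \<in> {z \<in> ?P \<times> ?R. fst z @ snd z = w}"
      by (rule sum.not_neutral_contains_not_neutral)
    then show "w \<in> (\<lambda>z. fst z @ snd z) ` (?P \<times> ?R)" by auto
  qed
  then show ?thesis using pr by (auto simp: ncpolys_def elim!: finite_subset)
qed

lemma nceval_ncmul:
  assumes "p \<in> ncpolys" "r \<in> ncpolys"
  shows "nce (ncmul p r) = nce p \<circ> nce r"
proof (intro ext)
  fix f x
  let ?P = "{w. p w \<noteq> 0}" and ?R = "{w. r w \<noteq> 0}"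
  let ?h = "\<lambda>z. p (fst z) * r (snd z) * wop (fst z @ snd z) f x"
  have fin: "finite ?P" "finite ?R" using assms by (auto simp: ncpolys_def)
  let ?S = "(\<lambda>z. fst z @ snd z) ` (?P \<times> ?R)"
  have m: "ncmul p r w = (\<Sum>z\<in>{z \<in> ?P \<times> ?R. fst z @ snd z = w}. p (fst z) * r (snd z))" for w
    by (rule ncmul_eq_sum) (use fin in auto)
  have S: "w \<in> ?S" if "ncmul p r w \<noteq> 0" for w
  proof -
    obtain z where "z \<in> {z \<in> ?P \<times> ?R. fst z @ snd z = w}"
      using \<open>ncmul p r w \<noteq> 0\<close> unfolding m by (rule sum.not_neutral_contains_not_neutral)
    then show ?thesis by auto
  qed
  have "nce (ncmul p r) f x = (\<Sum>w\<in>?S. ncmul p r w * wop w f x)"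
    by (subst nceval_superset[OF _ S]) (use fin in auto)
  also have "\<dots> = (\<Sum>w\<in>?S. \<Sum>z\<in>{z \<in> ?P \<times> ?R. fst z @ snd z = w}. ?h z)"
    unfolding m sum_distrib_right by (intro sum.cong refl) auto
  also have "\<dots> = (\<Sum>z\<in>?P \<times> ?R. ?h z)" by (rule sum.group) (use fin in auto)
  also have "\<dots> = (\<Sum>u\<in>?P. \<Sum>v\<in>?R. p u * r v * wop u (wop v f) x)"
    by (simp add: sum.cartesian_product case_prod_beta wop_append)
  also have "\<dots> = (\<Sum>u\<in>?P. p u * wop u (nce r f) x)"
  proof (intro sum.cong refl)
    fix u
    have "wop u (nce r f) = (\<lambda>x. \<Sum>v\<in>?R. r v * wop u (wop v f) x)"
      unfolding nceval_def by (rule Hend_sum[OF wop_Hend fin(2)]) (simp add: Hend_range wop_Hend)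
    then show "(\<Sum>v\<in>?R. p u * r v * wop u (wop v f) x) = p u * wop u (nce r f) x"
      by (simp add: sum_distrib_left algebra_simps)
  qed
  finally show "nce (ncmul p r) f x = (nce p \<circ> nce r) f x" by (simp add: nceval_def)
qed

section \<open>Normal forms modulo the quadratic relations\<close>

definition qrel :: "bool \<Rightarrow> bool list \<Rightarrow> 'c" where
  "qrel b = (\<lambda>w. ncword [b, b] w - lincoef b * ncword [b] w - concoef b * ncword [] w)"

abbreviation "J \<equiv> nc_ideal {qrel True, qrel False}"

lemma ncword_ncpolys: "ncword u \<in> ncpolys"
  by (simp add: ncword_def ncpolys_def)

lemma qrel_ncpolys: "qrel b \<in> ncpolys"
proof -
  have "{w. qrel b w \<noteq> 0} \<subseteq> {[b, b], [b], []}" by (auto simp: qrel_def ncword_def split: if_splits)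
  then show ?thesis unfolding ncpolys_def using finite_subset by blast
qed

lemma nceval_qrel: "nce (qrel b) = ezero"
proof -
  have "nce (qrel b) = (\<lambda>f x. \<Sum>w\<in>{[b, b], [b], []}. qrel b w * wop w f x)"
    by (rule nceval_superset) (auto simp: qrel_def ncword_def split: if_splits)
  also have "\<dots> = ezero"
  proof (intro ext)
    fix f x
    have "hop b (eid V f) = hop b f" using fun_cong[OF comp_eid[OF hop_Hend[of b]], of f] by simp
    then have b: "wop [b] f = hop b f" "wop [b, b] f = hop b (hop b f)"
      by (simp_all add: wop_Cons)
    have "hop b (hop b f) x = lincoef b * hop b f x + concoef b * eid V f x"
      using fun_cong[OF fun_cong[OF hop_quadratic[of b]], of f x] by (simp add: eadd_def esmul_def)
    then show "(\<Sum>w\<in>{[b, b], [b], []}. qrel b w * wop w f x) = ezero f x"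
      by (simp add: b qrel_def ncword_def ezero_def)
  qed
  finally show ?thesis .
qed

lemma ideal_nceval: "a \<in> J \<Longrightarrow> a \<in> ncpolys \<and> nce a = ezero"
proof (induction rule: nc_ideal.induct)
  case (gen r)
  then show ?case using qrel_ncpolys nceval_qrel by auto
next
  case (add a b)
  then show ?case using ncpolys_lin[of a b 1] nceval_lin[of a b 1]
    by (simp add: ncadd_def eadd_def esmul_def ezero_def)
next
  case (lmul a u)
  then show ?case using Hend_zero[OF nceval_Hend, of u]
    by (simp add: ncmul_ncpolys nceval_ncmul) (simp add: ezero_def comp_def)
next
  case (rmul a u)
  then show ?case by (simp add: ncmul_ncpolys nceval_ncmul) (simp add: ezero_def comp_def)
qed

lemma ncmul_ncword:
  "ncmul (ncword u) a w = (if take (length u) w = u then a (drop (length u) w) else 0)"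
proof -
  have *: "take i w \<noteq> u" if "i \<le> length w" "i \<noteq> length u" for i
    using that by auto
  have "ncmul (ncword u) a w =
      (\<Sum>i\<le>length w. if i = length u then (if take (length u) w = u then a (drop (length u) w) else 0) else 0)"
    unfolding ncmul_def by (rule sum.cong) (auto simp: ncword_def *)
  also have "\<dots> = (if take (length u) w = u then a (drop (length u) w) else 0)"
  proof (cases "length u \<le> length w")
    case False
    then have "take (length u) w \<noteq> u" using arg_cong[of "take (length u) w" u length] by auto
    then show ?thesis by simp
  qed (simp add: sum.delta)
  finally show ?thesis .
qed

lemma ncmul_ncword_ncword: "ncmul (ncword u) (ncword v) = ncword (u @ v)"
proof
  fix w
  have "take (length u) w = u \<and> drop (length u) w = v \<longleftrightarrow> w = u @ v"
    using append_eq_conv_conj[of u v w] by auto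
  then show "ncmul (ncword u) (ncword v) w = ncword (u @ v) w"
    unfolding ncmul_ncword by (auto simp: ncword_def)
qed

lemma ncmul_lin_left:
  "ncmul (\<lambda>w. p w + c * p' w) r = (\<lambda>w. ncmul p r w + c * ncmul p' r w)"
  by (simp add: ncmul_def fun_eq_iff algebra_simps sum.distrib sum_distrib_left)

lemma ncmul_lin_right:
  "ncmul p (\<lambda>w. r w + c * r' w) = (\<lambda>w. ncmul p r w + c * ncmul p r' w)"
  by (simp add: ncmul_def fun_eq_iff algebra_simps sum.distrib sum_distrib_left)

text \<open>The constructors of \<open>nc_ideal\<close> offer only sums and polynomial factors, so a
  scalar enters as left multiplication by \<open>c\<close> times the empty word.\<close>

lemma ideal_smult: assumes "a \<in> J" shows "(\<lambda>w. c * a w) \<in> J"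
proof -
  have 0: "(\<lambda>w. 0) \<in> ncpolys" by (simp add: ncpolys_def)
  have "ncmul (\<lambda>w. 0 + c * ncword [] w) a = (\<lambda>w. c * a w)"
    by (simp only: ncmul_lin_left) (simp add: ncmul_ncword, simp add: ncmul_def)
  then show ?thesis using nc_ideal.lmul[OF assms ncpolys_lin[OF 0 ncword_ncpolys]] by metis
qed

lemma ideal_lin: "a \<in> J \<Longrightarrow> b \<in> J \<Longrightarrow> (\<lambda>w. a w + c * b w) \<in> J"
  using nc_ideal.add[OF _ ideal_smult] by (simp add: ncadd_def)

lemma ideal_zero: "(\<lambda>w. 0) \<in> J"
  using ideal_smult[OF nc_ideal.gen, of "qrel True" 0] by simp

text \<open>Existence of a normal form: a combination of alternating words in the same class modulo
  the relations.\<close>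

definition reducible :: "(bool list \<Rightarrow> 'c) \<Rightarrow> bool" where
  "reducible p \<longleftrightarrow> (\<exists>p'\<in>ncpolys. (\<forall>w. p' w \<noteq> 0 \<longrightarrow> distinct_adj w) \<and> (\<lambda>w. p w - p' w) \<in> J)"

lemma reducible_lin:
  assumes "reducible p" "reducible r" shows "reducible (\<lambda>w. p w + c * r w)"
proof -
  obtain p' where p: "p' \<in> ncpolys" "\<And>w. p' w \<noteq> 0 \<Longrightarrow> distinct_adj w" "(\<lambda>w. p w - p' w) \<in> J"
    using assms(1) by (auto simp: reducible_def)
  obtain r' where r: "r' \<in> ncpolys" "\<And>w. r' w \<noteq> 0 \<Longrightarrow> distinct_adj w" "(\<lambda>w. r w - r' w) \<in> J"
    using assms(2) by (auto simp: reducible_def)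
  have "(\<lambda>w. (p w + c * r w) - (p' w + c * r' w)) \<in> J"
    using ideal_lin[OF p(3) r(3), of c] by (simp add: algebra_simps)
  moreover have "distinct_adj w" if "p' w + c * r' w \<noteq> 0" for w
    using that p(2) r(2) by (metis add.right_neutral mult_zero_right)
  ultimately show ?thesis unfolding reducible_def
    by (intro bexI[of _ "\<lambda>w. p' w + c * r' w"] conjI allI impI ncpolys_lin p(1) r(1)) auto
qed

lemma reducible_zero: "reducible (\<lambda>w. 0)"
  unfolding reducible_def
  by (rule bexI[of _ "\<lambda>w. 0"]) (simp_all add: ncpolys_def ideal_zero)

lemma reducible_mod:
  assumes "reducible r" "(\<lambda>w. p w - r w) \<in> J" shows "reducible p"
proof -
  obtain r' where r: "r' \<in> ncpolys" "\<forall>w. r' w \<noteq> 0 \<longrightarrow> distinct_adj w" "(\<lambda>w. r w - r' w) \<in> J"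
    using assms(1) by (auto simp: reducible_def)
  then show ?thesis using ideal_lin[OF assms(2) r(3), of 1] by (auto simp: reducible_def)
qed

text \<open>The step adds only words from the support of the given \<open>p\<close>; in
  \<open>reducible_ncword\<close> this is what guarantees that they alternate.\<close>

lemma ncpoly_induct:
  assumes "p \<in> ncpolys" "P (\<lambda>w. 0)"
    and "\<And>r c w. P r \<Longrightarrow> p w \<noteq> 0 \<Longrightarrow> P (\<lambda>v. r v + c * ncword w v)"
  shows "P p"
proof -
  have "P (\<lambda>v. if v \<in> S then p v else 0)" if "finite S" "S \<subseteq> {w. p w \<noteq> 0}" for S
    using that
  proof (induction S)
    case empty then show ?case using assms(2) by simp
  next
    case (insert w S)
    have "(\<lambda>v. if v \<in> insert w S then p v else 0) =
        (\<lambda>v. (if v \<in> S then p v else 0) + p w * ncword w v)"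
      using insert by (auto simp: ncword_def)
    then show ?case using insert assms(3)[OF insert.IH, of w "p w"] by auto
  qed
  moreover have "finite {w. p w \<noteq> 0}" using assms(1) by (simp add: ncpolys_def)
  ultimately have "P (\<lambda>v. if v \<in> {w. p w \<noteq> 0} then p v else 0)" by blast
  moreover have "(\<lambda>v. if v \<in> {w. p w \<noteq> 0} then p v else 0) = p" by auto
  ultimately show ?thesis by (simp only:)
qed

lemma reducible_reduced: "distinct_adj w \<Longrightarrow> reducible (ncword w)"
  unfolding reducible_def
  using ncword_ncpolys[of w] ideal_zero by (intro bexI[of _ "ncword w"]) (auto simp: ncword_def)

text \<open>If \<open>v = b # v'\<close>, then \<open>qrel b\<close> multiplied on the right by
  \<open>v'\<close> rewrites \<open>b # v\<close> in terms of \<open>v\<close> and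
  \<open>v'\<close>, which are both alternating.\<close>

lemma reducible_Cons:
  assumes "distinct_adj v" shows "reducible (ncword (b # v))"
proof (cases rule: distinct_adj_Cons_cases[OF assms, of b])
  case (1 v')
  have q: "qrel b = (\<lambda>w. (ncword [b, b] w + (- lincoef b) * ncword [b] w) + (- concoef b) * ncword [] w)"
    by (simp add: qrel_def fun_eq_iff)
  have "ncmul (qrel b) (ncword v') \<in> J"
    by (rule nc_ideal.rmul[OF nc_ideal.gen ncword_ncpolys]) (cases b, auto)
  also have "ncmul (qrel b) (ncword v') = (\<lambda>w. ncword (b # v) w -
      ((0 + lincoef b * ncword v w) + concoef b * ncword v' w))"
    unfolding q ncmul_lin_left ncmul_ncword_ncword using 1 by (simp add: fun_eq_iff)
  finally show ?thesis
    by (rule reducible_mod[rotated]) (intro reducible_lin reducible_zero reducible_reduced 1(3) assms)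
qed (rule reducible_reduced)

text \<open>The tail is brought to normal form first; prefixing one letter to each of its
  alternating words is the case of \<open>reducible_Cons\<close>.\<close>

lemma reducible_ncword: "reducible (ncword w)"
proof (induction w)
  case Nil show ?case by (simp add: reducible_reduced)
next
  case (Cons b w)
  then obtain p where p: "p \<in> ncpolys" "\<And>w. p w \<noteq> 0 \<Longrightarrow> distinct_adj w" "(\<lambda>v. ncword w v - p v) \<in> J"
    by (auto simp: reducible_def)
  have "reducible (ncmul (ncword [b]) p)"
  proof (rule ncpoly_induct[OF p(1), where P = "\<lambda>p. reducible (ncmul (ncword [b]) p)"])
    show "reducible (ncmul (ncword [b]) (\<lambda>w. 0))" using reducible_zero by (simp add: ncmul_def)
    fix r c w assume "reducible (ncmul (ncword [b]) r)" "p w \<noteq> 0"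
    then show "reducible (ncmul (ncword [b]) (\<lambda>v. r v + c * ncword w v))"
      unfolding ncmul_lin_right ncmul_ncword_ncword
      by (intro reducible_lin) (auto intro: reducible_Cons p(2))
  qed
  moreover have "(\<lambda>v. ncword (b # w) v - ncmul (ncword [b]) p v) \<in> J"
  proof -
    have "(\<lambda>v. ncword w v + (- 1) * p v) \<in> J" using p(3) by simp
    from nc_ideal.lmul[OF this ncword_ncpolys[of "[b]"]] show ?thesis
      unfolding ncmul_lin_right ncmul_ncword_ncword by simp
  qed
  ultimately show ?case by (rule reducible_mod)
qed

text \<open>The evaluation of a normal form has the normal form as its coefficients. So if
  \<open>p\<close> evaluates to zero, its normal form is zero, which places \<open>p\<close> in the
  ideal.\<close>

lemma nceval_kernel:
  assumes "p \<in> ncpolys" shows "nce p = ezero \<longleftrightarrow> p \<in> J"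
proof
  assume 0: "nce p = ezero"
  have "reducible p"
    by (rule ncpoly_induct[OF assms]) (auto intro: reducible_zero reducible_lin reducible_ncword)
  then obtain p' where p': "p' \<in> ncpolys" "\<And>w. p' w \<noteq> 0 \<Longrightarrow> distinct_adj w" "(\<lambda>w. p w - p' w) \<in> J"
    by (auto simp: reducible_def)
  have "nce (\<lambda>w. p w + (- 1) * (p w - p' w)) = eadd (nce p) (esmul (- 1) (nce (\<lambda>w. p w - p' w)))"
    using assms ideal_nceval[OF p'(3)] by (intro nceval_lin) auto
  then have "nce p' = ezero"
    using 0 ideal_nceval[OF p'(3)] by (simp add: eadd_def esmul_def ezero_def)
  then have "p' w = 0" for w
    using coef_nceval[OF p'(1,2), of w] p'(2)[of w] by (auto simp: coef_ezero)
  then show "p \<in> J" using p'(3) by simp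
qed (simp add: ideal_nceval)

end

section \<open>The centre\<close>

lemma distinct_adj_last:
  fixes w :: "bool list"
  assumes "distinct_adj w" "w \<noteq> []" shows "last w = hd w \<longleftrightarrow> odd (length w)"
  using assms by (induction w) (auto simp: distinct_adj_Cons)

lemma distinct_adj_eqI:
  fixes w w' :: "bool list"
  assumes "distinct_adj w" "distinct_adj w'" "length w = length w'" "w \<noteq> [] \<Longrightarrow> hd w = hd w'"
  shows "w = w'"
  using assms
proof (induction w arbitrary: w')
  case (Cons b w)
  then obtain b' v where w': "w' = b' # v" by (cases w') auto
  have "w = v"
    by (rule Cons.IH) (use Cons.prems w' in \<open>auto simp: distinct_adj_Cons\<close>)
  then show ?case using Cons.prems w' by simp
qed simp

lemma distinct_adj_snoc_cases:
  fixes w :: "bool list"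
  assumes "distinct_adj w"
  obtains w' where "w = w' @ [b]" "distinct_adj (w' @ [b])" | "distinct_adj (w @ [b])"
  using assms
  by (cases w rule: rev_cases; cases "last w = b") (auto simp: distinct_adj_append_iff)

context dihedral_cosets
begin

lemma Hend_lin:
  "T \<in> A \<Longrightarrow> f \<in> V \<Longrightarrow> g \<in> V \<Longrightarrow> T (\<lambda>x. f x + c * g x) = (\<lambda>x. T f x + c * T g x)"
  using Hend_add[of T f "\<lambda>x. c * g x"] by (simp add: Hend_smult cind_smult)

lemma cind_lin: "f \<in> V \<Longrightarrow> g \<in> V \<Longrightarrow> (\<lambda>x. f x + c * g x) \<in> V"
  by (intro cind_add cind_smult)

lemma hop_hop: "f \<in> V \<Longrightarrow> hop b (hop b f) = (\<lambda>x. lincoef b * hop b f x + concoef b * f x)"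
  using fun_cong[OF hop_quadratic[of b], of f] by (simp add: eadd_def esmul_def eid_def)

definition Zop :: "('e, 'c) endo" where
  "Zop = eadd (hop True \<circ> eadd (hop False) (esmul (- lincoef False) (eid V)))
              (hop False \<circ> eadd (hop True) (esmul (- lincoef True) (eid V)))"

lemma Zop_Hend: "Zop \<in> A"
  unfolding Zop_def by (intro eadd_Hend comp_Hend esmul_Hend hop_Hend eid_Hend)

text \<open>\<open>Zop\<close> is symmetric in the two letters and may be expanded from either. The
  nesting and the factor \<open>1\<close> produce the shape \<open>f x + c * g x\<close> on which
  \<open>Hend_lin\<close> and \<open>cind_lin\<close> operate.\<close>

lemma Zop_apply:
  assumes f: "f \<in> V"
  shows "Zop f = (\<lambda>x. ((hop b (hop (\<not> b) f) x + (- lincoef (\<not> b)) * hop b f x) + 1 * hop (\<not> b) (hop b f) x)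
      + (- lincoef b) * hop (\<not> b) f x)"
proof -
  have *: "hop c (eadd (hop d) (esmul (- lincoef d) (eid V)) f) =
      (\<lambda>x. hop c (hop d f) x + (- lincoef d) * hop c f x)" for c d
    using Hend_lin[OF hop_Hend[of c] Hend_cind[OF hop_Hend[of d] f] f, of "- lincoef d"] f
    by (simp add: eadd_def esmul_def eid_def)
  show ?thesis unfolding Zop_def
    by (cases b) (simp_all add: eadd_def[of "_ \<circ> _"] * fun_eq_iff)
qed

text \<open>Let \<open>B\<close> be \<open>hop b\<close> and \<open>C\<close> the other generator.
  The relation for \<open>B\<close> turns both \<open>B Z\<close> and \<open>Z B\<close> into
  \<open>B C B - l_C B^2 + c_B C\<close>, with \<open>l_C\<close> the linear and \<open>c_B\<close>
  the constant coefficient.\<close>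

lemma Zop_hop: "Zop \<circ> hop b = hop b \<circ> Zop"
proof
  fix f
  show "(Zop \<circ> hop b) f = (hop b \<circ> Zop) f"
  proof (cases "f \<in> V")
    case False
    then show ?thesis using Zop_Hend hop_Hend by (simp add: Hend_outside Hend_zero)
  next
    case f: True
    note V = Hend_cind[OF hop_Hend]
    let ?B = "hop b" and ?C = "hop (\<not> b)"
    have 1: "?B (Zop f) = (\<lambda>x. ((?B (?B (?C f)) x + (- lincoef (\<not> b)) * ?B (?B f) x)
        + 1 * ?B (?C (?B f)) x) + (- lincoef b) * ?B (?C f) x)"
      unfolding Zop_apply[OF f, of b] by (simp only: Hend_lin[OF hop_Hend] cind_lin V f)
    have 2: "?C (?B (?B f)) = (\<lambda>x. lincoef b * ?C (?B f) x + concoef b * ?C f x)"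
      unfolding hop_hop[OF f] by (simp only: Hend_add[OF hop_Hend] Hend_smult[OF hop_Hend] cind_smult V f)
    have "Zop (hop b f) = hop b (Zop f)"
      unfolding 1 Zop_apply[OF V[OF f], of b b] 2 hop_hop[OF V[OF f]] unfolding hop_hop[OF f]
      by (simp add: fun_eq_iff algebra_simps)
    then show ?thesis by simp
  qed
qed

lemma commute_all:
  assumes T: "T \<in> A" and hop: "\<And>b. T \<circ> hop b = hop b \<circ> T" and S: "S \<in> A"
  shows "T \<circ> S = S \<circ> T"
proof -
  have w: "T \<circ> wop w = wop w \<circ> T" for w
  proof (induction w)
    case Nil then show ?case using comp_eid[OF T] eid_comp[OF T] by simp
  next
    case (Cons b w)
    have "T \<circ> (hop b \<circ> wop w) = (T \<circ> hop b) \<circ> wop w" by (simp only: comp_assoc)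
    also have "\<dots> = hop b \<circ> (T \<circ> wop w)" unfolding hop by (simp only: comp_assoc)
    finally show ?case unfolding wop_Cons Cons by (simp only: comp_assoc)
  qed
  obtain p where p: "p \<in> ncpolys" "S = nce p" using S nceval_image by blast
  show ?thesis
  proof
    fix f
    have "T (nce p f) = (\<lambda>x. \<Sum>v\<in>{w. p w \<noteq> 0}. p v * T (wop v f) x)"
      unfolding nceval_def by (rule Hend_sum[OF T]) (use p in \<open>auto simp: ncpolys_def Hend_range wop_Hend\<close>)
    also have "\<dots> = nce p (T f)" unfolding nceval_def using fun_cong[OF w] by simp
    finally show "(T \<circ> S) f = (S \<circ> T) f" by (simp add: p)
  qed
qed

lemma ecenter_eq: "ecenter A = {T \<in> A. \<forall>b. T \<circ> hop b = hop b \<circ> T}"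
  unfolding ecenter_def using commute_all hop_Hend by blast

section \<open>Powers of the central element and their leading coefficients\<close>

abbreviation "zpow \<equiv> epow V Zop"

lemma zpow_Hend: "zpow k \<in> A"
proof (induction k)
  case (Suc k) then show ?case unfolding epow.simps by (rule comp_Hend[OF Zop_Hend])
qed (simp add: eid_Hend)

lemma zpow_commute: "zpow k \<circ> hop b = hop b \<circ> zpow k"
proof (induction k)
  case 0 then show ?case using comp_eid[OF hop_Hend] eid_comp[OF hop_Hend] by simp
next
  case (Suc k)
  have "(Zop \<circ> zpow k) \<circ> hop b = Zop \<circ> (hop b \<circ> zpow k)" unfolding comp_assoc Suc ..
  also have "\<dots> = hop b \<circ> (Zop \<circ> zpow k)" by (simp only: comp_assoc[symmetric] Zop_hop)
  finally show ?case by (simp only: epow.simps)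
qed

text \<open>In top length \<open>Zop\<close> prefixes two letters: at a word starting with
  \<open>b, c\<close> only the product of \<open>hop b\<close> and \<open>hop c\<close> in this
  order reaches \<open>coef w S\<close>. All other terms involve coefficients of length above
  \<open>m\<close>.\<close>

lemma coef_Zop_top:
  assumes S: "S \<in> A" and vanish: "\<And>v. distinct_adj v \<Longrightarrow> length v > m \<Longrightarrow> coef v S = 0"
    and w: "distinct_adj (b # c # w)" and len: "length w \<ge> m"
  shows "coef (b # c # w) (Zop \<circ> S) = coef w S"
proof -
  have c: "c = (\<not> b)" and cw: "distinct_adj (c # w)" using w by (auto simp: distinct_adj_Cons)
  have cbcw: "distinct_adj (c # b # c # w)" and bcbcw: "distinct_adj (b # c # b # c # w)"
    using w c by (auto simp: distinct_adj_Cons)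
  have H: "hop d \<circ> S \<in> A" for d by (rule comp_Hend[OF hop_Hend S])
  have 1: "coef (b # c # w) (hop b \<circ> (hop c \<circ> S)) = coef w S"
    using coef_hop_descend[OF H w] coef_hop_descend[OF S cw] coef_hop_ascend[OF S cbcw]
      vanish[OF cw] vanish[OF cbcw] len by (simp del: comp_apply)
  have 2: "coef (b # c # w) (hop b \<circ> S) = 0"
    using coef_hop_descend[OF S w] vanish[OF w] vanish[OF cw] len by simp
  have 3: "coef (b # c # w) (hop c \<circ> S) = 0"
    using coef_hop_ascend[OF S cbcw] vanish[OF cbcw] len by simp
  have 4: "coef (b # c # w) (hop c \<circ> (hop b \<circ> S)) = 0"
    using coef_hop_ascend[OF H cbcw] coef_hop_ascend[OF S bcbcw] vanish[OF bcbcw] len by simp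
  show ?thesis
    using 1 2 3 4 Zop_apply[OF Hend_range[OF S, of delta], of b] unfolding c coef_def
    by (simp add: coef_def)
qed

lemma coef_zpow:
  assumes "distinct_adj w" "length w \<ge> 2 * k"
  shows "coef w (zpow k) = (if length w = 2 * k then 1 else 0)"
  using assms
proof (induction k arbitrary: w)
  case 0 then show ?case by (simp add: coef_eid)
next
  case (Suc k)
  then obtain b c v where w: "w = b # c # v" by (cases w rule: remdups_adj.cases) auto
  have v: "distinct_adj v" using Suc.prems w by (auto simp: distinct_adj_Cons)
  have "coef w (Zop \<circ> zpow k) = coef v (zpow k)"
    unfolding w by (rule coef_Zop_top[OF zpow_Hend, of "2 * k"]) (use Suc w in auto)
  then show ?case using Suc.IH[OF v] Suc.prems w by (simp add: comp_def)
qed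

text \<open>The coset sums describe multiplication by \<open>hop b\<close> on the left only. The
  mirrored recursion is checked on the basis, according to whether \<open>u\<close> ends in
  \<open>b\<close>, and extended linearly in \<open>coef_comp_hop\<close>.\<close>

lemma coef_wop_hop:
  assumes u: "distinct_adj u" and w: "distinct_adj (w @ [b])"
  shows "coef w (wop u \<circ> hop b) = concoef b * coef (w @ [b]) (wop u)"
    and "coef (w @ [b]) (wop u \<circ> hop b) = coef w (wop u) + lincoef b * coef (w @ [b]) (wop u)"
proof -
  have wop1: "wop [b] = hop b" using comp_eid[OF hop_Hend] by (simp add: wop_Cons)
  have w': "distinct_adj w" "w = [] \<or> last w \<noteq> b" using w by (auto simp: distinct_adj_append_iff)
  have "coef w (wop u \<circ> hop b) = concoef b * coef (w @ [b]) (wop u) \<and>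
    coef (w @ [b]) (wop u \<circ> hop b) = coef w (wop u) + lincoef b * coef (w @ [b]) (wop u)"
  proof (cases rule: distinct_adj_snoc_cases[OF u, of b])
    case (1 u')
    then have u': "distinct_adj u'" "u' = [] \<or> last u' \<noteq> b" by (auto simp: distinct_adj_append_iff)
    have "wop u \<circ> hop b = wop u' \<circ> (hop b \<circ> hop b)" unfolding 1 wop_append wop1 by (simp only: comp_assoc)
    also have "\<dots> = eadd (esmul (lincoef b) (wop u)) (esmul (concoef b) (wop u'))"
    proof
      fix f
      show "(wop u' \<circ> (hop b \<circ> hop b)) f = eadd (esmul (lincoef b) (wop u)) (esmul (concoef b) (wop u')) f"
      proof (cases "f \<in> V")
        case True
        then show ?thesis unfolding 1 wop_append wop1
          using Hend_cind[OF hop_Hend True]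
          by (simp add: hop_hop Hend_add[OF wop_Hend] Hend_smult[OF wop_Hend] cind_smult eadd_def esmul_def)
      next
        case False
        then show ?thesis using Hend_outside[OF hop_Hend] Hend_outside[OF wop_Hend] Hend_zero[OF wop_Hend]
            Hend_zero[OF hop_Hend] by (simp add: eadd_def esmul_def)
      qed
    qed
    finally have "coef v (wop u \<circ> hop b) = lincoef b * coef v (wop u) + concoef b * coef v (wop u')" for v
      by (simp only: coef_eadd coef_esmul)
    then show ?thesis using 1 w w' u' by (auto simp: coef_wop simp del: comp_apply)
  next
    case 2
    have u': "u = [] \<or> last u \<noteq> b" using 2 by (auto simp: distinct_adj_append_iff)
    have "wop u \<circ> hop b = wop (u @ [b])" unfolding wop_append wop1 ..
    then show ?thesis using 2 w w' u u' by (auto simp: coef_wop simp del: comp_apply)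
  qed
  then show "coef w (wop u \<circ> hop b) = concoef b * coef (w @ [b]) (wop u)"
    and "coef (w @ [b]) (wop u \<circ> hop b) = coef w (wop u) + lincoef b * coef (w @ [b]) (wop u)"
    by blast+
qed

lemma coef_comp_hop:
  assumes T: "T \<in> A" and w: "distinct_adj (w @ [b])"
  shows "coef w (T \<circ> hop b) = concoef b * coef (w @ [b]) T"
    and "coef (w @ [b]) (T \<circ> hop b) = coef w T + lincoef b * coef (w @ [b]) T"
proof -
  define p where "p = (\<lambda>w. if distinct_adj w then coef w T else 0)"
  let ?S = "{w. p w \<noteq> 0}"
  have T': "T = (\<lambda>f x. \<Sum>u\<in>?S. p u * wop u f x)"
    using nceval_coef(2)[OF T] by (simp add: p_def nceval_def)
  have 1: "coef v T = (\<Sum>u\<in>?S. p u * coef v (wop u))" for v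
    by (subst T') (rule coef_lincomb)
  have "T \<circ> hop b = (\<lambda>f x. \<Sum>u\<in>?S. p u * (wop u \<circ> hop b) f x)"
    by (subst T') (simp add: fun_eq_iff)
  then have 2: "coef v (T \<circ> hop b) = (\<Sum>u\<in>?S. p u * coef v (wop u \<circ> hop b))" for v
    using coef_lincomb[of v p "\<lambda>u. wop u \<circ> hop b" ?S] by simp
  have S: "distinct_adj u" if "u \<in> ?S" for u using that by (auto simp: p_def split: if_splits)
  show "coef w (T \<circ> hop b) = concoef b * coef (w @ [b]) T"
    unfolding 1 2 sum_distrib_left
    by (rule sum.cong[OF refl]) (simp add: coef_wop_hop(1)[OF S w] del: comp_apply)
  show "coef (w @ [b]) (T \<circ> hop b) = coef w T + lincoef b * coef (w @ [b]) T"
    unfolding 1 2 sum_distrib_left sum.distrib[symmetric]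
    by (rule sum.cong[OF refl]) (simp add: coef_wop_hop(2)[OF S w] algebra_simps del: comp_apply)
qed

section \<open>Polynomials in the central element\<close>

lemma epolys_add_power:
  assumes "T \<in> epolys V Zop" shows "eadd T (esmul c (zpow k)) \<in> epolys V Zop"
proof -
  define pe where "pe P = (\<lambda>f x. \<Sum>i\<le>degree P. coeff P i * zpow i f x)" for P
  obtain P where P: "T = pe P" using assms by (auto simp: epolys_def pe_def)
  let ?N = "max (degree P) k"
  have pe: "pe Q = (\<lambda>f x. \<Sum>i\<le>?N. coeff Q i * zpow i f x)" if "degree Q \<le> ?N" for Q
    unfolding pe_def using that by (intro ext sum.mono_neutral_left) (auto simp: coeff_eq_0)
  have deg: "degree (P + monom c k) \<le> ?N"
    by (rule order_trans[OF degree_add_le_max]) (use degree_monom_le[of c k] in linarith)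
  have monom_sum: "(\<Sum>i\<le>?N. (if k = i then c else 0) * zpow i f x) = c * zpow k f x" for f x
  proof -
    have "(\<Sum>i\<le>?N. (if k = i then c else 0) * zpow i f x) =
        (\<Sum>i\<le>?N. if k = i then c * zpow k f x else 0)"
      by (rule sum.cong) auto
    then show ?thesis by (simp add: sum.delta')
  qed
  have "pe (P + monom c k) = eadd (pe P) (esmul c (zpow k))"
    unfolding pe[OF deg] pe[OF max.cobounded1]
    by (simp add: eadd_def esmul_def fun_eq_iff distrib_right sum.distrib monom_sum)
  then show ?thesis unfolding P epolys_def pe_def[symmetric] by (intro CollectI exI[of _ "P + monom c k"]) simp
qed

text \<open>Compare coefficients of length \<open>m + 1\<close> in \<open>T \<circ> hop b\<close> and \<open>hop b \<circ> T\<close>: for odd \<open>m\<close> those of \<open>T\<close> in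
  length \<open>m\<close> vanish, and for even \<open>m\<close> the two of them agree, as they do for \<open>Z^(m/2)\<close>.\<close>

lemma center_le_epolys:
  assumes "T \<in> A" "\<And>b. T \<circ> hop b = hop b \<circ> T"
    and "\<And>w. distinct_adj w \<Longrightarrow> length w \<ge> m \<Longrightarrow> coef w T = 0"
  shows "T \<in> epolys V Zop"
  using assms
proof (induction m arbitrary: T)
  case 0
  then have "T = ezero" by (intro coef_eqI ezero_Hend) (auto simp: coef_ezero)
  then show ?case unfolding epolys_def ezero_def by (intro CollectI exI[of _ 0]) simp
next
  case (Suc m)
  note T = Suc.prems(1) and comm = Suc.prems(2) and vanish = Suc.prems(3)
  have odd0: "coef w T = 0" if w: "distinct_adj w" "length w = m" "odd m" for w
  proof -
    \<comment> \<open>A word of odd length starts and ends with the same letter, so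
      \<open>?b\<close> may be added at both ends. Multiplication on the left sees
      \<open>coef w T\<close>, on the right only a coefficient of length
      \<open>m + 2\<close>.\<close>
    let ?b = "\<not> hd w"
    have [simp]: "w \<noteq> []" using w by auto
    have bw: "distinct_adj (?b # w)" and bwb: "distinct_adj ((?b # w) @ [?b])"
      using w distinct_adj_last[of w] by (auto simp: distinct_adj_Cons distinct_adj_append_iff)
    have "coef (?b # w) (hop ?b \<circ> T) = coef w T"
      using coef_hop_descend[OF T bw] vanish[OF bw] w by simp
    moreover have "coef (?b # w) (T \<circ> hop ?b) = 0"
      using coef_comp_hop(1)[OF T bwb] vanish[OF bwb] w by simp
    ultimately show ?thesis using comm by metis
  qed
  have even_eq: "coef w T = coef w' T"
    if w: "distinct_adj w" "distinct_adj w'" "length w = m" "length w' = m" "even m" for w w'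
  proof (cases "w = [] \<or> hd w = hd w'")
    case True
    then show ?thesis using distinct_adj_eqI[OF w(1,2)] w by auto
  next
    case False
    \<comment> \<open>A word of even length ends with the letter it does not start with. Hence
      prefixing \<open>?b\<close> to \<open>w\<close> gives the same word as appending
      \<open>?b\<close> to \<open>w'\<close>; left multiplication reads off \<open>coef w T\<close>
      there, right multiplication \<open>coef w' T\<close>.\<close>
    let ?b = "\<not> hd w"
    have ne: "w \<noteq> []" "w' \<noteq> []" "hd w' = ?b" using False w by auto
    have bw: "distinct_adj (?b # w)" using w ne by (simp add: distinct_adj_Cons)
    have "last w = ?b" using distinct_adj_last[of w] w ne by auto
    then have eq: "?b # w = butlast (?b # w) @ [?b]" 
      using append_butlast_last_id[of "?b # w"] ne by simp
    have "distinct_adj (butlast (?b # w) @ [?b])" using bw by (subst eq[symmetric])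
    then have d: "distinct_adj (butlast (?b # w))" by (simp only: distinct_adj_append_iff)
    have "butlast (?b # w) = w'"
      by (rule distinct_adj_eqI[OF d w(2)]) (use w ne in auto)
    then have eq: "?b # w = w' @ [?b]" using eq by simp
    have "coef (?b # w) (hop ?b \<circ> T) = coef w T"
      using coef_hop_descend[OF T bw] vanish[OF bw] w by simp
    moreover have "coef (?b # w) (T \<circ> hop ?b) = coef w' T"
    proof -
      have "coef (w' @ [?b]) T = 0" using vanish[OF bw] w(3) unfolding eq[symmetric] by simp
      then show ?thesis using coef_comp_hop(2)[OF T, of w' ?b] bw unfolding eq[symmetric] by simp
    qed
    ultimately show ?thesis unfolding comm by (simp only:)
  qed
  \<comment> \<open>The common value of all coefficients of length \<open>m\<close>; subtracting
    \<open>c\<close> times the power \<open>m div 2\<close> of \<open>Zop\<close> removes this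
    length from the support.\<close>
  define c where "c = (if odd m then 0 else coef (SOME w. distinct_adj w \<and> length w = m) T)"
  have c: "coef w T = c" if "distinct_adj w" "length w = m" for w
  proof (cases "odd m")
    case True
    then show ?thesis using odd0[OF that] by (simp add: c_def)
  next
    case False
    have "distinct_adj (SOME w :: bool list. distinct_adj w \<and> length w = m) \<and>
        length (SOME w :: bool list. distinct_adj w \<and> length w = m) = m"
      by (rule someI[of _ w]) (use that in simp)
    then have "coef w T = coef (SOME w. distinct_adj w \<and> length w = m) T"
      using even_eq[OF that(1) _ that(2)] False by blast
    then show ?thesis using False by (simp only: c_def if_False)
  qed
  define k where "k = m div 2"
  define T' where "T' = eadd T (esmul (- c) (zpow k))"
  have "T' \<in> epolys V Zop"
  proof (rule Suc.IH)
    show "T' \<in> A" unfolding T'_def by (intro eadd_Hend esmul_Hend T zpow_Hend)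
    show "T' \<circ> hop b = hop b \<circ> T'" for b
    proof
      fix f
      have 1: "T (hop b f) = hop b (T f)" "zpow k (hop b f) = hop b (zpow k f)"
        using fun_cong[OF comm[of b], of f] fun_cong[OF zpow_commute[of k b], of f] by simp_all
      have "hop b (T' f) = (\<lambda>x. hop b (T f) x + (- c) * hop b (zpow k f) x)"
        unfolding T'_def eadd_def esmul_def
        by (rule Hend_lin[OF hop_Hend Hend_range[OF T] Hend_range[OF zpow_Hend]])
      then show "(T' \<circ> hop b) f = (hop b \<circ> T') f"
        by (simp add: T'_def eadd_def esmul_def 1)
    qed
    fix w :: "bool list" assume w: "distinct_adj w" "length w \<ge> m"
    have z: "coef w (zpow k) = (if length w = 2 * k then 1 else 0)"
      by (rule coef_zpow) (use w in \<open>auto simp: k_def\<close>)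
    have k: "length w = 2 * k \<longleftrightarrow> even m \<and> length w = m"
      using w(2) unfolding k_def by presburger
    show "coef w T' = 0"
    proof (cases "length w = m")
      case True
      then show ?thesis using z k c[OF w(1)] by (auto simp: T'_def coef_eadd coef_esmul c_def)
    next
      case False
      then show ?thesis using z k vanish[OF w(1)] w by (simp add: T'_def coef_eadd coef_esmul)
    qed
  qed
  then have "eadd T' (esmul c (zpow k)) \<in> epolys V Zop" by (rule epolys_add_power)
  then show ?case by (simp add: T'_def eadd_def esmul_def)
qed

lemma center_eq_epolys: "ecenter A = epolys V Zop"
proof
  show "ecenter A \<subseteq> epolys V Zop"
  proof
    fix T assume "T \<in> ecenter A"
    then have T: "T \<in> A" "\<And>b. T \<circ> hop b = hop b \<circ> T" by (auto simp: ecenter_eq)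
    let ?L = "length ` {w. distinct_adj w \<and> coef w T \<noteq> 0}"
    \<comment> \<open>The inserted 0 gives the maximum a meaning when \<open>T\<close> has no
      nonzero coefficient.\<close>
    have "coef w T = 0" if "distinct_adj w" "length w \<ge> Suc (Max (insert 0 ?L))" for w
    proof (rule ccontr)
      assume "coef w T \<noteq> 0"
      then have "length w \<in> insert 0 ?L" using that by auto
      then have "length w \<le> Max (insert 0 ?L)" using finite_coef[OF T(1)] by (intro Max_ge) auto
      then show False using that by simp
    qed
    then show "T \<in> epolys V Zop" using T center_le_epolys by blast
  qed
  show "epolys V Zop \<subseteq> ecenter A"
  proof
    fix T assume "T \<in> epolys V Zop"
    then obtain P :: "'c poly" where P: "T = (\<lambda>f x. \<Sum>i\<le>degree P. coeff P i * zpow i f x)"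
      by (auto simp: epolys_def)
    have "T \<circ> hop b = hop b \<circ> T" for b
    proof
      fix f
      have "hop b (T f) = (\<lambda>x. \<Sum>i\<le>degree P. coeff P i * hop b (zpow i f) x)"
        unfolding P by (rule Hend_sum[OF hop_Hend]) (auto intro: Hend_range zpow_Hend)
      then show "(T \<circ> hop b) f = (hop b \<circ> T) f"
        using fun_cong[OF zpow_commute, of _ b f] by (simp add: P)
    qed
    moreover have "T \<in> A" unfolding P by (rule lincomb_Hend) (auto simp: zpow_Hend)
    ultimately show "T \<in> ecenter A" by (simp add: ecenter_eq)
  qed
qed

end

section \<open>Simple modules\<close>

text \<open>By finite dimension some nonzero polynomial \<open>P\<close> satisfies
  \<open>P(f) w = 0\<close>. Split off a root: if \<open>P = (x - a) Q\<close>, then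
  \<open>Q(f) w\<close> is an eigenvector for \<open>a\<close>, or it is zero and \<open>Q\<close>
  has smaller degree.\<close>

lemma (in vector_space) exists_eigenvector:
  fixes f :: "'b \<Rightarrow> 'b" and w :: 'b
  assumes f_add: "\<And>u w. f (u + w) = f u + f w" and f_scale: "\<And>c u. f (scale c u) = scale c (f u)"
    and alg_closed: "\<forall>P :: 'a poly. 0 < degree P \<longrightarrow> (\<exists>x. poly P x = 0)"
    and B: "finite B" "span B = UNIV" and nontriv: "w \<noteq> 0"
  shows "\<exists>l u. u \<noteq> 0 \<and> f u = scale l u"
proof -
  define pv where "pv P u = (\<Sum>i\<le>degree P. scale (coeff P i) ((f ^^ i) u))" for P u
  have f_sum: "f (sum h S) = (\<Sum>i\<in>S. f (h i))" for h :: "nat \<Rightarrow> 'b" and S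
  proof -
    have "f 0 = 0" using f_add[of 0 0] by simp
    then show ?thesis by (induction S rule: infinite_finite_induct) (auto simp: f_add)
  qed
  have pv_le: "pv P u = (\<Sum>i\<le>N. scale (coeff P i) ((f ^^ i) u))" if "degree P \<le> N" for P u N
    unfolding pv_def using that by (intro sum.mono_neutral_left) (auto simp: coeff_eq_0)
  have pv_add: "pv (P + Q) u = pv P u + pv Q u" for P Q u
  proof -
    let ?N = "max (degree P) (degree Q)"
    have "degree (P + Q) \<le> ?N" by (rule degree_add_le_max)
    then show ?thesis
      by (simp add: pv_le[of _ ?N] scale_left_distrib sum.distrib)
  qed
  have pv_smult: "pv (smult c P) u = scale c (pv P u)" for c P u
    using pv_le[of "smult c P" "degree P" u] by (simp add: pv_def scale_sum_right degree_smult_le)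
  have pv_shift: "pv (pCons 0 P) u = f (pv P u)" for P u
  proof -
    have "pv (pCons 0 P) u = (\<Sum>i\<le>Suc (degree P). scale (coeff (pCons 0 P) i) ((f ^^ i) u))"
      by (rule pv_le) (rule degree_pCons_le)
    also have "\<dots> = (\<Sum>i\<le>degree P. scale (coeff P i) (f ((f ^^ i) u)))"
      by (simp only: sum.atMost_Suc_shift coeff_pCons_0 coeff_pCons_Suc funpow.simps comp_apply) simp
    finally show ?thesis by (simp add: pv_def f_sum f_scale)
  qed
  have descend: "\<exists>l u. u \<noteq> 0 \<and> f u = scale l u" if "P \<noteq> 0" "u \<noteq> 0" "pv P u = 0" for P u
    using that
  proof (induction "degree P" arbitrary: P rule: less_induct)
    case less
    show ?case
    proof (cases "degree P = 0")
      case True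
      then obtain c where "P = [:c:]" using degree_eq_zeroE by blast
      then show ?thesis using less.prems by (simp add: pv_def)
    next
      case False
      then obtain a where "poly P a = 0" using alg_closed by blast
      then obtain Q where P: "P = [:- a, 1:] * Q" by (auto simp: poly_eq_0_iff_dvd dvd_def)
      have Q: "Q \<noteq> 0" using P less.prems(1) by auto
      have deg: "degree Q < degree P" unfolding P using Q by (subst degree_mult_eq) auto
      have "pv P u = f (pv Q u) - scale a (pv Q u)"
        unfolding P by (simp add: pv_add pv_smult pv_shift del: smult_minus_left)
      then have "f (pv Q u) = scale a (pv Q u)" using less.prems(3) by simp
      then show ?thesis using less.hyps[OF deg Q less.prems(2)] by blast
    qed
  qed
  have pv_monom: "pv (monom c i) u = scale c ((f ^^ i) u)" for c i u
  proof -
    have "pv (monom c i) u = (\<Sum>j\<le>i. scale (if j = i then c else 0) ((f ^^ j) u))"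
      by (subst pv_le[of _ i]) (auto simp: degree_monom_le coeff_monom intro!: sum.cong)
    also have "\<dots> = (\<Sum>j\<le>i. if j = i then scale c ((f ^^ i) u) else 0)"
      by (rule sum.cong) auto
    finally show ?thesis by simp
  qed
  \<comment> \<open>Among \<open>card B + 1\<close> iterates of \<open>w\<close>, either two
    coincide, which yields the polynomial \<open>x^i - x^j\<close>, or they are distinct and hence
    linearly dependent.\<close>
  let ?v = "\<lambda>i. (f ^^ i) w" and ?N = "card B"
  show ?thesis
  proof (cases "inj_on ?v {..?N}")
    case False
    then obtain i j where ij: "i \<noteq> j" "?v i = ?v j" by (auto simp: inj_on_def)
    let ?P = "monom 1 i + monom (- 1) j :: 'a poly"
    have "coeff ?P i = 1" using ij by (simp add: coeff_monom)
    moreover have "coeff 0 i \<noteq> (1 :: 'a)" by simp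
    ultimately have "?P \<noteq> 0" by metis
    moreover have "pv ?P w = 0" using ij by (simp add: pv_add pv_monom)
    ultimately show ?thesis using descend nontriv by blast
  next
    case True
    have "dependent (?v ` {..?N})"
      using independent_span_bound[OF B(1), of "?v ` {..?N}"] True B(2) by (auto simp: card_image)
    then obtain c where c: "\<exists>u\<in>?v ` {..?N}. c u \<noteq> 0" "(\<Sum>u\<in>?v ` {..?N}. scale (c u) u) = 0"
      using dependent_finite[of "?v ` {..?N}"] by blast
    define P where "P = (\<Sum>i\<le>?N. monom (c (?v i)) i)"
    have coeff_P: "coeff P i = (if i \<le> ?N then c (?v i) else 0)" for i
      by (simp add: P_def coeff_sum coeff_monom)
    obtain i where "i \<le> ?N" "c (?v i) \<noteq> 0" using c(1) by auto
    then have "P \<noteq> 0" using coeff_P[of i] by auto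
    moreover have "pv P w = (\<Sum>i\<le>?N. scale (c (?v i)) (?v i))"
    proof -
      have "degree P \<le> ?N" by (rule degree_le) (simp add: coeff_P)
      then show ?thesis by (simp add: pv_le coeff_P)
    qed
    then have "pv P w = 0" using c(2) True by (simp add: sum.reindex)
    ultimately show ?thesis using descend nontriv by blast
  qed
qed

text \<open>\<open>iso_to_mu\<close> and \<open>iso_to_M\<close> ask for an action on a concrete
  space; it is obtained by pulling the given one back along a linear bijection from that
  space.\<close>

lemma rmod_transport:
  fixes g :: "'n::ab_group_add \<Rightarrow> 'm::ab_group_add" and scale' :: "'c::field \<Rightarrow> 'n \<Rightarrow> 'n"
    and A :: "('e::field, 'c) endo set"
  assumes rm: "rmod V A scale act" and vs: "vector_space scale'" and bij: "bij g"
    and g_add: "\<And>u w. g (u + w) = g u + g w" and g_scale: "\<And>c u. g (scale' c u) = scale c (g u)"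
  defines "act' \<equiv> \<lambda>u T. inv_into UNIV g (act (g u) T)"
  shows "rmod V A scale' act'" "rmod_iso A scale act scale' act'"
proof -
  have g[simp]: "inv_into UNIV g (g u) = u" "g (inv_into UNIV g x) = x" for u x
    using bij by (simp_all add: bij_is_inj bij_is_surj surj_f_inv_f)
  have i_add: "inv_into UNIV g (x + y) = inv_into UNIV g x + inv_into UNIV g y" for x y
    using g_add[of "inv_into UNIV g x" "inv_into UNIV g y"] by (metis g)
  have i_scale: "inv_into UNIV g (scale c x) = scale' c (inv_into UNIV g x)" for c x
    using g_scale[of c "inv_into UNIV g x"] by (metis g)
  show "rmod V A scale' act'"
    using rm vs unfolding rmod_def act'_def by (simp add: g_add g_scale i_add i_scale)
  show "rmod_iso A scale act scale' act'"
    unfolding rmod_iso_def act'_def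
    by (rule exI[of _ "inv_into UNIV g"]) (simp add: bij_imp_bij_inv[OF bij] i_add i_scale)
qed

lemma vector_space_times: "vector_space ((*) :: 'c::field \<Rightarrow> 'c \<Rightarrow> 'c)"
  by unfold_locales (simp_all add: algebra_simps)

lemma vector_space_scale2: "vector_space (scale2 :: 'c::field \<Rightarrow> _)"
  by unfold_locales (simp_all add: scale2_def algebra_simps)

locale unramified_hecke = dihedral_cosets N G I chi iv n U cf
  for N :: nat and G I :: "'e::field mat set" and chi :: "'e mat \<Rightarrow> 'c::field"
    and iv :: "'e mat \<Rightarrow> 'e mat" and n :: "bool \<Rightarrow> 'e mat" and U :: "bool \<Rightarrow> 'e mat set"
    and cf :: "bool \<Rightarrow> 'e mat \<Rightarrow> 'c" +
  fixes q :: nat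
  assumes lincoef_True: "lincoef True = of_nat q - of_nat q ^ 2"
    and concoef_True: "concoef True = of_nat q ^ 3"
    and lincoef_False: "lincoef False = of_nat q - 1"
    and concoef_False: "concoef False = of_nat q"
begin

lemma hecke_presentation_hop: "hecke_presentation V A q (hop True) (hop False)"
proof -
  have "relX q = qrel True" "relY q = qrel False"
    by (simp_all add: relX_def relY_def qrel_def lincoef_True concoef_True lincoef_False concoef_False
        algebra_simps)
  then show ?thesis unfolding hecke_presentation_def
    using nceval_image nceval_kernel by simp
qed

lemma Zelt_eq: "Zelt V q (hop True) (hop False) = Zop"
  by (simp add: Zelt_def Zop_def lincoef_True lincoef_False)

section \<open>Right modules over the Hecke algebra\<close>

context
  fixes scale :: "'c \<Rightarrow> 'm::ab_group_add \<Rightarrow> 'm" and act :: "'m \<Rightarrow> ('e, 'c) endo \<Rightarrow> 'm"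
  assumes rm: "rmod V A scale act"
begin

interpretation vector_space scale using rm by (simp add: rmod_def)

lemma act_add: "T \<in> A \<Longrightarrow> act (u + w) T = act u T + act w T"
  and act_scale: "T \<in> A \<Longrightarrow> act (scale c u) T = scale c (act u T)"
  and act_eadd: "S \<in> A \<Longrightarrow> T \<in> A \<Longrightarrow> act u (eadd S T) = act u S + act u T"
  and act_esmul: "T \<in> A \<Longrightarrow> act u (esmul c T) = scale c (act u T)"
  and act_comp: "S \<in> A \<Longrightarrow> T \<in> A \<Longrightarrow> act u (S \<circ> T) = act (act u S) T"
  and act_eid: "act u (eid V) = u"
  using rm by (auto simp: rmod_def)

lemma act_zero: "T \<in> A \<Longrightarrow> act 0 T = 0"
  using act_scale[of T 0 0] by simp

lemma act_diff: "T \<in> A \<Longrightarrow> act (u - w) T = act u T - act w T"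
  using act_add[of T "u - w" w] by simp

lemma act_hop_hop: "act (act u (hop b)) (hop b) = scale (lincoef b) (act u (hop b)) + scale (concoef b) u"
  unfolding act_comp[OF hop_Hend hop_Hend, symmetric] hop_quadratic
  by (simp add: act_eadd act_esmul esmul_Hend hop_Hend eid_Hend act_eid)

lemma act_Zop: "act u Zop = act (act u (hop True)) (hop False) - scale (lincoef False) (act u (hop True))
    + (act (act u (hop False)) (hop True) - scale (lincoef True) (act u (hop False)))"
  unfolding Zop_def
  by (simp only: act_eadd act_comp act_esmul act_eid eadd_Hend comp_Hend esmul_Hend hop_Hend eid_Hend)
    simp

lemma act_Zop_commute:
  assumes "T \<in> A" shows "act (act u Zop) T = act (act u T) Zop"
proof -
  have "Zop \<circ> T = T \<circ> Zop" using commute_all[OF Zop_Hend Zop_hop assms] .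
  then show ?thesis using act_comp[OF Zop_Hend assms] act_comp[OF assms Zop_Hend] by metis
qed

text \<open>Every element of \<open>A\<close> is a polynomial in the two generators, so stability
  under these is enough.\<close>

lemma submodule_Hend:
  assumes W: "subspace W" "\<And>w b. w \<in> W \<Longrightarrow> act w (hop b) \<in> W" and "w \<in> W" "T \<in> A"
  shows "act w T \<in> W"
proof -
  have word: "act w (wop v) \<in> W" if "w \<in> W" for v w
    using that
  proof (induction v arbitrary: w)
    case Nil then show ?case by (simp add: act_eid)
  next
    case (Cons b v)
    then show ?case unfolding wop_Cons act_comp[OF hop_Hend wop_Hend] using W(2) by blast
  qed
  have "act w (\<lambda>f x. \<Sum>v\<in>S. p v * wop v f x) \<in> W" if "finite S" for S p
    using that
  proof (induction S)
    case empty
    \<comment> \<open>The module axioms speak of scalar multiples, so the zero operator is reached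
      as \<open>esmul 0 (eid V)\<close>.\<close>
    have "act w (esmul 0 (eid V)) \<in> W"
      using act_esmul[OF eid_Hend, of w 0] subspace_0[OF W(1)] by simp
    then show ?case by (simp add: esmul_def)
  next
    case (insert v S)
    let ?T = "\<lambda>f x. \<Sum>v\<in>S. p v * wop v f x"
    have T: "?T \<in> A" by (rule lincomb_Hend[OF insert(1)]) (rule wop_Hend)
    have "act w (eadd (esmul (p v) (wop v)) ?T) = scale (p v) (act w (wop v)) + act w ?T"
      by (simp add: act_eadd act_esmul esmul_Hend wop_Hend T)
    also have "\<dots> \<in> W"
      by (intro subspace_add subspace_scale W(1) insert.IH word assms(3))
    finally show ?case using insert by (simp add: eadd_def esmul_def)
  qed
  moreover obtain p where "p \<in> ncpolys" "T = nce p" using assms(4) nceval_image by blast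
  ultimately show ?thesis unfolding nceval_def ncpolys_def by simp
qed

context
  assumes simple: "simple_rmod A scale act"
begin

lemma simple_submodule:
  assumes "subspace W" "\<And>w b. w \<in> W \<Longrightarrow> act w (hop b) \<in> W" "w \<in> W" "w \<noteq> 0"
  shows "W = UNIV"
  using simple submodule_Hend[OF assms(1,2)] assms unfolding simple_rmod_def by blast

text \<open>The line through a common eigenvector of both generators is a submodule, so simplicity
  makes it the whole module.\<close>

lemma eigenline_UNIV:
  assumes v: "v \<noteq> 0" and x: "act v (hop True) = scale th v" and y: "act v (hop False) = scale th' v"
  shows "\<exists>z. u = scale z v"
proof -
  have "act w (hop b) \<in> range (\<lambda>z. scale z v)" if "w \<in> range (\<lambda>z. scale z v)" for w b
    using that by (cases b) (auto simp: act_scale hop_Hend x y)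
  moreover have "subspace (range (\<lambda>z. scale z v))"
    by (auto simp: subspace_def scale_left_distrib[symmetric] intro: range_eqI[of _ _ 0])
  moreover have "v \<in> range (\<lambda>z. scale z v)" by (auto intro: range_eqI[of _ _ 1])
  ultimately show ?thesis using simple_submodule[of "range (\<lambda>z. scale z v)" v] v by blast
qed

lemma iso_to_mu_eigenvector:
  assumes v: "v \<noteq> 0" and x: "act v (hop True) = scale th v" and y: "act v (hop False) = scale th' v"
  shows "iso_to_mu V A (hop True) (hop False) scale act th th'"
proof -
  let ?g = "\<lambda>z. scale z v"
  have inj: "inj ?g" using v by (auto intro: injI)
  then have bij: "bij ?g" using eigenline_UNIV[OF v x y] by (auto simp: bij_def surj_def)
  have inv: "inv_into UNIV ?g (scale z v) = z" for z by (rule inv_f_f[OF inj])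
  let ?act = "\<lambda>z T. inv_into UNIV ?g (act (?g z) T)"
  have "rmod V A (*) ?act" "rmod_iso A scale act (*) ?act"
    using rmod_transport[of V A scale act "(*)" ?g, OF rm vector_space_times bij]
    by (simp_all add: scale_left_distrib)
  moreover have "?act z (hop True) = th * z" "?act z (hop False) = th' * z" for z
    by (simp_all add: act_scale hop_Hend x y inv mult.commute)
  ultimately show ?thesis unfolding iso_to_mu_def by (intro exI[of _ ?act] conjI allI)
qed

text \<open>Schur's lemma: an eigenspace of the central element is a nonzero submodule.\<close>

lemma central_character:
  assumes alg_closed: "\<forall>P :: 'c poly. 0 < degree P \<longrightarrow> (\<exists>x. poly P x = 0)" and fin: "fin_dim scale"
  obtains l where "\<And>u. act u Zop = scale l u"
proof -
  obtain B where B: "finite B" "span B = UNIV" using fin by (auto simp: fin_dim_def)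
  obtain w :: 'm where "w \<noteq> 0" using simple by (auto simp: simple_rmod_def)
  then obtain l w where lw: "w \<noteq> 0" "act w Zop = scale l w"
    using exists_eigenvector[of "\<lambda>u. act u Zop", OF act_add act_scale alg_closed B] Zop_Hend by blast
  let ?W = "{u. act u Zop = scale l u}"
  have "subspace ?W"
    by (auto simp: subspace_def act_zero act_add act_scale Zop_Hend scale_right_distrib mult.commute)
  moreover have "act w (hop b) \<in> ?W" if "w \<in> ?W" for w b
    using that act_Zop_commute[OF hop_Hend, of w b] by (simp add: act_scale hop_Hend)
  ultimately have "?W = UNIV" using simple_submodule[of ?W w] lw by blast
  then show ?thesis using that by blast
qed

lemma hop_False_eigenvalue:
  assumes v: "v \<noteq> 0" and y: "act v (hop False) = scale c v" shows "c \<in> {- 1, of_nat q}"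
proof -
  have "scale (c * c) v = scale (lincoef False * c + concoef False) v"
    using act_hop_hop[of v False] by (simp add: y act_scale hop_Hend scale_left_distrib)
  then have "c * c = lincoef False * c + concoef False"
    using v by (simp only: scale_cancel_right) simp
  then have "(c + 1) * (c - of_nat q) = 0"
    by (simp add: lincoef_False concoef_False algebra_simps)
  then show ?thesis by (auto simp: eq_neg_iff_add_eq_0)
qed

context
  fixes l :: 'c and v1 v2 :: 'm
  assumes central: "\<And>u. act u Zop = scale l u" and v1: "v1 \<noteq> 0"
    and xv1: "act v1 (hop True) = scale (- (of_nat q ^ 2)) v1"
    and v2: "act v1 (hop False) = v2"
begin

text \<open>Since \<open>v2\<close> is \<open>v1 Y\<close>, the summand \<open>Y X\<close> of
  \<open>Z\<close> applied to \<open>v1\<close> is \<open>v2 X\<close>. Solving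
  \<open>v1 Z = l v1\<close> for it shows how the parameter of \<open>M(l)\<close> arises from the
  central character.\<close>

lemma act_v2_True: "act v2 (hop True) = scale (l + of_nat q ^ 2 - of_nat q ^ 3) v1 + scale (of_nat q) v2"
proof -
  have "scale l v1 = scale (- (of_nat q ^ 2)) v2 - scale ((of_nat q - 1) * - (of_nat q ^ 2)) v1 +
      (act v2 (hop True) - scale (of_nat q - of_nat q ^ 2) v2)"
    using act_Zop[of v1] central[of v1]
    by (simp add: xv1 v2 act_scale hop_Hend lincoef_True lincoef_False del: scale_minus_left)
  then have "act v2 (hop True) = scale l v1 - scale (- (of_nat q ^ 2)) v2
      + scale ((of_nat q - 1) * - (of_nat q ^ 2)) v1 + scale (of_nat q - of_nat q ^ 2) v2"
    by (simp only: algebra_simps)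
  also have "\<dots> = scale (l + (of_nat q - 1) * - (of_nat q ^ 2)) v1
      + scale (of_nat q - of_nat q ^ 2 - - (of_nat q ^ 2)) v2"
    by (simp only: scale_left_distrib scale_left_diff_distrib) (simp add: algebra_simps)
  also have "l + (of_nat q - 1) * - (of_nat q ^ 2) = l + of_nat q ^ 2 - of_nat q ^ 3"
    by (simp add: algebra_simps power2_eq_square power3_eq_cube)
  finally show ?thesis by simp
qed

lemma act_v2_False: "act v2 (hop False) = scale (of_nat q) v1 + scale (of_nat q - 1) v2"
  using act_hop_hop[of v1 False] by (simp add: v2 lincoef_False concoef_False add.commute)

lemma no_eigenvector:
  assumes indep: "\<And>a b. scale a v1 + scale b v2 = 0 \<Longrightarrow> a = 0 \<and> b = 0"
  shows "act (scale a v1 + v2) (hop True) = scale th (scale a v1 + v2) \<Longrightarrow>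
    act (scale a v1 + v2) (hop False) = scale th' (scale a v1 + v2) \<Longrightarrow> False"
proof -
  let ?u = "scale a v1 + v2"
  assume u: "act ?u (hop True) = scale th ?u" "act ?u (hop False) = scale th' ?u"
  have "?u \<noteq> 0" using indep[of a 1] by auto
  then obtain z where "v1 = scale z ?u" using eigenline_UNIV u by blast
  moreover have "scale (z * a - 1) v1 + scale z v2 = scale z ?u - v1"
    by (simp add: scale_right_distrib scale_left_diff_distrib)
  ultimately have "scale (z * a - 1) v1 + scale z v2 = 0" by simp
  from indep[OF this] show False by auto
qed

text \<open>At the excluded values \<open>v1 + v2\<close>, respectively \<open>v2 - q v1\<close>, is
  a common eigenvector with eigenvalues \<open>(q, q)\<close>, respectively \<open>(q, -1)\<close>,
  which contradicts independence. The isomorphism exists because \<open>v1\<close> and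
  \<open>v2\<close> span a submodule.\<close>

lemma iso_to_M_independent:
  assumes indep: "\<And>a b. scale a v1 + scale b v2 = 0 \<Longrightarrow> a = 0 \<and> b = 0"
  shows "l \<noteq> of_nat q ^ 3 + of_nat q" "l \<noteq> - 2 * of_nat q ^ 2"
    "iso_to_M V A q (hop True) (hop False) scale act l"
proof -
  show "l \<noteq> of_nat q ^ 3 + of_nat q"
  proof
    assume l: "l = of_nat q ^ 3 + of_nat q"
    show False
      by (rule no_eigenvector[OF indep, of 1 "of_nat q" "of_nat q"])
        (simp_all add: act_add act_scale hop_Hend xv1 v2 act_v2_True act_v2_False l
          scale_left_distrib scale_left_diff_distrib algebra_simps)
  qed
  show "l \<noteq> - 2 * of_nat q ^ 2"
  proof
    assume l: "l = - 2 * of_nat q ^ 2"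
    have "l + of_nat q ^ 2 = - (of_nat q ^ 2)" by (simp add: l)
    show False
      by (rule no_eigenvector[OF indep, of "- of_nat q" "of_nat q" "- 1"])
        (simp_all add: act_add act_diff act_scale hop_Hend xv1 v2 act_v2_True act_v2_False l
          scale_left_distrib scale_left_diff_distrib scale_right_diff_distrib
          algebra_simps power2_eq_square power3_eq_cube)
  qed
  define g where "g z = scale (fst z) v1 + scale (snd z) v2" for z
  have g_add: "g (z + z') = g z + g z'" for z z'
    by (simp add: g_def scale_left_distrib algebra_simps)
  have g_scale: "g (scale2 c z) = scale c (g z)" for c z
    by (simp add: g_def scale2_def scale_right_distrib)
  have inj: "inj g"
  proof (rule injI)
    fix z z' assume "g z = g z'"
    then have "scale (fst z - fst z') v1 + scale (snd z - snd z') v2 = 0"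
      by (simp add: g_def scale_left_diff_distrib algebra_simps)
    from indep[OF this] show "z = z'" by (simp add: prod_eq_iff)
  qed
  have "act w (hop b) \<in> range g" if w: "w \<in> range g" for w b
  proof -
    obtain z where z: "w = g z" using w by blast
    have "act w (hop True) \<in> range g"
      by (rule range_eqI[of _ g "(fst z * - (of_nat q ^ 2) + snd z * (l + of_nat q ^ 2 - of_nat q ^ 3),
          snd z * of_nat q)"])
        (simp add: z g_def act_add act_scale hop_Hend xv1 act_v2_True scale_right_distrib
          scale_right_diff_distrib scale_left_distrib scale_left_diff_distrib algebra_simps)
    moreover have "act w (hop False) \<in> range g"
      by (rule range_eqI[of _ g "(snd z * of_nat q, fst z + snd z * (of_nat q - 1))"])
        (simp add: z g_def act_add act_scale hop_Hend v2 act_v2_False scale_right_distrib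
          scale_left_distrib add_ac)
    ultimately show ?thesis by (cases b) simp_all
  qed
  moreover have "subspace (range g)"
    unfolding subspace_def
  proof (intro conjI ballI allI)
    show "0 \<in> range g" by (rule range_eqI[of _ _ 0]) (simp add: g_def)
    show "x + y \<in> range g" if "x \<in> range g" "y \<in> range g" for x y
      using that by (auto simp flip: g_add)
    show "scale c x \<in> range g" if "x \<in> range g" for c x
      using that by (auto simp flip: g_scale)
  qed
  moreover have "v1 \<in> range g" by (rule range_eqI[of _ _ "(1, 0)"]) (simp add: g_def)
  ultimately have "range g = UNIV" using simple_submodule[of "range g" v1] v1 by blast
  then have bij: "bij g" using inj by (simp add: bij_def)
  have inv: "inv_into UNIV g (scale a v1 + scale b v2) = (a, b)" for a b
    using inv_f_f[OF inj, of "(a, b)"] by (simp add: g_def)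
  have "scale a v1 = scale a v1 + scale 0 v2" "v2 = scale 0 v1 + scale 1 v2" for a by simp_all
  then have inv1: "inv_into UNIV g (scale a v1) = (a, 0)" "inv_into UNIV g v2 = (0, 1)" for a
    using inv by metis+
  let ?act = "\<lambda>z T. inv_into UNIV g (act (g z) T)"
  have "rmod V A scale2 ?act" "rmod_iso A scale act scale2 ?act"
    by (rule rmod_transport[of V A scale act scale2 g, OF rm vector_space_scale2 bij g_add g_scale])+
  moreover have "?act (1, 0) (hop True) = (- (of_nat q ^ 2), 0)" "?act (1, 0) (hop False) = (0, 1)"
    "?act (0, 1) (hop True) = (l + of_nat q ^ 2 - of_nat q ^ 3, of_nat q)"
    "?act (0, 1) (hop False) = (of_nat q, of_nat q - 1)"
    by (simp_all add: g_def xv1 v2 inv1 inv act_v2_True act_v2_False del: scale_minus_left)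
  ultimately show "iso_to_M V A q (hop True) (hop False) scale act l"
    unfolding iso_to_M_def by (intro exI[of _ ?act] conjI)
qed

end

lemma simple_module_classification:
  assumes alg_closed: "\<forall>P :: 'c poly. 0 < degree P \<longrightarrow> (\<exists>x. poly P x = 0)" and fin: "fin_dim scale"
  shows "(\<exists>th th'. th \<in> {- (of_nat q ^ 2), of_nat q} \<and> th' \<in> {-1, of_nat q} \<and>
            iso_to_mu V A (hop True) (hop False) scale act th th') \<or>
         (\<exists>l. l \<noteq> of_nat q ^ 3 + of_nat q \<and> l \<noteq> - 2 * of_nat q ^ 2 \<and>
            iso_to_M V A q (hop True) (hop False) scale act l)"
proof -
  obtain l where l: "\<And>u. act u Zop = scale l u" using central_character[OF alg_closed fin] by blast
  show ?thesis
  proof (cases "\<exists>v. v \<noteq> 0 \<and> act v (hop True) = scale (- (of_nat q ^ 2)) v")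
    case True
    then obtain v1 where v1: "v1 \<noteq> 0" "act v1 (hop True) = scale (- (of_nat q ^ 2)) v1" by blast
    define v2 where "v2 = act v1 (hop False)"
    show ?thesis
    proof (cases "\<forall>a b. scale a v1 + scale b v2 = 0 \<longrightarrow> a = 0 \<and> b = 0")
      case True
      then show ?thesis using iso_to_M_independent[OF l v1 v2_def[symmetric]] by blast
    next
      \<comment> \<open>Now \<open>v2\<close> is a multiple of \<open>v1\<close>, so
        \<open>v1\<close> is a common eigenvector.\<close>
      case False
      then obtain a b where ab: "scale a v1 + scale b v2 = 0" "a \<noteq> 0 \<or> b \<noteq> 0" by blast
      have b: "b \<noteq> 0" using ab v1(1) by auto
      have "scale (inverse b) (scale a v1 + scale b v2) = 0" by (simp only: ab(1) scale_zero_right)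
      then have "act v1 (hop False) = scale (- (inverse b * a)) v1"
        using b by (simp add: v2_def scale_right_distrib eq_neg_iff_add_eq_0 add.commute)
      then show ?thesis
        using iso_to_mu_eigenvector[OF v1] hop_False_eigenvalue[OF v1(1)] by blast
    qed
  next
    case False
    have x: "act u (hop True) = scale (of_nat q) u" for u
    proof -
      \<comment> \<open>Because \<open>(X - q)(X + q^2) = 0\<close>, this vector satisfies the
        eigenvector equation for \<open>-q^2\<close>, so in this case it must be zero.\<close>
      let ?t = "act u (hop True) - scale (of_nat q) u"
      have "act ?t (hop True) = scale (- (of_nat q ^ 2)) ?t"
        using act_hop_hop[of u True]
        by (simp add: act_diff act_scale hop_Hend lincoef_True concoef_True scale_right_diff_distrib
            scale_left_diff_distrib algebra_simps power2_eq_square power3_eq_cube)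
      then have "?t = 0" using False by blast
      then show ?thesis by simp
    qed
    obtain u :: 'm where u: "u \<noteq> 0" using simple by (auto simp: simple_rmod_def)
    \<comment> \<open>\<open>X\<close> acts as the scalar \<open>q\<close>, so any eigenvector of
      \<open>Y\<close> suffices: \<open>u\<close> itself if \<open>u (Y - q) = 0\<close>, and
      otherwise \<open>u (Y - q)\<close>, with eigenvalue \<open>-1\<close>.\<close>
    let ?t = "act u (hop False) - scale (of_nat q) u"
    show ?thesis
    proof (cases "?t = 0")
      case True
      then have "act u (hop False) = scale (of_nat q) u" by simp
      then show ?thesis using iso_to_mu_eigenvector[OF u x] by blast
    next
      case False
      have "act ?t (hop False) = scale (- 1) ?t"
        using act_hop_hop[of u False]
        by (simp add: act_diff act_scale hop_Hend lincoef_False concoef_False scale_right_diff_distrib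
            scale_left_diff_distrib algebra_simps)
      then show ?thesis using iso_to_mu_eigenvector[OF False x] by blast
    qed
  qed
qed

end
end
end

section \<open>Unitary matrices over an unramified quadratic extension\<close>

text \<open>Listing the nine entries turns products, unitarity and membership in the Iwahori
  subgroup into explicit conditions on entries.\<close>

definition m3 :: "'a \<Rightarrow> 'a \<Rightarrow> 'a \<Rightarrow> 'a \<Rightarrow> 'a \<Rightarrow> 'a \<Rightarrow> 'a \<Rightarrow> 'a \<Rightarrow> 'a \<Rightarrow> 'a mat" where
  "m3 a b c d e f g h i = mat 3 3 (\<lambda>(r, s).
     if r = 0 then (if s = 0 then a else if s = 1 then b else c)
     else if r = 1 then (if s = 0 then d else if s = 1 then e else f)
     else (if s = 0 then g else if s = 1 then h else i))"

lemma less3_cases: "r < (3::nat) \<Longrightarrow> r = 0 \<or> r = Suc 0 \<or> r = 2"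
  by linarith

lemma all_less3: "(\<forall>r<3. P r) \<longleftrightarrow> P 0 \<and> P (Suc 0) \<and> P (2::nat)"
  using less3_cases by auto

lemma m3_carrier [simp]: "m3 a b c d e f g h i \<in> carrier_mat 3 3"
  by (simp add: m3_def)

lemma m3_index [simp]:
  "m3 a b c d e f g h i $$ (0, 0) = a" "m3 a b c d e f g h i $$ (0, Suc 0) = b"
  "m3 a b c d e f g h i $$ (0, 2) = c" "m3 a b c d e f g h i $$ (Suc 0, 0) = d"
  "m3 a b c d e f g h i $$ (Suc 0, Suc 0) = e" "m3 a b c d e f g h i $$ (Suc 0, 2) = f"
  "m3 a b c d e f g h i $$ (2, 0) = g" "m3 a b c d e f g h i $$ (2, Suc 0) = h"
  "m3 a b c d e f g h i $$ (2, 2) = i"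
  by (simp_all add: m3_def)

lemma eq_m3I:
  assumes "A \<in> carrier_mat 3 3" "A $$ (0, 0) = a" "A $$ (0, Suc 0) = b" "A $$ (0, 2) = c"
    "A $$ (Suc 0, 0) = d" "A $$ (Suc 0, Suc 0) = e" "A $$ (Suc 0, 2) = f"
    "A $$ (2, 0) = g" "A $$ (2, Suc 0) = h" "A $$ (2, 2) = i"
  shows "A = m3 a b c d e f g h i"
proof (rule eq_matI)
  fix r s assume "r < dim_row (m3 a b c d e f g h i)" "s < dim_col (m3 a b c d e f g h i)"
  then have "r < 3" "s < 3" by (auto simp: m3_def)
  then show "A $$ (r, s) = m3 a b c d e f g h i $$ (r, s)"
    using less3_cases[of r] less3_cases[of s] assms by auto
qed (use assms(1) in \<open>auto simp: m3_def\<close>)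

lemma carrier3E:
  assumes "A \<in> carrier_mat 3 3"
  obtains a b c d e f g h i where "A = m3 a b c d e f g h i"
  using eq_m3I[OF assms refl refl refl refl refl refl refl refl refl] by blast

lemma m3_eq_iff: "m3 a b c d e f g h i = m3 a' b' c' d' e' f' g' h' i' \<longleftrightarrow>
    a = a' \<and> b = b' \<and> c = c' \<and> d = d' \<and> e = e' \<and> f = f' \<and> g = g' \<and> h = h' \<and> i = i'"
  (is "?A = ?B \<longleftrightarrow> ?R")
proof
  assume AB: "?A = ?B"
  have "?A $$ (r, s) = ?B $$ (r, s)" for r s using AB by simp
  from this[of 0 0] this[of 0 "Suc 0"] this[of 0 2] this[of "Suc 0" 0] this[of "Suc 0" "Suc 0"]
    this[of "Suc 0" 2] this[of 2 0] this[of 2 "Suc 0"] this[of 2 2]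
  show ?R by simp
qed simp

lemma m3_mult:
  fixes a :: "'a::comm_ring_1"
  shows "m3 a b c d e f g h i * m3 a' b' c' d' e' f' g' h' i' =
    m3 (a * a' + b * d' + c * g') (a * b' + b * e' + c * h') (a * c' + b * f' + c * i')
       (d * a' + e * d' + f * g') (d * b' + e * e' + f * h') (d * c' + e * f' + f * i')
       (g * a' + h * d' + i * g') (g * b' + h * e' + i * h') (g * c' + h * f' + i * i')"
  by (rule eq_m3I[OF mult_carrier_mat[OF m3_carrier m3_carrier]])
    (simp_all add: m3_def scalar_prod_def numeral_3_eq_3 numeral_2_eq_2 algebra_simps)

lemma one_m3: "1\<^sub>m 3 = m3 1 0 0 0 1 0 0 0 1"
  by (rule eq_m3I) simp_all

lemma sM_m3: "sM = m3 0 0 1 0 1 0 1 0 0"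
  by (rule eq_m3I) (simp_all add: sM_def)

lemma diag3_m3: "diag3 a b c = m3 a 0 0 0 b 0 0 0 c"
  by (rule eq_m3I) (simp_all add: diag3_def)

lemma nS_m3: "nS s = m3 0 0 (- inverse s) 0 1 0 s 0 0"
  by (rule eq_m3I) (simp_all add: nS_def)

lemma nS'_m3: "nS' s w = m3 0 0 (- (inverse w * inverse s)) 0 1 0 (w * s) 0 0"
  by (rule eq_m3I) (simp_all add: nS'_def)

lemma adjoint_m3: "transpose_mat (map_mat sg (m3 a b c d e f g h i)) =
    m3 (sg a) (sg d) (sg g) (sg b) (sg e) (sg h) (sg c) (sg f) (sg i)"
  by (rule eq_m3I) (simp_all add: m3_def)

lemma m3_Ggrp: "m3 a b c d e f g h i \<in> Ggrp sg \<longleftrightarrow>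
    sg g * a + sg d * d + sg a * g = 0 \<and> sg g * b + sg d * e + sg a * h = 0 \<and>
    sg g * c + sg d * f + sg a * i = 1 \<and> sg h * a + sg e * d + sg b * g = 0 \<and>
    sg h * b + sg e * e + sg b * h = 1 \<and> sg h * c + sg e * f + sg b * i = 0 \<and>
    sg i * a + sg f * d + sg c * g = 1 \<and> sg i * b + sg f * e + sg c * h = 0 \<and>
    sg i * c + sg f * f + sg c * i = 0"
  by (simp add: Ggrp_def adjoint_m3 sM_m3 m3_mult m3_eq_iff conj_assoc)

text \<open>The inverse of a unitary matrix, because \<open>sM\<close> is its own inverse. Its
  entries are those of the matrix, conjugated and permuted.\<close>

definition uinv :: "('e::field \<Rightarrow> 'e) \<Rightarrow> 'e mat \<Rightarrow> 'e mat" where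
  "uinv sg A = sM * transpose_mat (map_mat sg A) * sM"

lemma uinv_m3: "uinv sg (m3 a b c d e f g h i) =
    m3 (sg i) (sg f) (sg c) (sg h) (sg e) (sg b) (sg g) (sg d) (sg a)"
  by (simp add: uinv_def adjoint_m3 sM_m3 m3_mult)

lemma Ggrp_E:
  assumes "A \<in> Ggrp sg"
  obtains a b c d e f g h i where "A = m3 a b c d e f g h i" "m3 a b c d e f g h i \<in> Ggrp sg"
  using assms carrier3E[of A] by (metis (no_types, lifting) Ggrp_def mem_Collect_eq)

lemma uinv_carrier: "A \<in> carrier_mat 3 3 \<Longrightarrow> uinv sg A \<in> carrier_mat 3 3"
  by (erule carrier3E) (simp add: uinv_m3)

lemma uinv_left: "A \<in> Ggrp sg \<Longrightarrow> uinv sg A * A = 1\<^sub>m 3"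
  by (erule Ggrp_E) (simp add: uinv_m3 m3_mult one_m3 m3_eq_iff m3_Ggrp)

lemma uinv_right: "A \<in> Ggrp sg \<Longrightarrow> A * uinv sg A = 1\<^sub>m 3"
  using mat_mult_left_right_inverse[of "uinv sg A" 3 A] uinv_left[of A sg] uinv_carrier[of A sg]
  by (auto simp: Ggrp_def)

section \<open>Valuation, conjugation and units\<close>

locale unramified_data =
  fixes v :: "'e::field \<Rightarrow> int" and sg :: "'e \<Rightarrow> 'e" and eps seps w :: 'e and p q :: nat
  assumes data: "unram_local_data v sg eps seps w p q"
begin

lemma
  shows v_mult: "x \<noteq> 0 \<Longrightarrow> y \<noteq> 0 \<Longrightarrow> v (x * y) = v x + v y"
    and v_add: "x \<noteq> 0 \<Longrightarrow> y \<noteq> 0 \<Longrightarrow> x + y \<noteq> 0 \<Longrightarrow> min (v x) (v y) \<le> v (x + y)"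
    and sg_add [simp]: "sg (x + y) = sg x + sg y"
    and sg_mult [simp]: "sg (x * y) = sg x * sg y"
    and sg_1 [simp]: "sg 1 = 1"
    and sg_sg [simp]: "sg (sg x) = x"
    and v_sg': "x \<noteq> 0 \<Longrightarrow> v (sg x) = v x"
    and sg_eps [simp]: "sg eps = eps" and eps0: "eps \<noteq> 0" and v_eps: "v eps = 0"
    and seps_sq: "seps * seps = eps" and sg_seps_neq: "sg seps \<noteq> seps"
    and sg_w [simp]: "sg w = w" and w0 [simp]: "w \<noteq> 0" and v_w [simp]: "v w = 1"
    and p_odd: "odd p" and p_pEk: "of_nat p \<in> pEk v 1"
    and fin_resF: "finite (resF v sg)" and card_resF: "card (resF v sg) = q"
  using data unfolding unram_local_data_def by blast+

lemma sg_0 [simp]: "sg 0 = 0" 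
proof -
  have "sg 0 + sg 0 = sg 0 + 0" by (metis add_0_right sg_add)
  then show ?thesis by (rule add_left_imp_eq)
qed
lemma sg_minus [simp]: "sg (- x) = - sg x" using sg_add[of x "- x"] by (simp add: eq_neg_iff_add_eq_0 add.commute)
lemma sg_diff [simp]: "sg (x - y) = sg x - sg y" using sg_add[of x "- y"] by simp
lemma sg_eq_0 [simp]: "sg x = 0 \<longleftrightarrow> x = 0" by (metis sg_0 sg_sg)
lemma sg_inverse [simp]: "sg (inverse x) = inverse (sg x)"
proof (cases "x = 0")
  case False
  then have "sg x * sg (inverse x) = 1" using sg_mult[of x "inverse x"] by simp
  then show ?thesis by (metis inverse_unique)
qed simp
lemma sg_divide [simp]: "sg (x / y) = sg x / sg y" by (simp add: divide_inverse)
lemma sg_of_nat [simp]: "sg (of_nat m) = of_nat m" by (induction m) simp_all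
lemma sg_numeral [simp]: "sg (numeral m) = numeral m" using sg_of_nat[of "numeral m"] by simp

lemma v_1 [simp]: "v 1 = 0" using v_mult[of 1 1] by simp
lemma v_m1 [simp]: "v (- 1) = 0" using v_mult[of "- 1" "- 1"] by simp
lemma v_minus [simp]: "v (- x) = v x"
  using v_mult[of "- 1" x] by (cases "x = 0") simp_all
lemma v_inverse: "x \<noteq> 0 \<Longrightarrow> v (inverse x) = - v x"
  using v_mult[of x "inverse x"] by simp
lemma v_divide: "x \<noteq> 0 \<Longrightarrow> y \<noteq> 0 \<Longrightarrow> v (x / y) = v x - v y"
  by (simp add: divide_inverse v_mult v_inverse)
lemma v_sg [simp]: "v (sg x) = v x" by (cases "x = 0") (simp_all add: v_sg')

abbreviation "P \<equiv> pEk v"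

lemma oE_eq: "oE v = P 0" by (simp add: oE_def pEk_def)

lemma P_iff: "x \<noteq> 0 \<Longrightarrow> x \<in> P k \<longleftrightarrow> k \<le> v x" by (simp add: pEk_def)
lemma P_0 [simp]: "0 \<in> P k" by (simp add: pEk_def)
lemma P_1 [simp]: "1 \<in> P 0" by (simp add: P_iff)
lemma one_notin_P1: "1 \<notin> P 1" by (simp add: P_iff)
lemma P_minus [simp]: "- x \<in> P k \<longleftrightarrow> x \<in> P k" by (simp add: pEk_def)
lemma P_sg [simp]: "sg x \<in> P k \<longleftrightarrow> x \<in> P k" by (simp add: pEk_def)
lemma P_add: "x \<in> P k \<Longrightarrow> y \<in> P k \<Longrightarrow> x + y \<in> P k"
  using v_add[of x y] by (cases "x = 0 \<or> y = 0 \<or> x + y = 0") (auto simp: pEk_def)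
lemma P_diff: "x \<in> P k \<Longrightarrow> y \<in> P k \<Longrightarrow> x - y \<in> P k"
  using P_add[of x k "- y"] by simp
lemma P_mult: "x \<in> P k \<Longrightarrow> y \<in> P l \<Longrightarrow> x * y \<in> P (k + l)"
  by (cases "x = 0 \<or> y = 0") (auto simp: pEk_def v_mult)
lemma P_mono: "x \<in> P k \<Longrightarrow> l \<le> k \<Longrightarrow> x \<in> P l" by (auto simp: pEk_def)
lemma P1_P0: "x \<in> P 1 \<Longrightarrow> x \<in> P 0" by (auto simp: pEk_def)
lemma P00: "x \<in> P 0 \<Longrightarrow> y \<in> P 0 \<Longrightarrow> x * y \<in> P 0" using P_mult[of x 0 y 0] by simp
lemma P10: "x \<in> P 1 \<Longrightarrow> y \<in> P 0 \<Longrightarrow> x * y \<in> P 1" using P_mult[of x 1 y 0] by simp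
lemma P01: "x \<in> P 0 \<Longrightarrow> y \<in> P 1 \<Longrightarrow> x * y \<in> P 1" using P_mult[of x 0 y 1] by simp

definition unit :: "'e \<Rightarrow> bool" where "unit x \<longleftrightarrow> x \<noteq> 0 \<and> v x = 0"

lemma unit_P0: "unit x \<Longrightarrow> x \<in> P 0" by (simp add: unit_def P_iff)
lemma unit_iff: "unit x \<longleftrightarrow> x \<in> P 0 \<and> x \<notin> P 1"
  by (auto simp: unit_def pEk_def)
lemma unit_mult: "unit x \<Longrightarrow> unit y \<Longrightarrow> unit (x * y)" by (simp add: unit_def v_mult)
lemma unit_inverse: "unit x \<Longrightarrow> unit (inverse x)" by (simp add: unit_def v_inverse)
lemma unit_divide: "unit x \<Longrightarrow> unit y \<Longrightarrow> unit (x / y)" by (simp add: unit_def v_divide)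
lemma unit_sg [simp]: "unit (sg x) \<longleftrightarrow> unit x" by (simp add: unit_def)
lemma unit_minus [simp]: "unit (- x) \<longleftrightarrow> unit x" by (simp add: unit_def)
lemma unit_1 [simp]: "unit 1" by (simp add: unit_def)
lemma unit_nonzero: "unit x \<Longrightarrow> x \<noteq> 0" by (simp add: unit_def)
lemma unit_mult_P: "unit u \<Longrightarrow> u * x \<in> P k \<longleftrightarrow> x \<in> P k"
  by (cases "x = 0") (auto simp: unit_def pEk_def v_mult)
lemma unit_divide_P: "unit u \<Longrightarrow> x / u \<in> P k \<longleftrightarrow> x \<in> P k"
  using unit_mult_P[OF unit_inverse, of u x k] by (simp add: divide_inverse mult.commute)
lemma unit_cong: "unit x \<Longrightarrow> x - y \<in> P 1 \<Longrightarrow> unit y"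
proof -
  assume "unit x" "x - y \<in> P 1"
  then have "y \<in> P 0" using P_diff[of x 0 "x - y"] P1_P0 unit_P0 by simp
  moreover have "y \<notin> P 1" using \<open>unit x\<close> P_add[of "x - y" 1 y] \<open>x - y \<in> P 1\<close> by (auto simp: unit_iff)
  ultimately show "unit y" by (simp add: unit_iff)
qed
lemma unit_prod_cong: "x \<in> P 0 \<Longrightarrow> y \<in> P 0 \<Longrightarrow> x * y - 1 \<in> P 1 \<Longrightarrow> unit x"
proof -
  assume *: "x \<in> P 0" "y \<in> P 0" "x * y - 1 \<in> P 1"
  have "x \<notin> P 1"
  proof
    assume "x \<in> P 1"
    then have "x * y - (x * y - 1) \<in> P 1" using * P_diff P10 by blast
    then show False using one_notin_P1 by simp
  qed
  then show "unit x" using * by (simp add: unit_iff)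
qed

lemma of_nat_P0: "of_nat m \<in> P 0"
  by (induction m) (auto intro: P_add)

text \<open>Otherwise \<open>1 = p - 2 m\<close> would lie in the maximal ideal, as \<open>p\<close>
  is odd and lies there.\<close>

lemma unit_2: "unit 2"
proof -
  have "(2::'e) \<notin> P 1"
  proof
    assume 2: "(2::'e) \<in> P 1"
    obtain m where "p = 2 * m + 1" using p_odd by (elim oddE)
    then have "(of_nat p :: 'e) - 2 * of_nat m = 1" by simp
    then have "1 \<in> P 1" using P_diff[OF p_pEk P10[OF 2 of_nat_P0[of m]]] by simp
    then show False using one_notin_P1 by simp
  qed
  then show ?thesis using of_nat_P0[of 2] by (simp add: unit_iff)
qed

lemma two0 [simp]: "(2::'e) \<noteq> 0" using unit_2 by (simp add: unit_def)

lemma four0 [simp]: "(4::'e) \<noteq> 0"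
proof -
  have "(4::'e) = 2 * 2" by simp
  then show ?thesis using two0 by (metis mult_eq_0_iff)
qed

lemma seps0 [simp]: "seps \<noteq> 0" using sg_seps_neq by auto

lemma sg_seps [simp]: "sg seps = - seps"
proof -
  have "sg seps * sg seps = seps * seps" using sg_eps seps_sq by (metis sg_mult)
  then have "(sg seps - seps) * (sg seps + seps) = 0" by (simp add: algebra_simps)
  then show ?thesis using sg_seps_neq by (simp add: eq_neg_iff_add_eq_0)
qed

lemma unit_seps: "unit seps"
  using v_mult[of seps seps] seps_sq v_eps by (simp add: unit_def)

lemma unit_eps: "unit eps" using eps0 v_eps by (simp add: unit_def)

definition re :: "'e \<Rightarrow> 'e" where "re x = (x + sg x) / 2"
definition im :: "'e \<Rightarrow> 'e" where "im x = (x - sg x) / (2 * seps)"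

lemma sg_re [simp]: "sg (re x) = re x" by (simp add: re_def add.commute)
lemma sg_im [simp]: "sg (im x) = im x"
proof -
  have "sg (im x) = (sg x - x) / (- (2 * seps))" by (simp add: im_def)
  also have "sg x - x = - (x - sg x)" by simp
  finally show ?thesis by (simp only: im_def minus_divide_divide)
qed
lemma re_im: "x = re x + im x * seps"
  by (simp add: re_def im_def field_simps)
lemma re_P: "x \<in> P k \<Longrightarrow> re x \<in> P k"
  unfolding re_def by (simp add: unit_divide_P[OF unit_2] P_add)
lemma im_P: "x \<in> P k \<Longrightarrow> im x \<in> P k"
  unfolding im_def by (simp add: unit_divide_P[OF unit_mult[OF unit_2 unit_seps]] P_diff)
lemma re_eq: "sg a = a \<Longrightarrow> sg b = b \<Longrightarrow> re (a + b * seps) = a" by (simp add: re_def)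
lemma im_eq: "sg a = a \<Longrightarrow> sg b = b \<Longrightarrow> im (a + b * seps) = b" by (simp add: im_def)

text \<open>The coordinates come from \<open>x\<close> and its conjugate by division by
  \<open>2\<close> and \<open>2 * seps\<close>, which are units.\<close>

lemma P_decomp: "sg a = a \<Longrightarrow> sg b = b \<Longrightarrow> a + b * seps \<in> P k \<longleftrightarrow> a \<in> P k \<and> b \<in> P k"
  using re_P[of "a + b * seps" k] im_P[of "a + b * seps" k] unit_mult_P[OF unit_seps, of b k]
  by (auto simp: re_eq im_eq mult.commute intro: P_add)

lemma P1_of_norm: "x * sg x \<in> P 1 \<Longrightarrow> x \<in> P 1"
  by (cases "x = 0") (auto simp: P_iff v_mult)

lemma P0_of_norm: "x * sg x \<in> P 0 \<Longrightarrow> x \<in> P 0"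
  by (cases "x = 0") (auto simp: P_iff v_mult)

section \<open>The unitary group and its Iwahori subgroup\<close>

abbreviation "GG \<equiv> Ggrp sg"
abbreviation "II \<equiv> Iw v sg"
abbreviation "iv \<equiv> uinv sg"

lemma one_GG: "1\<^sub>m 3 \<in> GG" by (simp add: one_m3 m3_Ggrp)

lemma GG_carrier: "g \<in> GG \<Longrightarrow> g \<in> carrier_mat 3 3" by (simp add: Ggrp_def)

lemma adjoint_mult:
  "A \<in> carrier_mat 3 3 \<Longrightarrow> B \<in> carrier_mat 3 3 \<Longrightarrow>
    transpose_mat (map_mat sg (A * B)) = transpose_mat (map_mat sg B) * transpose_mat (map_mat sg A)"
  by (elim carrier3E) (simp add: m3_mult adjoint_m3 mult.commute)

lemma GG_mult:
  assumes "g \<in> GG" "h \<in> GG" shows "g * h \<in> GG"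
proof -
  let ?t = "\<lambda>A. transpose_mat (map_mat sg A)"
  have c: "g \<in> carrier_mat 3 3" "h \<in> carrier_mat 3 3" "?t g \<in> carrier_mat 3 3" "?t h \<in> carrier_mat 3 3"
    "?t g * sM \<in> carrier_mat 3 3" "?t g * sM * g \<in> carrier_mat 3 3" "sM \<in> carrier_mat 3 3"
    using assms by (auto simp: Ggrp_def sM_m3)
  have "?t (g * h) * sM * (g * h) = ?t h * (?t g * sM) * (g * h)"
    using c by (simp add: adjoint_mult assoc_mult_mat[OF c(4,3,7)])
  also have "\<dots> = ?t h * (?t g * sM * g * h)"
    by (simp only: assoc_mult_mat[OF c(4,5) mult_carrier_mat[OF c(1,2)]] assoc_mult_mat[OF c(5,1,2)])
  also have "\<dots> = ?t h * (?t g * sM * g) * h" by (rule assoc_mult_mat[OF c(4,6,2), symmetric])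
  also have "\<dots> = sM" using assms by (simp add: Ggrp_def)
  finally show ?thesis using c by (simp add: Ggrp_def)
qed

lemma GG_iv: assumes "g \<in> GG" shows "iv g \<in> GG"
proof -
  obtain a b c d e f h i j where g: "g = m3 a b c d e f h i j" by (rule Ggrp_E[OF assms])
  have "g * iv g = 1\<^sub>m 3" by (rule uinv_right[OF assms])
  then show ?thesis by (simp add: g uinv_m3 m3_mult one_m3 m3_eq_iff m3_Ggrp mult.commute)
qed

text \<open>The integral inverse required by \<open>GL3o\<close> is automatic, since
  \<open>uinv\<close> only conjugates and permutes entries.\<close>

lemma m3_II: "m3 a b c d e f g h i \<in> II \<longleftrightarrow> m3 a b c d e f g h i \<in> GG \<and>
    a \<in> P 0 \<and> b \<in> P 0 \<and> c \<in> P 0 \<and> d \<in> P 1 \<and> e \<in> P 0 \<and> f \<in> P 0 \<and> g \<in> P 1 \<and> h \<in> P 1 \<and> i \<in> P 0"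
  (is "?A \<in> II \<longleftrightarrow> ?R")
proof
  assume "?A \<in> II"
  then show ?R by (auto simp: Iw_def GL3o_def integral_mat_def all_less3 oE_eq)
next
  assume R: ?R
  then have "integral_mat v ?A" "integral_mat v (iv ?A)"
    by (auto simp: integral_mat_def all_less3 oE_eq uinv_m3 P1_P0)
  moreover have "iv ?A \<in> carrier_mat 3 3" by (simp add: uinv_m3)
  ultimately show "?A \<in> II"
    using R uinv_left[of ?A sg] uinv_right[of ?A sg]
    by (auto simp: Iw_def GL3o_def all_less3 intro!: bexI[of _ "iv ?A"])
qed

lemma m3_Iw1: "m3 a b c d e f g h i \<in> Iw1 v sg \<longleftrightarrow> m3 a b c d e f g h i \<in> II \<and>
    a - 1 \<in> P 1 \<and> e - 1 \<in> P 1 \<and> i - 1 \<in> P 1"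
  by (simp add: Iw1_def all_less3)

lemma II_GG: "k \<in> II \<Longrightarrow> k \<in> GG" by (simp add: Iw_def)

lemma II_E:
  assumes "A \<in> II"
  obtains a b c d e f g h i where "A = m3 a b c d e f g h i" "m3 a b c d e f g h i \<in> II"
  using assms carrier3E[of A] GG_carrier[OF II_GG] by metis

lemma one_II: "1\<^sub>m 3 \<in> II" by (simp add: one_m3 m3_II m3_Ggrp)

lemma II_mult: assumes "k \<in> II" "l \<in> II" shows "k * l \<in> II"
proof -
  obtain a b c d e f g h i where k: "k = m3 a b c d e f g h i" by (rule II_E[OF assms(1)])
  obtain a' b' c' d' e' f' g' h' i' where l: "l = m3 a' b' c' d' e' f' g' h' i'" by (rule II_E[OF assms(2)])
  show ?thesis
    using GG_mult[OF II_GG II_GG, OF assms] assms unfolding k l m3_mult m3_II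
    by (intro conjI P_add) (auto intro: P00 P10 P01 P1_P0)
qed

lemma II_iv: assumes "k \<in> II" shows "iv k \<in> II"
proof -
  obtain a b c d e f g h i where k: "k = m3 a b c d e f g h i" by (rule II_E[OF assms(1)])
  show ?thesis using assms GG_iv[OF II_GG, OF assms] by (simp add: k uinv_m3 m3_II)
qed

end

context unramified_data
begin

subsection \<open>Representatives of residue classes\<close>

abbreviation "OF \<equiv> {x \<in> P 0. sg x = x}"

text \<open>The class of \<open>0\<close> is represented by \<open>0\<close> so that the trivial coset is represented by the identity matrix.\<close>

definition rep :: "'e \<Rightarrow> 'e" where
  "rep x = (if x \<in> P 1 then 0 else SOME y. y \<in> OF \<and> x - y \<in> P 1)"

lemma rep: assumes "x \<in> OF" shows rep_OF: "rep x \<in> OF" and rep_diff: "x - rep x \<in> P 1"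
proof -
  have "rep x \<in> OF \<and> x - rep x \<in> P 1"
  proof (cases "x \<in> P 1")
    case False
    have "(SOME y. y \<in> OF \<and> x - y \<in> P 1) \<in> OF \<and> x - (SOME y. y \<in> OF \<and> x - y \<in> P 1) \<in> P 1"
      by (rule someI[of _ x]) (use assms in simp)
    then show ?thesis using False by (simp add: rep_def)
  qed (simp add: rep_def)
  then show "rep x \<in> OF" "x - rep x \<in> P 1" by blast+
qed

lemma P_cong: "x - y \<in> P k \<Longrightarrow> x \<in> P k \<longleftrightarrow> y \<in> P k"
  using P_add[of "x - y" k y] P_diff[of x k "x - y"] by auto

lemma P_diff_commute: "x - y \<in> P k \<longleftrightarrow> y - x \<in> P k"
  using P_minus[of "x - y" k] by simp

lemma P_diff_trans: "x - y \<in> P k \<Longrightarrow> y - z \<in> P k \<Longrightarrow> x - z \<in> P k"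
  using P_add[of "x - y" k "y - z"] by simp

lemma rep_cong: assumes "x - y \<in> P 1" shows "rep x = rep y"
proof -
  have "x - z \<in> P 1 \<longleftrightarrow> y - z \<in> P 1" for z
    by (rule P_cong) (use assms in simp)
  then show ?thesis using P_cong[OF assms] by (simp add: rep_def)
qed

definition R :: "'e set" where "R = rep ` OF"

lemma R_OF: "r \<in> R \<Longrightarrow> r \<in> OF" using rep_OF by (auto simp: R_def)
lemma R_P0: "r \<in> R \<Longrightarrow> r \<in> P 0" and R_sg: "r \<in> R \<Longrightarrow> sg r = r" using R_OF by auto
lemma rep_R: "x \<in> OF \<Longrightarrow> rep x \<in> R" by (simp add: R_def)
lemma rep_id: "r \<in> R \<Longrightarrow> rep r = r"
  using rep_cong[OF rep_diff] by (auto simp: R_def)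
lemma R_eqI: "r \<in> R \<Longrightarrow> r' \<in> R \<Longrightarrow> r - r' \<in> P 1 \<Longrightarrow> r = r'"
  using rep_cong rep_id by metis
lemma zero_R: "0 \<in> R" using rep_R[of 0] by (simp add: rep_def)
lemma R_P1: "r \<in> R \<Longrightarrow> r \<in> P 1 \<longleftrightarrow> r = 0" using R_eqI[OF _ zero_R] by auto

lemma R_bij: "bij_betw (\<lambda>x. {y \<in> oE v \<inter> fixF sg. x - y \<in> P 1}) R (resF v sg)"
  (is "bij_betw ?C _ _")
proof (rule bij_betwI')
  fix r r' assume r: "r \<in> R" "r' \<in> R"
  show "?C r = ?C r' \<longleftrightarrow> r = r'"
  proof
    assume "?C r = ?C r'"
    moreover have "r \<in> ?C r" using R_OF[OF r(1)] by (simp add: oE_eq fixF_def)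
    ultimately have "r' - r \<in> P 1" by blast
    then show "r = r'" using R_eqI[OF r(2,1)] by simp
  qed simp
next
  fix r assume "r \<in> R"
  then have "r \<in> oE v \<inter> fixF sg" using R_OF[of r] by (simp add: oE_eq fixF_def)
  then show "?C r \<in> resF v sg" unfolding resF_def by (rule imageI)
next
  fix C assume "C \<in> resF v sg"
  then obtain x where x: "x \<in> OF" "C = ?C x" by (auto simp: resF_def oE_eq fixF_def)
  have "x - y \<in> P 1 \<longleftrightarrow> rep x - y \<in> P 1" for y
    by (rule P_cong) (use rep_diff[OF x(1)] in simp)
  then have "C = ?C (rep x)" by (simp add: x(2))
  then show "\<exists>r\<in>R. C = ?C r" using rep_R[OF x(1)] by blast
qed

lemma finite_R: "finite R" and card_R: "card R = q"
  using bij_betw_finite[OF R_bij] bij_betw_same_card[OF R_bij] fin_resF card_resF by auto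

lemma OF_mult: "x \<in> OF \<Longrightarrow> y \<in> OF \<Longrightarrow> x * y \<in> OF" by (simp add: P00)
lemma sum_R_scale:
  assumes h: "\<And>x y. x \<in> OF \<Longrightarrow> y \<in> OF \<Longrightarrow> x - y \<in> P 1 \<Longrightarrow> h x = h y"
    and c: "unit c" "sg c = c"
  shows "(\<Sum>t\<in>R. h (c * t)) = (\<Sum>t\<in>R. h t)"
proof -
  have c': "c \<in> OF" using c unit_P0 by simp
  have inj: "inj_on (\<lambda>t. rep (c * t)) R"
  proof (rule inj_onI)
    fix s t assume st: "s \<in> R" "t \<in> R" "rep (c * s) = rep (c * t)"
    have "c * s - rep (c * t) \<in> P 1" "rep (c * t) - c * t \<in> P 1"
      using rep_diff[OF OF_mult[OF c' R_OF[OF st(1)]]] rep_diff[OF OF_mult[OF c' R_OF[OF st(2)]]]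
      by (simp_all add: st(3) P_diff_commute[of "rep (c * t)"])
    then have "c * (s - t) \<in> P 1" using P_diff_trans by (fastforce simp: right_diff_distrib)
    then show "s = t" using R_eqI st unit_mult_P[OF c(1)] by blast
  qed
  have bij: "bij_betw (\<lambda>t. rep (c * t)) R R"
    using inj rep_R[OF OF_mult[OF c' R_OF]] finite_R by (simp add: bij_betw_def endo_inj_surj image_subset_iff)
  have "(\<Sum>t\<in>R. h t) = (\<Sum>t\<in>R. h (rep (c * t)))"
    by (rule sum.reindex_bij_betw[OF bij, symmetric])
  also have "\<dots> = (\<Sum>t\<in>R. h (c * t))"
  proof (rule sum.cong[OF refl])
    fix t assume "t \<in> R"
    then have "c * t \<in> OF" using OF_mult[OF c' R_OF] by blast
    then show "h (rep (c * t)) = h (c * t)" using h[OF _ rep_OF rep_diff] by metis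
  qed
  finally show ?thesis by simp
qed

text \<open>Through the coordinates with respect to \<open>1\<close> and \<open>seps\<close>,
  \<open>R \<times> R\<close> represents the residue field of \<open>E\<close>.\<close>

definition pt :: "'e \<times> 'e \<Rightarrow> 'e" where "pt z = fst z + snd z * seps"

lemma pt_P0: "z \<in> R \<times> R \<Longrightarrow> pt z \<in> P 0"
  using R_P0 R_sg by (auto simp: pt_def P_decomp)

lemma pt_eqI: "z \<in> R \<times> R \<Longrightarrow> z' \<in> R \<times> R \<Longrightarrow> pt z - pt z' \<in> P 1 \<Longrightarrow> z = z'"
proof -
  assume z: "z \<in> R \<times> R" "z' \<in> R \<times> R" and "pt z - pt z' \<in> P 1"
  then have "(fst z - fst z') + (snd z - snd z') * seps \<in> P 1" by (simp add: pt_def algebra_simps)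
  then have "fst z - fst z' \<in> P 1" "snd z - snd z' \<in> P 1"
    using z R_sg P_decomp[of "fst z - fst z'" "snd z - snd z'" 1] by auto
  then show "z = z'" using z R_eqI by (auto simp: prod_eq_iff)
qed

definition rep2 :: "'e \<Rightarrow> 'e \<times> 'e" where "rep2 x = (rep (re x), rep (im x))"

lemma rep2: assumes "x \<in> P 0" shows rep2_R: "rep2 x \<in> R \<times> R" and rep2_diff: "x - pt (rep2 x) \<in> P 1"
proof -
  have O: "re x \<in> OF" "im x \<in> OF" using assms re_P im_P by auto
  then show "rep2 x \<in> R \<times> R" by (simp add: rep2_def rep_R)
  have "x - pt (rep2 x) = (re x - rep (re x)) + (im x - rep (im x)) * seps"
    using re_im[of x] by (simp add: rep2_def pt_def algebra_simps)
  also have "\<dots> \<in> P 1" using rep_diff O rep_OF by (subst P_decomp) auto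
  finally show "x - pt (rep2 x) \<in> P 1" .
qed

lemma pt_P1: "z \<in> R \<times> R \<Longrightarrow> pt z \<in> P 1 \<longleftrightarrow> z = (0, 0)"
  using pt_eqI[of z "(0, 0)"] zero_R by (auto simp: pt_def)

lemma pt_unit: "z \<in> R \<times> R \<Longrightarrow> unit (pt z) \<longleftrightarrow> z \<noteq> (0, 0)"
  using pt_P1 pt_P0 by (auto simp: unit_iff)

lemma sum_pt_scale:
  assumes h: "\<And>x y. x \<in> P 0 \<Longrightarrow> y \<in> P 0 \<Longrightarrow> x - y \<in> P 1 \<Longrightarrow> h x = h y" and c: "unit c"
  shows "(\<Sum>z\<in>R \<times> R. h (c * pt z)) = (\<Sum>z\<in>R \<times> R. h (pt z))"
proof -
  have cz: "c * pt z \<in> P 0" if "z \<in> R \<times> R" for z using P00[OF unit_P0[OF c] pt_P0[OF that]] .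
  have inj: "inj_on (\<lambda>z. rep2 (c * pt z)) (R \<times> R)"
  proof (rule inj_onI)
    fix z z' assume z: "z \<in> R \<times> R" "z' \<in> R \<times> R" "rep2 (c * pt z) = rep2 (c * pt z')"
    have "c * pt z - pt (rep2 (c * pt z')) \<in> P 1" "pt (rep2 (c * pt z')) - c * pt z' \<in> P 1"
      using rep2_diff[OF cz[OF z(1)]] rep2_diff[OF cz[OF z(2)]]
      by (simp_all add: z(3) P_diff_commute[of "pt (rep2 (c * pt z'))"])
    then have "c * (pt z - pt z') \<in> P 1" using P_diff_trans by (fastforce simp: right_diff_distrib)
    then show "z = z'" using pt_eqI z unit_mult_P[OF c] by blast
  qed
  have bij: "bij_betw (\<lambda>z. rep2 (c * pt z)) (R \<times> R) (R \<times> R)"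
    using inj rep2_R[OF cz] finite_R
    by (simp add: bij_betw_def endo_inj_surj image_subset_iff del: mem_Sigma_iff)
  have "(\<Sum>z\<in>R \<times> R. h (pt z)) = (\<Sum>z\<in>R \<times> R. h (pt (rep2 (c * pt z))))"
    by (rule sum.reindex_bij_betw[OF bij, symmetric])
  also have "\<dots> = (\<Sum>z\<in>R \<times> R. h (c * pt z))"
  proof (rule sum.cong[OF refl])
    fix z assume z: "z \<in> R \<times> R"
    show "h (pt (rep2 (c * pt z))) = h (c * pt z)"
      using h[OF cz[OF z] pt_P0[OF rep2_R[OF cz[OF z]]] rep2_diff[OF cz[OF z]]] by simp
  qed
  finally show ?thesis by simp
qed

text \<open>Pigeonhole: modulo the maximal ideal, \<open>a \<mapsto> a^2\<close> and \<open>b \<mapsto> c + eps b^2\<close> both take more than \<open>q/2\<close> values,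
  so that they have a common value, and then \<open>a^2 - eps b^2\<close> is congruent to \<open>c\<close>.\<close>

lemma half_of_R:
  assumes f: "\<And>a a'. a \<in> R \<Longrightarrow> a' \<in> R \<Longrightarrow> f a = f a' \<Longrightarrow> a - a' \<in> P 1 \<or> a + a' \<in> P 1"
  shows "q < 2 * card (f ` R)"
proof -
  \<comment> \<open>The value \<open>f 0\<close> is taken only at 0 and every other value at most
    twice, so \<open>q\<close> is at most one plus twice the number of the other values.\<close>
  let ?S = "f ` R - {f 0}"
  have fibre: "card {a \<in> R. f a = s} \<le> 2" for s
  proof (cases "\<exists>a0\<in>R. f a0 = s")
    case True
    then obtain a0 where a0: "a0 \<in> R" "f a0 = s" by blast
    have "{a \<in> R. f a = s} \<subseteq> {a0, rep (- a0)}"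
    proof
      fix a assume "a \<in> {a \<in> R. f a = s}"
      then have a: "a \<in> R" "f a = f a0" using a0 by auto
      then consider "a - a0 \<in> P 1" | "a - (- a0) \<in> P 1" using f[OF a(1) a0(1)] by auto
      then show "a \<in> {a0, rep (- a0)}"
        using R_eqI[OF a(1) a0(1)] rep_cong[of a "- a0"] rep_id[OF a(1)] by cases auto
    qed
    then have "card {a \<in> R. f a = s} \<le> card {a0, rep (- a0)}" by (intro card_mono) auto
    also have "\<dots> \<le> 2" by (simp add: card_insert_if)
    finally show ?thesis .
  next
    case False
    then have "{a \<in> R. f a = s} = {}" by auto
    then show ?thesis by (simp only: card.empty le0)
  qed
  have "R \<subseteq> insert 0 (\<Union>s\<in>?S. {a \<in> R. f a = s})"
  proof
    fix a assume a: "a \<in> R"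
    have "a = 0" if "f a = f 0" using f[OF a zero_R that] R_P1[OF a] by auto
    then show "a \<in> insert 0 (\<Union>s\<in>?S. {a \<in> R. f a = s})" using a by auto
  qed
  then have "q \<le> card (insert 0 (\<Union>s\<in>?S. {a \<in> R. f a = s}))"
    unfolding card_R[symmetric] using finite_R by (intro card_mono) auto
  also have "\<dots> \<le> Suc (card (\<Union>s\<in>?S. {a \<in> R. f a = s}))" by (rule card_insert_le_m1) auto
  also have "card (\<Union>s\<in>?S. {a \<in> R. f a = s}) \<le> (\<Sum>s\<in>?S. card {a \<in> R. f a = s})"
    using finite_R by (intro card_UN_le) auto
  also have "\<dots> \<le> (\<Sum>s\<in>?S. 2)" by (intro sum_mono fibre)
  also have "\<dots> = 2 * (card (f ` R) - 1)" using finite_R zero_R by simp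
  finally have "q \<le> Suc (2 * (card (f ` R) - 1))" by simp
  moreover have "card (f ` R) > 0" using finite_R zero_R by (auto simp: card_gt_0_iff)
  ultimately show ?thesis by linarith
qed

lemma norm_surj:
  assumes c: "unit c" "sg c = c"
  obtains x where "unit x" "x * sg x - c \<in> P 1"
proof -
  let ?f = "\<lambda>a. rep (a * a)" and ?g = "\<lambda>b. rep (c + eps * (b * b))"
  have sq: "a - a' \<in> P 1 \<or> a + a' \<in> P 1" if "a \<in> R" "a' \<in> R" "a * a - a' * a' \<in> P 1" for a a'
  proof -
    have "(a - a') * (a + a') \<in> P 1" using that(3) by (simp add: algebra_simps)
    moreover have "a - a' \<in> P 0" "a + a' \<in> P 0" using that R_P0 P_add P_diff by blast+
    ultimately show ?thesis using unit_mult_P[of "a - a'" "a + a'" 1] unit_iff[of "a - a'"] by blast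
  qed
  have O1: "a * a \<in> OF" if "a \<in> R" for a using R_OF[OF that] OF_mult by blast
  have O2: "c + eps * (b * b) \<in> OF" if "b \<in> R" for b
    using R_OF[OF that] c unit_P0 unit_eps by (auto intro!: P_add P00)
  have eq: "x - y \<in> P 1" if "x \<in> OF" "y \<in> OF" "rep x = rep y" for x y
    using rep_diff[OF that(1)] rep_diff[OF that(2)] that(3) P_diff_trans P_diff_commute by metis
  have "q < 2 * card (?f ` R)"
    by (rule half_of_R) (use sq eq O1 in blast)
  moreover have "q < 2 * card (?g ` R)"
  proof (rule half_of_R)
    fix b b' assume b: "b \<in> R" "b' \<in> R" "?g b = ?g b'"
    have "(c + eps * (b * b)) - (c + eps * (b' * b')) \<in> P 1" by (rule eq) (use b O2 in auto)
    then have "eps * (b * b - b' * b') \<in> P 1" by (simp add: algebra_simps)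
    then show "b - b' \<in> P 1 \<or> b + b' \<in> P 1" using sq b unit_mult_P[OF unit_eps] by blast
  qed
  moreover have "card (?f ` R \<union> ?g ` R) \<le> q"
    unfolding card_R[symmetric] using rep_R O1 O2 by (intro card_mono finite_R) auto
  ultimately have "?f ` R \<inter> ?g ` R \<noteq> {}"
    using card_Un_disjoint[of "?f ` R" "?g ` R"] finite_R by auto
  then obtain a b where ab: "a \<in> R" "b \<in> R" "?f a = ?g b" by blast
  define x where "x = a + b * seps"
  have "x * sg x = a * a - eps * (b * b)"
    using ab R_sg by (simp add: x_def seps_sq[symmetric] algebra_simps)
  then have "x * sg x - c = a * a - (c + eps * (b * b))" by simp
  also have "\<dots> \<in> P 1" by (rule eq) (use ab O1 O2 in auto)
  finally have N: "x * sg x - c \<in> P 1" .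
  have "unit (x * sg x)" using N unit_cong[OF c(1)] P_diff_commute by blast
  moreover have "x \<in> P 0" using ab R_P0 R_sg P_decomp[of a b 0] by (simp add: x_def)
  ultimately have "unit x" using P10[of x "sg x"] by (auto simp: unit_iff)
  then show ?thesis using that N by blast
qed

text \<open>Modulo the maximal ideal the matrix is upper triangular, and unitarity reduces to
  relations between the diagonal entries.\<close>

lemma II_diag_units:
  assumes "m3 a b c d e f g h i \<in> II"
  shows "unit a" "unit i" "e * sg e - 1 \<in> P 1" "a * sg i - 1 \<in> P 1"
proof -
  have O: "a \<in> P 0" "b \<in> P 0" "c \<in> P 0" "d \<in> P 1" "e \<in> P 0" "f \<in> P 0" "g \<in> P 1" "h \<in> P 1" "i \<in> P 0"
    using assms by (auto simp: m3_II)
  have eqs: "sg i * a = 1 - sg f * d - sg c * g" "sg e * e = 1 - sg h * b - sg b * h"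
    using II_GG[OF assms] by (auto simp: m3_Ggrp algebra_simps)
  have "a * sg i - 1 = - (sg f * d) - sg c * g" using eqs(1) by (simp add: mult.commute)
  also have "\<dots> \<in> P 1" by (intro P_diff P01 P_minus[THEN iffD2]) (use O in auto)
  finally show 1: "a * sg i - 1 \<in> P 1" .
  have "e * sg e - 1 = - (sg h * b) - sg b * h" using eqs(2) by (simp add: mult.commute)
  also have "\<dots> \<in> P 1" by (intro P_diff P_minus[THEN iffD2] P01[of "sg b"] P10[of "sg h"]) (use O in auto)
  finally show "e * sg e - 1 \<in> P 1" .
  show "unit a" by (rule unit_prod_cong[OF _ _ 1]) (use O in auto)
  have "sg i * a - 1 \<in> P 1" using 1 by (simp add: mult.commute)
  then have "unit (sg i)" by (rule unit_prod_cong[rotated 2]) (use O in auto)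
  then show "unit i" by simp
qed

end

section \<open>The character on the torus\<close>

locale unramified_character = unramified_data v sg eps seps w p q
  for v :: "'e::field \<Rightarrow> int" and sg :: "'e \<Rightarrow> 'e" and eps seps w :: 'e and p q :: nat +
  fixes chi :: "'e mat \<Rightarrow> 'c::field"
  assumes char: "of_nat ((q^2 - 1) * (q + 1)) \<noteq> (0 :: 'c)"
    and chi_char: "H_char v sg chi"
    and chi_s: "chi_s_fixed v sg chi"
    and not_det: "\<not> chi_factors_det v sg chi"
begin

lemma chi_mult: "k \<in> II \<Longrightarrow> l \<in> II \<Longrightarrow> chi (k * l) = chi k * chi l"
  and chi_Iw1: "k \<in> Iw1 v sg \<Longrightarrow> chi k = 1"
  using chi_char by (auto simp: H_char_def)

lemma chi_one: "chi (1\<^sub>m 3) = 1"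
  by (rule chi_Iw1) (use one_II in \<open>simp add: one_m3 m3_Iw1\<close>)

text \<open>The quotient \<open>iv k * k'\<close> lies in \<open>I(1)\<close>: by unitarity of
  \<open>k\<close> its diagonal entries are congruent to 1.\<close>

lemma chi_cong:
  assumes k: "m3 a b c d e f g h i \<in> II" and k': "m3 a' b' c' d' e' f' g' h' i' \<in> II"
    and ae: "a' - a \<in> P 1" "e' - e \<in> P 1" "i' - i \<in> P 1"
  shows "chi (m3 a b c d e f g h i) = chi (m3 a' b' c' d' e' f' g' h' i')"
proof -
  let ?k = "m3 a b c d e f g h i" and ?k' = "m3 a' b' c' d' e' f' g' h' i'"
  let ?l = "iv ?k * ?k'"
  have l: "?l \<in> II" by (intro II_mult II_iv k k')
  have eqs: "sg i * a = 1 - sg f * d - sg c * g" "sg e * e = 1 - sg h * b - sg b * h"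
    "sg a * i = 1 - sg g * c - sg d * f"
    using II_GG[OF k] by (auto simp: m3_Ggrp algebra_simps)
  have O: "a \<in> P 0" "b \<in> P 0" "c \<in> P 0" "d \<in> P 1" "e \<in> P 0" "f \<in> P 0" "g \<in> P 1" "h \<in> P 1" "i \<in> P 0"
    "a' \<in> P 0" "b' \<in> P 0" "c' \<in> P 0" "d' \<in> P 1" "e' \<in> P 0" "f' \<in> P 0" "g' \<in> P 1" "h' \<in> P 1" "i' \<in> P 0"
    using k k' by (auto simp: m3_II)
  have t: "sg i * (a' - a) \<in> P 1" "sg e * (e' - e) \<in> P 1" "sg a * (i' - i) \<in> P 1"
    by (rule P01; use O ae in simp)+
  have "sg i * a' + sg f * d' + sg c * g' - 1 =
      sg i * (a' - a) + sg f * d' + sg c * g' - sg f * d - sg c * g"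
    by (simp add: right_diff_distrib eqs(1))
  also have "\<dots> \<in> P 1" by (intro P_add P_diff t P01) (use O in auto)
  finally have 1: "sg i * a' + sg f * d' + sg c * g' - 1 \<in> P 1" .
  have "sg h * b' + sg e * e' + sg b * h' - 1 =
      sg e * (e' - e) + sg h * b' + sg b * h' - sg h * b - sg b * h"
    by (simp add: right_diff_distrib eqs(2))
  also have "\<dots> \<in> P 1" by (intro P_add P_diff t P01[of "sg b"] P10[of "sg h"]) (use O in auto)
  finally have 2: "sg h * b' + sg e * e' + sg b * h' - 1 \<in> P 1" .
  have "sg g * c' + sg d * f' + sg a * i' - 1 =
      sg a * (i' - i) + sg g * c' + sg d * f' - sg g * c - sg d * f"
    by (simp add: right_diff_distrib eqs(3))
  also have "\<dots> \<in> P 1" by (intro P_add P_diff t P10[of "sg g"] P10[of "sg d"]) (use O in auto)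
  finally have 3: "sg g * c' + sg d * f' + sg a * i' - 1 \<in> P 1" .
  have "?l \<in> Iw1 v sg" using l 1 2 3 unfolding uinv_m3 m3_mult m3_Iw1 by blast
  then have "chi ?l = 1" by (rule chi_Iw1)
  moreover have "?k' = ?k * ?l"
  proof -
    have c: "?k \<in> carrier_mat 3 3" "iv ?k \<in> carrier_mat 3 3" "?k' \<in> carrier_mat 3 3" by (simp_all add: uinv_m3)
    have "?k * ?l = ?k * iv ?k * ?k'" by (rule assoc_mult_mat[OF c, symmetric])
    then show ?thesis unfolding uinv_right[OF II_GG[OF k]] left_mult_one_mat[OF c(3)] ..
  qed
  ultimately show ?thesis using chi_mult[OF k l] by simp
qed

text \<open>Hilbert 90 with the explicit choice \<open>d = z / z'\<close>, \<open>z = 1 + e\<close>, makes Hensel's lemma unnecessary.\<close>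

lemma norm_one_lift:
  assumes e: "e \<in> P 0" "e * sg e - 1 \<in> P 1"
  obtains d where "d * sg d = 1" "d - e \<in> P 1"
proof (cases "unit (1 + e)")
  case True
  have se: "unit (sg (1 + e))" using True by (simp only: unit_sg)
  define d where "d = (1 + e) / sg (1 + e)"
  have "d * sg d = 1" using unit_nonzero[OF True] unit_nonzero[OF se] unfolding d_def sg_divide sg_sg
    by simp
  moreover have "d - e \<in> P 1"
  proof -
    have "d - e = (1 - e * sg e) / sg (1 + e)"
      using unit_nonzero[OF se] by (simp add: d_def field_simps)
    also have "\<dots> \<in> P 1" using e(2) P_diff_commute[of "e * sg e" 1] by (simp only: unit_divide_P[OF se])
    finally show ?thesis .
  qed
  ultimately show ?thesis using that by blast
next
  case False
  then have "1 + e \<in> P 1" using e(1) by (auto simp: unit_iff intro: P_add)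
  then have "- (1 + e) \<in> P 1" by (simp only: P_minus)
  then show ?thesis using that[of "- 1"] by simp
qed

lemma diag_II:
  assumes "unit a" "d * sg d = 1" shows "diag3 a d (inverse (sg a)) \<in> II"
proof -
  have "unit d"
  proof -
    have "d \<noteq> 0" using assms(2) by auto
    then show ?thesis using assms(2) v_mult[of d "sg d"] by (simp add: unit_def)
  qed
  then show ?thesis
    using assms unit_inverse[of "sg a"] unit_nonzero[of a]
    by (simp add: diag3_m3 m3_II m3_Ggrp unit_P0 mult.commute)
qed

lemma chi_s_diag: "unit a \<Longrightarrow> d * sg d = 1 \<Longrightarrow>
    chi (diag3 a d (inverse (sg a))) = chi (diag3 (inverse (sg a)) d a)"
  using chi_s by (simp add: chi_s_fixed_def unit_def)

text \<open>The hypothesis on \<open>chi\<close> concerns diagonal unitary matrices. Both matrices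
  are compared with such matrices by \<open>chi_cong\<close>, the middle entry of norm exactly 1
  coming from \<open>norm_one_lift\<close>.\<close>

lemma chi_swap:
  assumes k: "m3 a b c d e f g h i \<in> II" and k': "m3 a' b' c' d' e' f' g' h' i' \<in> II"
    and ae: "a' - i \<in> P 1" "e' - e \<in> P 1" "i' - a \<in> P 1"
  shows "chi (m3 a b c d e f g h i) = chi (m3 a' b' c' d' e' f' g' h' i')"
proof -
  note u = II_diag_units[OF k]
  have "e \<in> P 0" using k by (simp add: m3_II)
  then obtain d0 where d0: "d0 * sg d0 = 1" "d0 - e \<in> P 1" using norm_one_lift u(3) by blast
  have sa: "unit (sg a)" using u(1) by simp
  have "sg a * i - 1 \<in> P 1" using u(4) P_sg[of "a * sg i - 1"] by simp
  then have "(sg a * i - 1) / sg a \<in> P 1" by (simp only: unit_divide_P[OF sa])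
  then have i: "i - inverse (sg a) \<in> P 1" using unit_nonzero[OF sa] by (simp add: field_simps)
  have D: "diag3 a d0 (inverse (sg a)) \<in> II" by (rule diag_II[OF u(1) d0(1)])
  have D': "diag3 (inverse (sg a)) d0 a \<in> II"
    using diag_II[of "inverse (sg a)" d0] d0(1) u(1) unit_inverse by simp
  have "chi (m3 a b c d e f g h i) = chi (diag3 a d0 (inverse (sg a)))"
    unfolding diag3_m3 by (rule chi_cong[OF k D[unfolded diag3_m3]]) (use i d0 P_diff_commute in auto)
  also have "\<dots> = chi (diag3 (inverse (sg a)) d0 a)" by (rule chi_s_diag[OF u(1) d0(1)])
  also have "\<dots> = chi (m3 a' b' c' d' e' f' g' h' i')"
    unfolding diag3_m3
    by (rule chi_cong[OF D'[unfolded diag3_m3] k'])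
      (use i d0(2) ae P_diff_trans P_diff_commute in blast)+
  finally show ?thesis .
qed

text \<open>\<open>chi\<close> is trivial on the norms \<open>diag(x xbar, 1, (x xbar)^-1)\<close> because it is fixed by \<open>s\<close>.\<close>

lemma chi_diag_fixed:
  assumes t: "unit t" "sg t = t" shows "chi (diag3 t 1 (inverse t)) = 1"
proof -
  obtain x where x: "unit x" "x * sg x - t \<in> P 1" using norm_surj[OF t] by blast
  let ?y = "inverse (sg x)"
  have y: "unit ?y" using x(1) unit_inverse by simp
  have sx: "unit (sg x)" using x by simp
  have I: "diag3 x 1 ?y \<in> II" "diag3 (sg x) 1 (inverse x) \<in> II" "diag3 ?y 1 x \<in> II"
    using diag_II[OF x(1), of 1] diag_II[OF sx, of 1] diag_II[OF y, of 1] by simp_all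
  \<comment> \<open>The matrix for the norm of \<open>x\<close> is the product of those for
    \<open>x\<close> and \<open>sg x\<close>. Reversing the first gives the inverse of the second,
    so the two values of \<open>chi\<close> cancel.\<close>
  have "diag3 (sg x) 1 (inverse x) * diag3 ?y 1 x = 1\<^sub>m 3"
    using unit_nonzero[OF x(1)] unit_nonzero[OF sx] by (simp add: diag3_m3 m3_mult one_m3)
  then have 1: "chi (diag3 (sg x) 1 (inverse x)) * chi (diag3 ?y 1 x) = 1"
    using chi_mult[OF I(2,3)] chi_one by simp
  have N: "diag3 x 1 ?y * diag3 (sg x) 1 (inverse x) = diag3 (x * sg x) 1 (inverse (x * sg x))"
    by (simp add: diag3_m3 m3_mult mult_ac)
  have "chi (diag3 (x * sg x) 1 (inverse (x * sg x))) =
      chi (diag3 (sg x) 1 (inverse x)) * chi (diag3 ?y 1 x)"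
    unfolding N[symmetric] chi_mult[OF I(1,2)] using chi_s_diag[OF x(1), of 1] by (simp add: mult.commute)
  also have "chi (diag3 (x * sg x) 1 (inverse (x * sg x))) = chi (diag3 t 1 (inverse t))"
  proof -
    have u: "unit (x * sg x)" by (rule unit_mult[OF x(1) sx])
    have Dx: "diag3 (x * sg x) 1 (inverse (x * sg x)) \<in> II"
      using diag_II[OF u, of 1] by (simp add: mult.commute)
    have Dt: "diag3 t 1 (inverse t) \<in> II" using diag_II[OF t(1), of 1] t(2) by simp
    have "inverse t - inverse (x * sg x) = (x * sg x - t) / (t * (x * sg x))"
      using unit_nonzero[OF u] unit_nonzero[OF t(1)] by (simp add: field_simps)
    also have "\<dots> \<in> P 1" using x(2) by (simp only: unit_divide_P[OF unit_mult[OF t(1) u]])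
    finally show ?thesis using x(2) P_diff_commute unfolding diag3_m3
      by (intro chi_cong[OF Dx[unfolded diag3_m3] Dt[unfolded diag3_m3]]) auto
  qed
  finally show ?thesis using 1 by simp
qed

text \<open>Extension by zero lets sums run over all residue classes and makes
  \<open>PP_mult\<close> valid for every second factor.\<close>

definition PP :: "'e \<Rightarrow> 'c" where
  "PP a = (if unit a then chi (diag3 a (sg a * inverse a) (inverse (sg a))) else 0)"

lemma PP_II: "unit a \<Longrightarrow> diag3 a (sg a * inverse a) (inverse (sg a)) \<in> II"
  using unit_nonzero[of a] by (intro diag_II) (simp_all add: field_simps)

lemma PP_mult: assumes "unit c" shows "PP (c * x) = PP c * PP x"
proof (cases "unit x")
  case True
  have "diag3 c (sg c * inverse c) (inverse (sg c)) * diag3 x (sg x * inverse x) (inverse (sg x)) =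
      diag3 (c * x) (sg (c * x) * inverse (c * x)) (inverse (sg (c * x)))"
    by (simp add: diag3_m3 m3_mult mult_ac)
  then have "chi (diag3 (c * x) (sg (c * x) * inverse (c * x)) (inverse (sg (c * x)))) =
      chi (diag3 c (sg c * inverse c) (inverse (sg c))) * chi (diag3 x (sg x * inverse x) (inverse (sg x)))"
    using chi_mult[OF PP_II[OF assms] PP_II[OF True]] by (simp only:)
  then show ?thesis using assms True unit_mult[OF assms True] by (simp only: PP_def if_True)
next
  case False
  then have "\<not> unit (c * x)" using assms by (auto simp: unit_iff unit_mult_P)
  then show ?thesis using False by (simp add: PP_def)
qed

lemma PP_cong: assumes xy: "x - y \<in> P 1" shows "PP x = PP y"
proof (cases "unit x")
  case True
  then have y: "unit y" using unit_cong xy by blast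
  have xy': "unit (x * y)" "unit (sg (x * y))" using True y unit_mult by auto
  have s: "sg x - sg y \<in> P 1" using P_sg[of "x - y" 1] xy by simp
  have 1: "inverse (sg y) - inverse (sg x) \<in> P 1"
  proof -
    have "inverse (sg y) - inverse (sg x) = (sg x - sg y) / sg (x * y)"
      using unit_nonzero[OF True] unit_nonzero[OF y] by (simp add: field_simps)
    then show ?thesis using s by (simp only: unit_divide_P[OF xy'(2)])
  qed
  have 2: "sg y * inverse y - sg x * inverse x \<in> P 1"
  proof -
    have "sg y * inverse y - sg x * inverse x = ((sg y - sg x) * x + sg x * (x - y)) / (x * y)"
      using unit_nonzero[OF True] unit_nonzero[OF y] by (simp add: field_simps)
    moreover have "(sg y - sg x) * x + sg x * (x - y) \<in> P 1"
      using s xy True by (intro P_add P10[of _ x] P01[of "sg x"]) (auto simp: P_diff_commute unit_P0)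
    ultimately show ?thesis by (simp only: unit_divide_P[OF xy'(1)])
  qed
  have "chi (diag3 x (sg x * inverse x) (inverse (sg x))) =
      chi (diag3 y (sg y * inverse y) (inverse (sg y)))"
    unfolding diag3_m3
    by (rule chi_cong[OF PP_II[OF True, unfolded diag3_m3] PP_II[OF y, unfolded diag3_m3]])
      (use xy 1 2 P_diff_commute in auto)
  then show ?thesis using True y by (simp only: PP_def if_True)
next
  case False
  then have "\<not> unit y" using unit_cong[of y x] xy P_diff_commute by blast
  then show ?thesis using False by (simp add: PP_def)
qed

section \<open>Character sums over the residue fields\<close>

lemma PP_fixed: "unit t \<Longrightarrow> sg t = t \<Longrightarrow> PP t = 1"
  using chi_diag_fixed[of t] unit_nonzero[of t] by (simp add: PP_def)

lemma PP_nontrivial: obtains a where "unit a" "PP a \<noteq> 1"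
  using not_det by (auto simp: chi_factors_det_def PP_def unit_def)

lemma sum_fixed_line: "(\<Sum>t\<in>R. PP (seps * (t * seps))) = of_nat q - 1"
proof -
  have "PP (seps * (t * seps)) = (if t = 0 then 0 else 1)" if t: "t \<in> R" for t
  proof (cases "t = 0")
    case True then show ?thesis by (simp add: PP_def unit_def)
  next
    case False
    have e: "seps * (t * seps) = eps * t" by (simp add: seps_sq[symmetric])
    have "unit t" using False t R_P0 R_P1 by (simp add: unit_iff)
    then show ?thesis unfolding e using False t R_sg PP_fixed[of "eps * t"] unit_mult unit_eps by simp
  qed
  then have "(\<Sum>t\<in>R. PP (seps * (t * seps))) = (\<Sum>t\<in>R. if t = 0 then 0 else 1)"
    by (rule sum.cong[OF refl])
  also have "\<dots> = (\<Sum>t\<in>R. 1 - (if t = 0 then 1 else 0))" by (rule sum.cong) auto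
  also have "\<dots> = of_nat q - 1" using zero_R finite_R by (simp add: sum_subtractf card_R)
  finally show ?thesis .
qed

text \<open>Substituting \<open>c * t\<close> for \<open>t\<close> extracts the factor
  \<open>c\<close>, on which \<open>PP\<close> is 1.\<close>

lemma sum_line_scale:
  assumes c: "unit c" "sg c = c"
  shows "(\<Sum>t\<in>R. PP (seps * (c + t * seps))) = (\<Sum>t\<in>R. PP (seps * (1 + t * seps)))"
proof -
  let ?h = "\<lambda>t. PP (seps * (c + t * seps))"
  have "(\<Sum>t\<in>R. ?h t) = (\<Sum>t\<in>R. ?h (c * t))"
  proof (rule sum_R_scale[symmetric, OF _ c])
    fix x y assume "x \<in> OF" "y \<in> OF" "x - y \<in> P 1"
    then have "(seps * seps) * (x - y) \<in> P 1" using unit_mult_P[OF unit_mult[OF unit_seps unit_seps]] by blast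
    then show "?h x = ?h y" by (intro PP_cong) (simp add: algebra_simps)
  qed
  also have "\<dots> = (\<Sum>t\<in>R. PP (seps * (1 + t * seps)))"
  proof (rule sum.cong[OF refl])
    fix t
    have "seps * (c + c * t * seps) = c * (seps * (1 + t * seps))" by (simp add: algebra_simps)
    then show "?h (c * t) = PP (seps * (1 + t * seps))"
      using PP_mult[OF c(1), of "seps * (1 + t * seps)"] PP_fixed[OF c] by (simp only: mult_1)
  qed
  finally show ?thesis .
qed

lemma q_neq_1: "of_nat q \<noteq> (1 :: 'c)"
proof
  assume 1: "of_nat q = (1 :: 'c)"
  have "q > 0" using zero_R finite_R card_R card_gt_0_iff by blast
  then have "(1::nat) \<le> q ^ 2" by simp
  then have "of_nat (q ^ 2 - 1) = (of_nat q ^ 2 - 1 :: 'c)" by (simp add: of_nat_diff)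
  then show False using char 1 by (simp add: power2_eq_square)
qed

text \<open>The sum over the residue field of \<open>E\<close> vanishes, as scaling by
  \<open>a\<close> multiplies it by \<open>PP a \<noteq> 1\<close>. Cut into lines of fixed
  coordinate \<open>c\<close>, it is \<open>q - 1\<close> from \<open>c = 0\<close> plus
  \<open>q - 1\<close> copies of the sum in question; \<open>q - 1\<close> can be cancelled by
  \<open>q_neq_1\<close>.\<close>

lemma sum_line: "(\<Sum>t\<in>R. PP (seps * (1 + t * seps))) = - 1"
proof -
  let ?A = "\<Sum>t\<in>R. PP (seps * (1 + t * seps))" and ?S = "\<Sum>z\<in>R \<times> R. PP (seps * pt z)"
  obtain a where a: "unit a" "PP a \<noteq> 1" by (rule PP_nontrivial)
  have "?S = (\<Sum>z\<in>R \<times> R. PP (seps * (a * pt z)))"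
  proof (rule sum_pt_scale[symmetric, OF _ a(1)])
    fix x y assume "x - y \<in> P 1"
    then have "seps * (x - y) \<in> P 1" using unit_mult_P[OF unit_seps] by blast
    then show "PP (seps * x) = PP (seps * y)" by (intro PP_cong) (simp add: algebra_simps)
  qed
  also have "\<dots> = (\<Sum>z\<in>R \<times> R. PP a * PP (seps * pt z))"
    by (rule sum.cong[OF refl]) (simp add: PP_mult[OF a(1), symmetric] mult.left_commute)
  also have "\<dots> = PP a * ?S" by (simp add: sum_distrib_left)
  finally have S: "?S = 0" using a(2) by auto
  have "?S = (\<Sum>c\<in>R. \<Sum>t\<in>R. PP (seps * (c + t * seps)))"
    by (simp add: sum.cartesian_product pt_def case_prod_beta)
  also have "\<dots> = (\<Sum>t\<in>R. PP (seps * (0 + t * seps))) + (\<Sum>c\<in>R - {0}. \<Sum>t\<in>R. PP (seps * (c + t * seps)))"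
    by (rule sum.remove[OF finite_R zero_R])
  also have "(\<Sum>c\<in>R - {0}. \<Sum>t\<in>R. PP (seps * (c + t * seps))) = (\<Sum>c\<in>R - {0}. ?A)"
    by (intro sum.cong refl sum_line_scale) (use R_P0 R_P1 R_sg in \<open>auto simp: unit_iff\<close>)
  also have "\<dots> = (of_nat q - 1) * ?A"
    using zero_R finite_R card_R card_gt_0_iff[of R]
    by (auto simp: card_Diff_singleton of_nat_diff Suc_leI)
  also have "(\<Sum>t\<in>R. PP (seps * (0 + t * seps))) = of_nat q - 1" using sum_fixed_line by simp
  finally have "(of_nat q - 1) * (1 + ?A) = 0" unfolding S by (simp only: distrib_left mult_1_right)
  then show ?thesis using q_neq_1 by (simp add: add_eq_0_iff)
qed

text \<open>The component in \<open>F\<close> of a solution of the Heisenberg equation over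
  \<open>x\<close> is minus half the norm of \<open>x\<close>. For nonzero \<open>x\<close> it is a
  unit, and \<open>sum_line_scale\<close> applies with it as \<open>c\<close>.\<close>

lemma sum_heisenberg:
  "(\<Sum>z\<in>R \<times> R. \<Sum>t\<in>R. PP (seps * (- (pt z * sg (pt z)) / 2 + t * seps))) = of_nat q - of_nat q ^ 2"
proof -
  let ?f = "\<lambda>z. \<Sum>t\<in>R. PP (seps * (- (pt z * sg (pt z)) / 2 + t * seps))"
  have z0: "(0, 0) \<in> R \<times> R" using zero_R by simp
  have fin: "finite (R \<times> R)" using finite_R by simp
  have f: "?f z = - 1" if "z \<in> R \<times> R - {(0, 0)}" for z
  proof -
    have "unit (pt z)" using that pt_unit by blast
    then have "unit (- (pt z * sg (pt z)) / 2)"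
      by (intro unit_divide unit_2) (simp add: unit_mult)
    then show ?thesis unfolding sum_line[symmetric]
      by (rule sum_line_scale) (simp add: mult.commute)
  qed
  have "(\<Sum>z\<in>R \<times> R. ?f z) = ?f (0, 0) + (\<Sum>z\<in>R \<times> R - {(0, 0)}. ?f z)"
    by (rule sum.remove[OF fin z0])
  also have "(\<Sum>z\<in>R \<times> R - {(0, 0)}. ?f z) = (\<Sum>z\<in>R \<times> R - {(0, 0)}. - 1)"
    by (rule sum.cong[OF refl f])
  also have "\<dots> = - (of_nat (q * q) - 1)"
  proof -
    have "card (R \<times> R - {(0, 0)}) = q * q - 1" using z0 fin by (simp add: card_Diff_singleton card_cartesian_product card_R)
    moreover have "q * q \<ge> 1" using zero_R finite_R card_R card_gt_0_iff[of R] by auto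
    ultimately show ?thesis by (simp add: of_nat_diff)
  qed
  also have "?f (0, 0) = of_nat q - 1" using sum_fixed_line by (simp add: pt_def)
  finally show ?thesis by (simp add: power2_eq_square)
qed

end

section \<open>Coset representatives for the two generators\<close>

definition anti3 :: "'a::{zero,one} \<Rightarrow> 'a \<Rightarrow> 'a mat" where
  "anti3 \<alpha> \<beta> = m3 0 0 \<alpha> 0 1 0 \<beta> 0 0"

context unramified_data
begin

lemma P_scale: "y \<noteq> 0 \<Longrightarrow> y * x \<in> P k \<longleftrightarrow> x \<in> P (k - v y)"
  by (cases "x = 0") (auto simp: P_iff v_mult)

lemma P_div: "y \<noteq> 0 \<Longrightarrow> x / y \<in> P k \<longleftrightarrow> x \<in> P (k + v y)"
  by (cases "x = 0") (auto simp: P_iff v_divide)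

lemma half_add: "x / 2 + x / 2 = (x :: 'e)"
  by (simp add: add_divide_distrib[symmetric] mult_2[symmetric])

text \<open>Unitarity relates columns; the rows of \<open>g\<close> appear as conjugated and
  reversed columns of its inverse.\<close>

lemma row_relations:
  assumes "m3 a b c d e f g h i \<in> GG"
  shows "a * sg c + b * sg b + c * sg a = 0" "g * sg i + h * sg h + i * sg g = 0"
    "a * sg f + b * sg e + c * sg d = 0"
  using GG_iv[OF assms] by (simp_all add: uinv_m3 m3_Ggrp)

definition uu :: "'e \<Rightarrow> 'e \<Rightarrow> 'e mat" where "uu x y = m3 1 x y 0 1 (- sg x) 0 0 1"
definition lo :: "'e \<Rightarrow> 'e \<Rightarrow> 'e mat" where "lo x y = m3 1 0 0 x 1 0 y (- sg x) 1"

lemma uu_GG: "uu x y \<in> GG \<longleftrightarrow> y + sg y + x * sg x = 0"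
  by (simp add: uu_def m3_Ggrp, simp add: ac_simps)

lemma lo_GG: "lo x y \<in> GG \<longleftrightarrow> y + sg y + x * sg x = 0"
  by (simp add: lo_def m3_Ggrp, simp add: ac_simps)

lemma uu_II: "uu x y \<in> II \<longleftrightarrow> uu x y \<in> GG \<and> x \<in> P 0 \<and> y \<in> P 0"
  by (auto simp: uu_def m3_II)

lemma lo_II: "lo x y \<in> II \<longleftrightarrow> lo x y \<in> GG \<and> x \<in> P 1 \<and> y \<in> P 1"
  by (auto simp: lo_def m3_II)

lemma uu_Iw1: "uu x y \<in> II \<Longrightarrow> uu x y \<in> Iw1 v sg"
  by (simp add: uu_def m3_Iw1)

lemma lo_Iw1: "lo x y \<in> II \<Longrightarrow> lo x y \<in> Iw1 v sg"
  by (simp add: lo_def m3_Iw1)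

text \<open>Solutions of the Heisenberg equation over \<open>x\<close> differ by trace zero elements
  \<open>t * seps\<close>. For \<open>lt\<close>, conjugation by \<open>n_s'\<close> sees only the
  lower left corner modulo \<open>P 2\<close>; its trace is minus a norm from \<open>P 1\<close>,
  hence in \<open>P 2\<close>, and only multiples of \<open>w * seps\<close> remain.\<close>

definition ut :: "('e \<times> 'e) \<times> 'e \<Rightarrow> 'e mat" where
  "ut z = uu (pt (fst z)) (- (pt (fst z) * sg (pt (fst z))) / 2 + snd z * seps)"
definition lt :: "'e \<Rightarrow> 'e mat" where "lt t = lo 0 (w * t * seps)"

definition UU :: "bool \<Rightarrow> 'e mat set" where
  "UU b = (if b then ut ` ((R \<times> R) \<times> R) else lt ` R)"
definition nn :: "bool \<Rightarrow> 'e mat" where "nn b = (if b then nS seps else nS' seps w)"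

lemma nn_anti: "nn True = anti3 (- inverse seps) seps"
  "nn False = anti3 (- inverse (w * seps)) (w * seps)"
  by (simp_all add: nn_def nS_m3 nS'_m3 anti3_def mult.commute)

lemma anti3_GG: "sg \<beta> = - \<beta> \<Longrightarrow> \<beta> \<noteq> 0 \<Longrightarrow> anti3 (- inverse \<beta>) \<beta> \<in> GG"
  by (simp add: anti3_def m3_Ggrp)

lemma nn_GG: "nn b \<in> GG"
proof -
  have "anti3 (- inverse seps) seps \<in> GG" "anti3 (- inverse (w * seps)) (w * seps) \<in> GG"
    by (rule anti3_GG; simp)+
  then show ?thesis by (cases b) (simp_all only: nn_anti)
qed

lemma ut_mem: assumes "z \<in> (R \<times> R) \<times> R"
  shows "pt (fst z) \<in> P 0" "- (pt (fst z) * sg (pt (fst z))) / 2 + snd z * seps \<in> P 0" "ut z \<in> II"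
proof -
  let ?x = "pt (fst z)" and ?t = "snd z"
  show x: "?x \<in> P 0" using assms by (auto intro: pt_P0)
  have t: "?t \<in> P 0" "sg ?t = ?t" using assms R_P0 R_sg by auto
  have N: "- (?x * sg ?x) / 2 \<in> P 0"
    unfolding unit_divide_P[OF unit_2] P_minus by (rule P00) (use x in auto)
  show y: "- (?x * sg ?x) / 2 + ?t * seps \<in> P 0"
    by (intro P_add N P00 t unit_P0 unit_seps)
  show "ut z \<in> II" unfolding ut_def uu_II uu_GG
    using x y t(2) by (simp add: field_simps)
qed

lemma lt_II: assumes "t \<in> R" shows "lt t \<in> II"
proof -
  have t: "t \<in> P 0" "sg t = t" using assms R_P0 R_sg by auto
  have z: "w * t * seps = (w * seps) * t" by simp
  have "w * t * seps \<in> P 1"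
    unfolding z using t(1) unit_seps by (subst P_scale) (auto simp: v_mult unit_def)
  then show ?thesis unfolding lt_def lo_II lo_GG using t(2) by simp
qed

lemma UU_II: "u \<in> UU b \<Longrightarrow> u \<in> II"
  using ut_mem(3) lt_II by (auto simp: UU_def split: if_splits)

lemma UU_Iw1: "u \<in> UU b \<Longrightarrow> u \<in> Iw1 v sg"
  using UU_II[of u b] uu_Iw1 lo_Iw1 by (auto simp: UU_def ut_def lt_def split: if_splits)

lemma one_UU: "1\<^sub>m 3 \<in> UU b"
proof (cases b)
  case True
  have "ut ((0, 0), 0) = 1\<^sub>m 3" by (simp add: ut_def uu_def pt_def one_m3)
  moreover have "((0, 0), 0) \<in> (R \<times> R) \<times> R" using zero_R by simp
  ultimately show ?thesis unfolding UU_def using True by (metis image_eqI)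
next
  case False
  have "lt 0 = 1\<^sub>m 3" by (simp add: lt_def lo_def one_m3)
  then show ?thesis unfolding UU_def using False zero_R by (metis image_eqI)
qed

lemma inj_ut: "inj_on ut ((R \<times> R) \<times> R)"
proof (rule inj_onI)
  fix z z' assume z: "z \<in> (R \<times> R) \<times> R" "z' \<in> (R \<times> R) \<times> R" and "ut z = ut z'"
  then have "pt (fst z) = pt (fst z')" "snd z = snd z'" by (auto simp: ut_def uu_def m3_eq_iff)
  moreover then have "fst z = fst z'" using pt_eqI[of "fst z" "fst z'"] z by auto
  ultimately show "z = z'" by (simp add: prod_eq_iff)
qed

lemma inj_lt: "inj_on lt R"
  by (rule inj_onI) (simp add: lt_def lo_def m3_eq_iff)

lemma finite_UU: "finite (UU b)"
  by (simp add: UU_def finite_R)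

lemma card_UU: "card (UU b) = (if b then q ^ 3 else q)"
  by (simp add: UU_def card_image inj_ut inj_lt card_cartesian_product card_R power3_eq_cube)

text \<open>If the corner is not a unit, both of its coordinates lie in the maximal ideal; the first
  is half a norm, so \<open>x\<close> is in the class of 0. Hence nontrivial representatives have a
  unit corner.\<close>

lemma ut_trivial:
  assumes z: "z \<in> (R \<times> R) \<times> R" and y: "- (pt (fst z) * sg (pt (fst z))) / 2 + snd z * seps \<in> P 1"
  shows "ut z = 1\<^sub>m 3"
proof -
  let ?x = "pt (fst z)"
  have zR: "fst z \<in> R \<times> R" "snd z \<in> R" using z by auto
  have "sg (- (?x * sg ?x) / 2) = - (?x * sg ?x) / 2" by (simp add: mult.commute)
  then have N: "- (?x * sg ?x) / 2 \<in> P 1" "snd z \<in> P 1"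
    using y P_decomp[OF _ R_sg[OF zR(2)]] by blast+
  have "?x * sg ?x \<in> P 1" using N(1) by (simp only: unit_divide_P[OF unit_2] P_minus)
  then have "fst z = (0, 0)" using P1_of_norm pt_P1[OF zR(1)] by blast
  moreover have "snd z = 0" using N(2) R_P1[OF zR(2)] by blast
  ultimately show ?thesis by (simp add: ut_def uu_def pt_def one_m3)
qed

end

section \<open>Verification of the coset axioms\<close>

context unramified_character
begin

text \<open>\<open>?j\<close> is the conjugate of \<open>k\<close> by the antidiagonal matrix. The
  bounds place it in \<open>I\<close>, and its diagonal is reversed, so \<open>chi_swap\<close>
  compares the characters.\<close>

lemma coset_step:
  assumes \<beta>: "\<beta> \<noteq> 0" "sg \<beta> = - \<beta>" and k: "m3 a b c d e f g h i \<in> II" and u: "u \<in> GG"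
    and bds: "h / \<beta> \<in> P 0" "g / (\<beta> * \<beta>) \<in> P 0" "\<beta> * f \<in> P 1" "d / \<beta> \<in> P 0"
      "\<beta> * \<beta> * c \<in> P 1" "\<beta> * b \<in> P 1"
  shows "\<exists>j\<in>II. chi j = chi (m3 a b c d e f g h i) \<and>
    anti3 (- inverse \<beta>) \<beta> * (m3 a b c d e f g h i * u) = j * (anti3 (- inverse \<beta>) \<beta> * u)"
proof -
  let ?n = "anti3 (- inverse \<beta>) \<beta>" and ?k = "m3 a b c d e f g h i"
  let ?j = "m3 i (- (h / \<beta>)) (- (g / (\<beta> * \<beta>))) (- (\<beta> * f)) e (d / \<beta>) (- (\<beta> * \<beta> * c)) (\<beta> * b) a"
  have n: "?n \<in> GG" by (rule anti3_GG[OF \<beta>(2,1)])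
  have c: "?n \<in> carrier_mat 3 3" "?k \<in> carrier_mat 3 3" "?j \<in> carrier_mat 3 3" "iv ?n \<in> carrier_mat 3 3"
    "u \<in> carrier_mat 3 3"
    using n u GG_carrier GG_iv by auto
  have nk: "?n * ?k = ?j * ?n"
    using \<beta>(1) by (simp add: anti3_def m3_mult m3_eq_iff field_simps)
  have "?j = ?j * (?n * iv ?n)" unfolding uinv_right[OF n] right_mult_one_mat[OF c(3)] ..
  also have "\<dots> = ?n * ?k * iv ?n" unfolding nk by (rule assoc_mult_mat[OF c(3,1,4), symmetric])
  finally have "?j \<in> GG" using n k II_GG by (metis GG_iv GG_mult)
  then have j: "?j \<in> II" using k bds by (simp add: m3_II)
  have "chi ?k = chi ?j" by (rule chi_swap[OF k j]) simp_all
  moreover have "?n * (?k * u) = ?j * (?n * u)"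
    using assoc_mult_mat[OF c(1,2,5)] assoc_mult_mat[OF c(3,1,5)] nk by simp
  ultimately show ?thesis using j by metis
qed

text \<open>Passing from \<open>k\<close> to \<open>k u^-1\<close> leaves \<open>chi\<close>
  unchanged, because \<open>u\<close> is in \<open>I(1)\<close>. It remains to choose
  \<open>u\<close> such that conjugation by \<open>n\<close> keeps \<open>k u^-1\<close> in
  \<open>I\<close>.\<close>

lemma UU_cover_aux:
  assumes k: "k \<in> II" and u: "u \<in> Iw1 v sg"
    and step: "\<exists>j\<in>II. chi j = chi (k * iv u) \<and> n * (k * iv u * u) = j * (n * u)"
  shows "\<exists>j\<in>II. chi j = chi k \<and> n * k = j * (n * u)"
proof -
  have uI: "u \<in> II" using u by (simp add: Iw1_def)
  have c: "k \<in> carrier_mat 3 3" "iv u \<in> carrier_mat 3 3" "u \<in> carrier_mat 3 3"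
    using k uI II_GG GG_carrier GG_iv by auto
  have "k * iv u * u = k" using assoc_mult_mat[OF c] uinv_left[OF II_GG[OF uI]] c(1) by simp
  moreover have "chi (iv u) = 1"
    using chi_mult[OF uI II_iv[OF uI]] chi_one chi_Iw1[OF u] uinv_right[OF II_GG[OF uI]] by simp
  ultimately show ?thesis using step chi_mult[OF k II_iv[OF uI]] by simp
qed

text \<open>The representative is read off from the first row, so that \<open>k u^-1\<close> becomes
  diagonal modulo the maximal ideal.\<close>

lemma UU_cover_True:
  assumes k: "k \<in> II"
  shows "\<exists>u\<in>UU True. \<exists>j\<in>II. chi j = chi k \<and> nn True * k = j * (nn True * u)"
proof -
  obtain a b c d e f g h i where k_eq: "k = m3 a b c d e f g h i" by (rule II_E[OF k])
  have kI: "m3 a b c d e f g h i \<in> II" using k k_eq by simp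
  have O: "b \<in> P 0" "c \<in> P 0" "d \<in> P 1" "e \<in> P 0" "f \<in> P 0" "g \<in> P 1" "h \<in> P 1" "i \<in> P 0"
    using kI by (auto simp: m3_II)
  have a: "unit a" "a \<noteq> 0" using II_diag_units[OF kI] unit_nonzero by auto
  define r where "r = b / a"
  define s where "s = c / a"
  have rs: "b = a * r" "c = a * s" "r \<in> P 0" "s \<in> P 0"
    using a O by (auto simp: r_def s_def unit_divide_P)
  define x where "x = pt (rep2 r)"
  have x: "rep2 r \<in> R \<times> R" "r - x \<in> P 1" "x \<in> P 0"
    using rep2[OF rs(3)] pt_P0 by (auto simp: x_def simp del: mem_Sigma_iff)
  \<comment> \<open>Modulo the maximal ideal the upper right entry of \<open>k u^-1\<close> is
    \<open>a * (m - t * seps)\<close>. The row relation puts \<open>re m\<close> into that ideal, so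
    \<open>t\<close> only has to match \<open>im m\<close>.\<close>
  define m where "m = x * sg x / 2 + s"
  have m: "m \<in> P 0" unfolding m_def
    by (intro P_add rs(4)) (simp only: unit_divide_P[OF unit_2] P00 x(3) P_sg)
  have "s + sg s + r * sg r = 0"
  proof -
    have "(s + sg s + r * sg r) * (a * sg a) = a * sg c + b * sg b + c * sg a"
      by (simp add: rs algebra_simps)
    also have "\<dots> = 0" by (rule row_relations(1)[OF II_GG[OF kI]])
    finally show ?thesis using a by simp
  qed
  then have "s + sg s = - (r * sg r)" by (simp add: eq_neg_iff_add_eq_0)
  moreover have "m + sg m = x * sg x + (s + sg s)"
    using half_add[of "x * sg x"] by (simp add: m_def algebra_simps)
  ultimately have "m + sg m = - ((r - x) * sg x + r * sg (r - x))"
    by (simp add: algebra_simps)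
  also have "\<dots> \<in> P 1" unfolding P_minus
    by (intro P_add P10[of "r - x"] P01[of r]) (use x(2,3) rs(3) in \<open>simp_all only: P_sg\<close>)
  finally have re: "re m \<in> P 1" by (simp add: re_def unit_divide_P[OF unit_2])
  define t where "t = rep (im m)"
  have imO: "im m \<in> OF" using m im_P by simp
  have t: "t \<in> R" "im m - t \<in> P 1" using rep_R[OF imO] rep_diff[OF imO] by (auto simp: t_def)
  have mt: "m - t * seps \<in> P 1"
  proof -
    have "m - t * seps = re m + (im m - t) * seps" using re_im[of m] by (simp add: algebra_simps)
    also have "\<dots> \<in> P 1" by (intro P_add re P10 t(2) unit_P0 unit_seps)
    finally show ?thesis .
  qed
  define y where "y = - (x * sg x) / 2 + t * seps"
  have sy: "sg y = - (x * sg x) / 2 - t * seps" using R_sg[OF t(1)] by (simp add: y_def mult.commute)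
  let ?u = "ut (rep2 r, t)"
  have u: "?u = uu x y" by (simp add: ut_def x_def y_def)
  have uU: "?u \<in> UU True" using x t by (auto simp: UU_def)
  have kiu: "k * iv (uu x y) = m3 a (b - a * x) (a * sg y + b * sg x + c) d (e - d * x) (d * sg y + e * sg x + f)
      g (h - g * x) (g * sg y + h * sg x + i)"
    by (simp add: k_eq uu_def uinv_m3 m3_mult)
  have \<kappa>: "m3 a (b - a * x) (a * sg y + b * sg x + c) d (e - d * x) (d * sg y + e * sg x + f)
      g (h - g * x) (g * sg y + h * sg x + i) \<in> II"
    unfolding kiu[symmetric] using II_mult[OF k II_iv[OF UU_II[OF uU]]] by (simp only: u)
  have B: "b - a * x \<in> P 1"
  proof -
    have "b - a * x = a * (r - x)" by (simp add: rs algebra_simps)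
    then show ?thesis using x(2) unit_mult_P[OF a(1)] by metis
  qed
  have C: "a * sg y + b * sg x + c \<in> P 1"
  proof -
    have "a * sg y + b * sg x + c = a * ((m - t * seps) + (r - x) * sg x)"
      by (simp add: rs sy m_def field_simps)
    also have "\<dots> \<in> P 1" unfolding unit_mult_P[OF a(1)]
      by (intro P_add mt P10) (use x in auto)
    finally show ?thesis .
  qed
  \<comment> \<open>The relation between the first two rows bounds this entry by the two already
    treated.\<close>
  have F: "d * sg y + e * sg x + f \<in> P 1"
  proof -
    let ?F = "d * sg y + e * sg x + f"
    have "e - d * x \<in> P 0" using \<kappa> by (simp add: m3_II)
    have "a * sg ?F = - ((b - a * x) * sg (e - d * x) + (a * sg y + b * sg x + c) * sg d)"
      using row_relations(3)[OF II_GG[OF \<kappa>]] by (simp only: add.assoc eq_neg_iff_add_eq_0)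
    also have "\<dots> \<in> P 1" unfolding P_minus
      by (intro P_add P10[OF B] P10[OF C]) (use \<open>e - d * x \<in> P 0\<close> O P1_P0 in \<open>simp_all only: P_sg\<close>)
    finally show ?thesis by (simp only: unit_mult_P[OF a(1)] P_sg)
  qed
  have H: "h - g * x \<in> P 1" using \<kappa> by (simp add: m3_II)
  have vs: "v seps = 0" using unit_seps by (simp add: unit_def)
  have "\<exists>j\<in>II. chi j = chi (k * iv ?u) \<and> nn True * (k * iv ?u * ?u) = j * (nn True * ?u)"
    unfolding u kiu nn_anti
    by (rule coset_step[OF seps0 sg_seps \<kappa>])
      (use UU_II[OF uU] II_GG u B C F H O(3,6) in \<open>auto simp: P_scale P_div vs v_mult P1_P0\<close>)
  then show ?thesis using UU_cover_aux[OF k UU_Iw1[OF uU]] uU by blast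
qed

text \<open>Here the last row decides. Conjugation by \<open>n_s'\<close> divides the lower left
  entry by an element of valuation 2, so the representative has to move this entry from
  \<open>P 1\<close> into \<open>P 2\<close>.\<close>

lemma UU_cover_False:
  assumes k: "k \<in> II"
  shows "\<exists>u\<in>UU False. \<exists>j\<in>II. chi j = chi k \<and> nn False * k = j * (nn False * u)"
proof -
  obtain a b c d e f g h i where k_eq: "k = m3 a b c d e f g h i" by (rule II_E[OF k])
  have kI: "m3 a b c d e f g h i \<in> II" using k k_eq by simp
  have O: "b \<in> P 0" "c \<in> P 0" "d \<in> P 1" "e \<in> P 0" "f \<in> P 0" "g \<in> P 1" "h \<in> P 1"
    using kI by (auto simp: m3_II)
  have i: "unit i" "i \<noteq> 0" using II_diag_units[OF kI] unit_nonzero by auto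
  define r where "r = h / i"
  define m where "m = g / (w * i)"
  have rm: "h = i * r" "g = i * (w * m)" "r \<in> P 1"
    using i O by (auto simp: r_def m_def unit_divide_P)
  have m: "m \<in> P 0" using O(6) i by (simp add: m_def P_div v_mult unit_def)
  have "w * (m + sg m) + r * sg r = 0"
  proof -
    have "(w * (m + sg m) + r * sg r) * (i * sg i) = g * sg i + h * sg h + i * sg g"
      by (simp add: rm algebra_simps)
    also have "\<dots> = 0" by (rule row_relations(2)[OF II_GG[OF kI]])
    finally show ?thesis using i by simp
  qed
  then have "w * (m + sg m) = - (r * sg r)" by (simp add: eq_neg_iff_add_eq_0)
  \<comment> \<open>The norm of \<open>r\<close> gains two powers, so one is left for the trace of
    \<open>m\<close> after division by \<open>w\<close>.\<close>
  also have "\<dots> \<in> P (1 + 1)" unfolding P_minus by (rule P_mult) (use rm in auto)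
  finally have "m + sg m \<in> P 1" by (simp add: P_scale)
  then have re: "re m \<in> P 1" by (simp add: re_def unit_divide_P[OF unit_2])
  define t where "t = rep (im m)"
  have imO: "im m \<in> OF" using m im_P by simp
  have t: "t \<in> R" "im m - t \<in> P 1" using rep_R[OF imO] rep_diff[OF imO] by (auto simp: t_def)
  have mt: "m - t * seps \<in> P 1"
  proof -
    have "m - t * seps = re m + (im m - t) * seps" using re_im[of m] by (simp add: algebra_simps)
    also have "\<dots> \<in> P 1" by (intro P_add re P10 t(2) unit_P0 unit_seps)
    finally show ?thesis .
  qed
  define z where "z = w * t * seps"
  let ?u = "lt t"
  have u: "?u = lo 0 z" by (simp add: lt_def z_def)
  have sz: "sg z = - z" using R_sg[OF t(1)] by (simp add: z_def)
  have uU: "?u \<in> UU False" using t by (auto simp: UU_def)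
  have kiu: "k * iv (lo 0 z) = m3 (a - c * z) b c (d - f * z) e f (g - i * z) h i"
    by (simp add: k_eq lo_def uinv_m3 m3_mult sz)
  have \<kappa>: "m3 (a - c * z) b c (d - f * z) e f (g - i * z) h i \<in> II"
    unfolding kiu[symmetric] using II_mult[OF k II_iv[OF UU_II[OF uU]]] by (simp only: u)
  have D: "d - f * z \<in> P 1" using \<kappa> by (simp add: m3_II)
  have G: "g - i * z \<in> P 2"
  proof -
    have "g - i * z = i * (w * (m - t * seps))" by (simp add: rm z_def algebra_simps)
    also have "\<dots> \<in> P 2" using mt by (simp add: unit_mult_P[OF i(1)] P_scale)
    finally show ?thesis .
  qed
  have vs: "v seps = 0" "w * seps \<noteq> 0" "sg (w * seps) = - (w * seps)" using unit_seps by (simp_all add: unit_def)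
  have "\<exists>j\<in>II. chi j = chi (k * iv ?u) \<and> nn False * (k * iv ?u * ?u) = j * (nn False * ?u)"
    unfolding u kiu nn_anti
    by (rule coset_step[OF vs(2,3) \<kappa>])
      (use UU_II[OF uU] II_GG u D G O in
        \<open>auto simp: P_scale P_div vs(1) v_mult P1_P0 P_mono[OF O(2), of "- 1"]\<close>)
  then show ?thesis using UU_cover_aux[OF k UU_Iw1[OF uU]] uU by blast
qed

text \<open>Comparing entries, the coordinates of the representatives differ by elements of the
  maximal ideal: entries of \<open>j\<close> below the diagonal up to units, or
  \<open>\<beta>\<close> times its upper right entry. Distinct elements of \<open>R\<close> are not
  congruent.\<close>

lemma UU_unique:
  assumes u: "u \<in> UU b" "u' \<in> UU b" and j: "j \<in> II" and eq: "nn b * u = j * (nn b * u')"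
  shows "u = u'"
proof -
  obtain a k c d e f g h i where j_eq: "j = m3 a k c d e f g h i" by (rule II_E[OF j])
  have O: "c \<in> P 0" "g \<in> P 1" "h \<in> P 1" using j j_eq by (auto simp: m3_II)
  show ?thesis
  proof (cases b)
    case True
    obtain z z' where z: "z \<in> (R \<times> R) \<times> R" "u = ut z" "z' \<in> (R \<times> R) \<times> R" "u' = ut z'"
      using u True by (auto simp: UU_def)
    define x x' y y' where xy: "x = pt (fst z)" "x' = pt (fst z')"
      "y = - (x * sg x) / 2 + snd z * seps" "y' = - (x' * sg x') / 2 + snd z' * seps"
    have "anti3 (- inverse seps) seps * uu x y = j * (anti3 (- inverse seps) seps * uu x' y')"
      using eq True unfolding z by (simp add: nn_anti ut_def xy)
    then have e: "seps * i = seps" "seps * x = h + i * (seps * x')"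
      "seps * y = i * (seps * y') - h * sg x' - g * inverse seps"
      by (auto simp: j_eq anti3_def uu_def m3_mult m3_eq_iff algebra_simps)
    then have i: "i = 1" by simp
    have "seps * (x - x') = h" using e(2) by (simp add: i algebra_simps)
    then have "x - x' \<in> P 1" using O unit_mult_P[OF unit_seps] by metis
    then have f: "fst z = fst z'" using pt_eqI[of "fst z" "fst z'"] z by (auto simp: xy)
    then have "h = 0" "y - y' = (snd z - snd z') * seps"
      using e(2) by (auto simp: xy i algebra_simps)
    moreover have "seps * (y - y') = - (g * inverse seps)"
      using e(3) \<open>h = 0\<close> by (simp add: i algebra_simps)
    ultimately have "seps * ((snd z - snd z') * seps) = - (g * inverse seps)" by (simp only:)
    also have "\<dots> \<in> P 1" unfolding P_minus by (intro P10 O unit_P0 unit_inverse unit_seps)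
    finally have "snd z - snd z' \<in> P 1"
      by (simp only: unit_mult_P[OF unit_seps] mult.commute[of _ seps])
    then have "snd z = snd z'" using R_eqI z by auto
    then show ?thesis using f z by (metis prod_eqI)
  next
    case False
    obtain t t' where t: "t \<in> R" "u = lt t" "t' \<in> R" "u' = lt t'" using u False by (auto simp: UU_def)
    define \<beta> where "\<beta> = w * seps"
    have \<beta>: "\<beta> \<noteq> 0" "v \<beta> = 1" using unit_seps by (auto simp: \<beta>_def v_mult unit_def)
    have "anti3 (- inverse \<beta>) \<beta> * lo 0 (\<beta> * t) = j * (anti3 (- inverse \<beta>) \<beta> * lo 0 (\<beta> * t'))"
      using eq False unfolding t by (simp add: nn_anti lt_def \<beta>_def mult_ac)
    then have "a * inverse \<beta> = inverse \<beta>" "- t = c * \<beta> - a * t'"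
      using \<beta>(1) by (auto simp: j_eq anti3_def lo_def m3_mult m3_eq_iff field_simps)
    then have "t' - t = c * \<beta>" using \<beta>(1) by (simp add: algebra_simps)
    also have "\<dots> = \<beta> * c" by (rule mult.commute)
    also have "\<dots> \<in> P 1" using O \<beta> by (simp add: P_scale)
    finally show ?thesis using R_eqI[OF t(3,1)] t by simp
  qed
qed

text \<open>The entry \<open>(0, 2)\<close> is the Heisenberg corner. At the identity it is 0, where
  \<open>PP\<close> vanishes, so the sum for \<open>True\<close> may include the trivial
  coset.\<close>

definition cff :: "bool \<Rightarrow> 'e mat \<Rightarrow> 'c" where
  "cff b u = (if b then PP (seps * u $$ (0, 2)) else 1)"

text \<open>The matrices \<open>?k\<close> and \<open>?k'\<close> solve
  \<open>n u n = k n k'\<close>, which is possible in \<open>I\<close> because \<open>y\<close> is a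
  unit. The diagonal of \<open>?k\<close> is the reversed diagonal of the matrix defining
  \<open>PP (seps * y)\<close>, and \<open>?k'\<close> lies in \<open>I(1)\<close>.\<close>

lemma UU_nontriv_True:
  assumes u: "u \<in> UU True" "u \<noteq> 1\<^sub>m 3"
  shows "\<exists>k\<in>II. \<exists>k'\<in>II. nn True * u * nn True = k * nn True * k' \<and> chi k * chi k' = cff True u"
proof -
  obtain z where z: "z \<in> (R \<times> R) \<times> R" "u = ut z" using u(1) by (auto simp: UU_def)
  define x y where xy: "x = pt (fst z)" "y = - (x * sg x) / 2 + snd z * seps"
  have u_eq: "u = uu x y" by (simp add: z ut_def xy)
  have y0: "unit y" and x0: "x \<in> P 0"
    using ut_trivial[OF z(1)] ut_mem[OF z(1)] u(2) z(2) by (auto simp: unit_iff xy)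
  have uG: "y + sg y + x * sg x = 0"
    using II_GG[OF UU_II[OF u(1)]] by (simp only: u_eq uu_GG)
  have ny: "y \<noteq> 0" "sg y \<noteq> 0" using unit_nonzero[OF y0] by auto
  have uG': "- sg y = y + x * sg x" "y + (sg y + x * sg x) = 0"
    using uG by (simp_all add: neg_eq_iff_add_eq_0 ac_simps)
  let ?n = "anti3 (- inverse seps) seps"
  let ?k' = "uu (x / (seps * y)) (- (1 / (eps * y)))"
  let ?k = "m3 (- (1 / (seps * sg y))) (x / (seps * y)) (- (1 / seps)) 0 (- (sg y / y)) (- sg x) 0 0 (seps * y)"
  have ue: "unit (seps * y)" "unit (eps * y)" "unit (seps * sg y)"
    using unit_mult unit_seps unit_eps y0 by auto
  have k': "?k' \<in> II" unfolding uu_II uu_GG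
  proof (intro conjI)
    have "- (1 / (eps * y)) + sg (- (1 / (eps * y))) + x / (seps * y) * sg (x / (seps * y)) =
        - ((y + sg y + x * sg x) / (eps * (y * sg y)))"
      using ny by (simp add: seps_sq[symmetric] field_simps)
    then show "- (1 / (eps * y)) + sg (- (1 / (eps * y))) + x / (seps * y) * sg (x / (seps * y)) = 0"
      by (simp add: uG)
  qed (use x0 ue in \<open>simp_all add: unit_divide_P\<close>)
  have nk': "?n * ?k' \<in> GG" using nn_GG[of True] II_GG[OF k'] GG_mult by (simp add: nn_anti)
  have eq: "?n * u * ?n = ?k * (?n * ?k')"
    using ny uG' by (simp add: u_eq anti3_def uu_def m3_mult m3_eq_iff seps_sq[symmetric] field_simps)
  have c: "?k \<in> carrier_mat 3 3" "?n * ?k' \<in> carrier_mat 3 3" "iv (?n * ?k') \<in> carrier_mat 3 3"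
    "?n \<in> carrier_mat 3 3" "?k' \<in> carrier_mat 3 3"
    using nk' GG_carrier GG_iv k' II_GG by (auto simp: anti3_def)
  have "?k = ?k * (?n * ?k' * iv (?n * ?k'))"
    unfolding uinv_right[OF nk'] right_mult_one_mat[OF c(1)] ..
  also have "\<dots> = ?n * u * ?n * iv (?n * ?k')" unfolding eq by (rule assoc_mult_mat[OF c(1-3), symmetric])
  also have "\<dots> \<in> GG"
    using nn_GG[of True] II_GG[OF UU_II[OF u(1)]] GG_iv[OF nk'] unfolding nn_anti by (intro GG_mult)
  finally have "?k \<in> GG" .
  then have k: "?k \<in> II"
    using x0 ue y0 unit_seps unit_P0[OF ue(1)] by (simp add: m3_II unit_divide_P unit_P0)
  have mid: "sg (seps * y) * inverse (seps * y) = - (sg y / y)" using ny by (simp add: field_simps)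
  have "cff True u = chi (diag3 (seps * y) (sg (seps * y) * inverse (seps * y)) (inverse (sg (seps * y))))"
    using ue(1) by (simp add: cff_def PP_def u_eq uu_def)
  also have "\<dots> = chi ?k"
    unfolding diag3_m3 mid by (rule chi_swap[OF PP_II[OF ue(1), unfolded diag3_m3 mid] k])
      (simp_all add: divide_inverse)
  finally have "chi ?k * chi ?k' = cff True u" using chi_Iw1[OF uu_Iw1[OF k']] by simp
  moreover have "nn True * u * nn True = ?k * nn True * ?k'"
    unfolding nn_anti eq by (rule assoc_mult_mat[OF c(1,4,5), symmetric])
  ultimately show ?thesis using k k' by blast
qed

text \<open>An \<open>SL_2\<close> identity in the outer two coordinates. The diagonal of
  \<open>?k\<close> is that of \<open>diag(-t, 1, -1/t)\<close> with \<open>t\<close> in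
  \<open>F\<close>, where \<open>chi\<close> is trivial, so every nontrivial coset contributes
  1.\<close>

lemma UU_nontriv_False:
  assumes u: "u \<in> UU False" "u \<noteq> 1\<^sub>m 3"
  shows "\<exists>k\<in>II. \<exists>k'\<in>II. nn False * u * nn False = k * nn False * k' \<and> chi k * chi k' = cff False u"
proof -
  obtain t where t: "t \<in> R" "u = lt t" using u(1) by (auto simp: UU_def)
  have t0: "t \<noteq> 0" using u(2) t by (auto simp: lt_def lo_def one_m3)
  then have ut: "unit t" "sg t = t" using t R_P1 R_P0 R_sg by (auto simp: unit_iff)
  define \<beta> where "\<beta> = w * seps"
  have \<beta>: "\<beta> \<noteq> 0" "v \<beta> = 1" "sg \<beta> = - \<beta>" using unit_seps by (auto simp: \<beta>_def v_mult unit_def)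
  let ?n = "anti3 (- inverse \<beta>) \<beta>"
  let ?k' = "lo 0 (- (\<beta> / t))" and ?k = "m3 (- t) 0 0 0 1 0 \<beta> 0 (- (1 / t))"
  have k': "?k' \<in> II" unfolding lo_II lo_GG
    using \<beta> ut t0 by (simp add: unit_def P_iff v_divide)
  have k: "?k \<in> II"
    using ut \<beta> t0 unit_P0[OF ut(1)] unit_P0[OF unit_divide[OF unit_1 ut(1)]]
    by (simp add: m3_II m3_Ggrp P_iff)
  have kd: "m3 (- t) 0 0 0 1 0 0 0 (inverse (- t)) \<in> II"
    using diag_II[of "- t" 1] ut by (simp add: diag3_m3)
  have "chi ?k = chi (diag3 (- t) 1 (inverse (- t)))"
    unfolding diag3_m3 by (rule chi_cong[OF k kd]) (simp_all add: divide_inverse)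
  also have "\<dots> = 1" by (rule chi_diag_fixed) (use ut in auto)
  finally have "chi ?k * chi ?k' = cff False u" using chi_Iw1[OF lo_Iw1[OF k']] by (simp add: cff_def)
  moreover have "nn False * u * nn False = ?k * nn False * ?k'"
    using \<beta>(1) t0 unfolding nn_anti \<beta>_def[symmetric] t
    by (simp add: lt_def anti3_def lo_def m3_mult m3_eq_iff mult_ac \<beta>_def[symmetric])
       (simp add: \<beta>_def field_simps)
  ultimately show ?thesis using k k' by blast
qed

lemma nn_sq: "nn b * nn b = diag3 (- 1) 1 (- 1)"
proof -
  have "anti3 (- inverse \<beta>) \<beta> * anti3 (- inverse \<beta>) \<beta> = diag3 (- 1) 1 (- 1)" if "\<beta> \<noteq> 0" for \<beta> :: 'e
    using that by (simp add: anti3_def diag3_m3 m3_mult)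
  from this[of seps] this[of "w * seps"] show ?thesis by (cases b) (simp_all add: nn_anti)
qed

sublocale double_cosets 3 GG II chi iv nn UU cff
proof
  show "nn b * nn b \<in> II" "chi (nn b * nn b) = 1" for b
    using diag_II[of "- 1" 1] chi_diag_fixed[of "- 1"] by (simp_all add: nn_sq)
  show "\<exists>u\<in>UU b. \<exists>j\<in>II. chi j = chi k \<and> nn b * k = j * (nn b * u)" if "k \<in> II" for k b
    using UU_cover_True[OF that] UU_cover_False[OF that] by (cases b) simp_all
  show "\<exists>k\<in>II. \<exists>k'\<in>II. nn b * u * nn b = k * nn b * k' \<and> chi k * chi k' = cff b u"
    if "u \<in> UU b" "u \<noteq> 1\<^sub>m 3" for u b
    using UU_nontriv_True UU_nontriv_False that by (cases b) simp_all
qed (auto simp: GG_carrier one_II II_GG GG_mult II_mult GG_iv II_iv uinv_left uinv_right chi_one chi_mult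
    nn_GG finite_UU UU_II one_UU chi_Iw1 UU_Iw1 intro: UU_unique)

end

section \<open>The double cosets of the Iwahori subgroup\<close>

text \<open>The valuation of the nonzero entry in the first row of the monomial matrix attached to a word.\<close>

fun word_val :: "bool list \<Rightarrow> int" where
  "word_val [] = 0"
| "word_val (b # w) = (if b then 0 else - 1) - word_val w"

text \<open>Every letter negates the valuation and \<open>False\<close> then subtracts one, so along
  an alternating word it moves away from 0 with the sign dictated by the first letter.\<close>

lemma word_val_sign:
  assumes "distinct_adj w" "w \<noteq> []"
  shows "if hd w then word_val w \<ge> 0 \<and> (even (length w) \<longrightarrow> word_val w \<ge> 1) else word_val w \<le> - 1"
  using assms
proof (induction w)
  case (Cons b w)
  show ?case
  proof (cases "w = []")
    case False
    then have "distinct_adj w" "hd w = (\<not> b)" using Cons.prems by (auto simp: distinct_adj_Cons)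
    then show ?thesis using Cons.IH False by (cases b) auto
  qed simp
qed simp

text \<open>Parity separates translations from reflections in the infinite dihedral group. The sign
  rule recovers the first letter, and induction the rest.\<close>

lemma word_val_inj:
  assumes "distinct_adj w" "distinct_adj w'" "even (length w) \<longleftrightarrow> even (length w')" "word_val w = word_val w'"
  shows "w = w'"
  using assms
proof (induction w arbitrary: w')
  case Nil
  show ?case
  proof (rule ccontr)
    assume "[] \<noteq> w'"
    then show False using word_val_sign[of w'] Nil by (auto split: if_splits)
  qed
next
  case (Cons b w)
  show ?case
  proof (cases w')
    case Nil
    then show ?thesis using word_val_sign[of "b # w"] Cons.prems by (auto split: if_splits)
  next
    case (Cons b' v)
    have "b = b'"
      using word_val_sign[of "b # w"] word_val_sign[of w'] Cons.prems Cons by (auto split: if_splits)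
    moreover have "w = v"
      by (rule Cons.IH) (use Cons.prems Cons \<open>b = b'\<close> in \<open>auto simp: distinct_adj_Cons\<close>)
    ultimately show ?thesis using Cons by simp
  qed
qed

text \<open>The prefix \<open>False, True\<close> translates the valuation by -1; in the next lemma
  \<open>True, False\<close> translates it by 1.\<close>

lemma word_val_even_neg: "\<exists>w. distinct_adj w \<and> (w \<noteq> [] \<longrightarrow> \<not> hd w) \<and> even (length w) \<and> word_val w = - int k"
proof (induction k)
  case 0 show ?case by (rule exI[of _ "[]"]) simp
next
  case (Suc k)
  then obtain w where "distinct_adj w" "w \<noteq> [] \<longrightarrow> \<not> hd w" "even (length w)" "word_val w = - int k" by blast
  then show ?case by (intro exI[of _ "False # True # w"]) (auto simp: distinct_adj_Cons)
qed

lemma word_val_even_pos: "\<exists>w. distinct_adj w \<and> (w \<noteq> [] \<longrightarrow> hd w) \<and> even (length w) \<and> word_val w = int k"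
proof (induction k)
  case 0 show ?case by (rule exI[of _ "[]"]) simp
next
  case (Suc k)
  then obtain w where "distinct_adj w" "w \<noteq> [] \<longrightarrow> hd w" "even (length w)" "word_val w = int k" by blast
  then show ?case by (intro exI[of _ "True # False # w"]) (auto simp: distinct_adj_Cons)
qed

lemma word_val_surj: "\<exists>w. distinct_adj w \<and> even (length w) = ev \<and> word_val w = m"
proof -
  obtain w1 where w1: "distinct_adj w1" "w1 \<noteq> [] \<longrightarrow> \<not> hd w1" "even (length w1)" "word_val w1 = - int (nat \<bar>m\<bar>)"
    using word_val_even_neg by blast
  obtain w2 where w2: "distinct_adj w2" "w2 \<noteq> [] \<longrightarrow> hd w2" "even (length w2)" "word_val w2 = int (nat \<bar>m\<bar>)"
    using word_val_even_pos by blast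
  obtain w3 where w3: "distinct_adj w3" "w3 \<noteq> [] \<longrightarrow> hd w3" "even (length w3)" "word_val w3 = int (nat (- 1 - m))"
    using word_val_even_pos by blast
  show ?thesis
  proof (cases ev; cases "m \<ge> 0")
    assume "ev" "m \<ge> 0" then show ?thesis using w2 by (intro exI[of _ w2]) auto
  next
    assume "ev" "\<not> m \<ge> 0" then show ?thesis using w1 by (intro exI[of _ w1]) auto
  next
    assume "\<not> ev" "m \<ge> 0" then show ?thesis using w1
      by (intro exI[of _ "True # w1"]) (auto simp: distinct_adj_Cons)
  next
    assume "\<not> ev" "\<not> m \<ge> 0" then show ?thesis using w3
      by (intro exI[of _ "False # w3"]) (auto simp: distinct_adj_Cons)
  qed
qed

section \<open>Monomial matrices of alternating words\<close>

context unramified_data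
begin

lemma nn_form: "\<exists>\<alpha> \<beta>. \<alpha> \<noteq> 0 \<and> \<beta> \<noteq> 0 \<and> v \<alpha> = (if b then 0 else - 1) \<and> v \<beta> = (if b then 0 else 1) \<and>
    nn b = anti3 \<alpha> \<beta>"
proof -
  have [simp]: "v seps = 0" using unit_seps by (simp add: unit_def)
  show ?thesis
  proof (cases b)
    case True
    then show ?thesis by (intro exI[of _ "- inverse seps"] exI[of _ seps]) (simp add: nn_anti v_inverse)
  next
    case False
    then show ?thesis using nn_anti(2)
      by (intro exI[of _ "- inverse (w * seps)"] exI[of _ "w * seps"])
        (simp add: v_mult v_inverse del: inverse_mult_distrib)
  qed
qed

lemma word_form:
  obtains a c where "a \<noteq> 0" "c \<noteq> 0" "v a = word_val u" "v c = - word_val u"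
    "word_prod 3 nn u = (if even (length u) then diag3 a 1 c else anti3 a c)"
proof -
  have "\<exists>a c. a \<noteq> 0 \<and> c \<noteq> 0 \<and> v a = word_val u \<and> v c = - word_val u \<and>
    word_prod 3 nn u = (if even (length u) then diag3 a 1 c else anti3 a c)"
  proof (induction u)
    case Nil
    show ?case by (intro exI[of _ 1]) (simp add: one_m3 diag3_m3)
  next
    case (Cons b u)
    then obtain a c where ac: "a \<noteq> 0" "c \<noteq> 0" "v a = word_val u" "v c = - word_val u"
      "word_prod 3 nn u = (if even (length u) then diag3 a 1 c else anti3 a c)" by blast
    obtain \<alpha> \<beta> where n: "\<alpha> \<noteq> 0" "\<beta> \<noteq> 0" "v \<alpha> = (if b then 0 else - 1)" "v \<beta> = (if b then 0 else 1)"
      "nn b = anti3 \<alpha> \<beta>" using nn_form by blast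
    have "anti3 \<alpha> \<beta> * diag3 a 1 c = anti3 (\<alpha> * c) (\<beta> * a)"
      "anti3 \<alpha> \<beta> * anti3 a c = diag3 (\<alpha> * c) 1 (\<beta> * a)"
      by (simp_all add: anti3_def diag3_m3 m3_mult)
    then show ?case using n ac
      by (intro exI[of _ "\<alpha> * c"] exI[of _ "\<beta> * a"]) (simp add: v_mult)
  qed
  then show ?thesis using that by blast
qed

lemma word_GG: "word_prod 3 nn u \<in> GG"
  by (induction u) (auto intro: one_GG GG_mult nn_GG)

text \<open>A matrix found by entrywise computation inherits unitarity from the product it solves,
  which spares its nine equations.\<close>

lemma GG_cancel:
  assumes n: "n \<in> GG" and u: "u \<in> GG" and k: "k \<in> carrier_mat 3 3" and eq: "u * n = n * k"
  shows "k \<in> GG"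
proof -
  have c: "iv n \<in> carrier_mat 3 3" "n \<in> carrier_mat 3 3" using n GG_carrier GG_iv by auto
  have "iv n * (u * n) = iv n * n * k" unfolding eq by (rule assoc_mult_mat[OF c k, symmetric])
  also have "\<dots> = k" unfolding uinv_left[OF n] by (rule left_mult_one_mat[OF k])
  finally show ?thesis using GG_mult[OF GG_iv[OF n] GG_mult[OF u n]] by simp
qed

lemma GG_cancel_right:
  assumes n: "n \<in> GG" and u: "u \<in> GG" and k: "k \<in> carrier_mat 3 3" and eq: "u = k * n"
  shows "k \<in> GG"
proof -
  have c: "n \<in> carrier_mat 3 3" "iv n \<in> carrier_mat 3 3" using n GG_carrier GG_iv by auto
  have "u * iv n = k * (n * iv n)" unfolding eq by (rule assoc_mult_mat[OF k c])
  also have "\<dots> = k" unfolding uinv_right[OF n] by (rule right_mult_one_mat[OF k])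
  finally show ?thesis using GG_mult[OF u GG_iv[OF n]] by simp
qed

text \<open>Conjugation by \<open>n_w\<close> rescales the entries of \<open>u\<close> according to
  \<open>word_val\<close>. As \<open>ws\<close> does not start with \<open>b\<close>, the sign of
  the valuation makes the result stay in \<open>I(1)\<close>.\<close>

lemma word_conjugate:
  assumes w: "distinct_adj (b # ws)" and u: "u \<in> UU b"
  shows "\<exists>k\<in>Iw1 v sg. u * word_prod 3 nn ws = word_prod 3 nn ws * k"
proof -
  let ?n = "word_prod 3 nn ws" and ?e = "word_val ws"
  obtain a c where ac: "a \<noteq> 0" "c \<noteq> 0" "v a = ?e" "v c = - ?e"
    "?n = (if even (length ws) then diag3 a 1 c else anti3 a c)" by (rule word_form)
  have sgn: "if b then ?e \<le> 0 \<and> (odd (length ws) \<longrightarrow> ?e \<le> - 1) else ?e \<ge> 0"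
    using word_val_sign[of ws] w by (cases "ws = []") (auto simp: distinct_adj_Cons split: if_splits)
  have finish: "\<exists>k\<in>Iw1 v sg. u * ?n = ?n * k"
    if eq: "u * ?n = ?n * m3 1 x y x' 1 y' z z' 1"
      and bds: "x \<in> P 0" "y \<in> P 0" "x' \<in> P 1" "y' \<in> P 0" "z \<in> P 1" "z' \<in> P 1" for x y x' y' z z'
  proof -
    have "m3 1 x y x' 1 y' z z' 1 \<in> GG"
      by (rule GG_cancel[OF word_GG II_GG[OF UU_II[OF u]] m3_carrier eq])
    then have "m3 1 x y x' 1 y' z z' 1 \<in> Iw1 v sg" using bds by (simp add: m3_Iw1 m3_II)
    then show ?thesis using eq by blast
  qed
  show ?thesis
  proof (cases b)
    case True
    then obtain x y where xy: "u = uu x y" using u by (auto simp: UU_def ut_def)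
    then have O: "x \<in> P 0" "y \<in> P 0" using UU_II[OF u] uu_II by auto
    have P: "s \<in> P k" if "s \<in> P 0" "k \<le> 0" for s k using that P_mono by blast
    show ?thesis
    proof (cases "even (length ws)")
      case even: True
      have "u * ?n = ?n * m3 1 (x / a) (y * c / a) 0 1 (- (sg x * c)) 0 0 1"
        using ac by (simp add: xy even uu_def diag3_m3 m3_mult m3_eq_iff)
      then show ?thesis
        by (rule finish) (use True sgn ac O in
            \<open>simp_all add: P_div mult.commute[of _ c] P_scale P\<close>)
    next
      case odd: False
      have "u * ?n = ?n * m3 1 0 0 (- (sg x * c)) 1 0 (y * c / a) (x / a) 1"
        using ac by (simp add: xy odd uu_def anti3_def m3_mult m3_eq_iff)
      then show ?thesis
        by (rule finish) (use True odd sgn ac O in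
            \<open>simp_all add: P_div mult.commute[of _ c] P_scale P\<close>)
    qed
  next
    case False
    then obtain z where z: "u = lo 0 z" using u by (auto simp: UU_def lt_def)
    then have O: "z \<in> P 1" using UU_II[OF u] lo_II by auto
    have P: "z \<in> P k" if "k \<le> 1" for k using that O P_mono by blast
    show ?thesis
    proof (cases "even (length ws)")
      case even: True
      have "u * ?n = ?n * m3 1 0 0 0 1 0 (z * a / c) 0 1"
        using ac by (simp add: z even lo_def diag3_m3 m3_mult m3_eq_iff)
      then show ?thesis
        by (rule finish) (use False sgn ac in
            \<open>simp_all add: P_div mult.commute[of _ a] P_scale P\<close>)
    next
      case odd: False
      have "u * ?n = ?n * m3 1 0 (z * a / c) 0 1 0 0 0 1"
        using ac by (simp add: z odd lo_def anti3_def m3_mult m3_eq_iff)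
      then show ?thesis
        by (rule finish) (use False sgn ac in
            \<open>simp_all add: P_div mult.commute[of _ a] P_scale P\<close>)
    qed
  qed
qed

lemma v_P: "x \<noteq> 0 \<Longrightarrow> x \<in> P k \<Longrightarrow> k \<le> v x" by (simp add: P_iff)

text \<open>The outer diagonal entries of Iwahori elements are units, so for equal parity comparison
  of one entry equates the valuations, and \<open>word_val_inj\<close> applies.\<close>

lemma double_cosets_disjoint:
  assumes ws: "distinct_adj ws" "distinct_adj ws'" and k: "k \<in> II" "k' \<in> II"
    and eq: "word_prod 3 nn ws = k * word_prod 3 nn ws' * k'"
  shows "ws = ws'"
proof -
  let ?n = "word_prod 3 nn ws" and ?n' = "word_prod 3 nn ws'"
  obtain a c where ac: "a \<noteq> 0" "c \<noteq> 0" "v a = word_val ws" "v c = - word_val ws"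
    "?n = (if even (length ws) then diag3 a 1 c else anti3 a c)" by (rule word_form)
  obtain a' c' where ac': "a' \<noteq> 0" "c' \<noteq> 0" "v a' = word_val ws'" "v c' = - word_val ws'"
    "?n' = (if even (length ws') then diag3 a' 1 c' else anti3 a' c')" by (rule word_form)
  have cm: "iv k \<in> carrier_mat 3 3" "k \<in> carrier_mat 3 3" "?n' * k' \<in> carrier_mat 3 3"
    "?n' \<in> carrier_mat 3 3" "k' \<in> carrier_mat 3 3"
    using k II_GG GG_iv GG_mult word_GG GG_carrier by auto
  have "iv k * ?n = iv k * (k * (?n' * k'))" unfolding eq assoc_mult_mat[OF cm(2,4,5)] ..
  also have "\<dots> = iv k * k * (?n' * k')" by (rule assoc_mult_mat[OF cm(1-3), symmetric])
  also have "\<dots> = ?n' * k'" unfolding uinv_left[OF II_GG[OF k(1)]] by (rule left_mult_one_mat[OF cm(3)])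
  finally have eq': "iv k * ?n = ?n' * k'" .
  obtain l00 l01 l02 l10 l11 l12 l20 l21 l22 where l: "iv k = m3 l00 l01 l02 l10 l11 l12 l20 l21 l22"
    by (rule II_E[OF II_iv[OF k(1)]])
  obtain k00 k01 k02 k10 k11 k12 k20 k21 k22 where k': "k' = m3 k00 k01 k02 k10 k11 k12 k20 k21 k22"
    by (rule II_E[OF k(2)])
  have ul: "unit l00" "unit l22" "l02 \<in> P 0" "l20 \<in> P 1"
    using II_diag_units(1,2) II_iv[OF k(1)] unfolding l by (auto simp: m3_II)
  have uk: "unit k00" "unit k22" "k02 \<in> P 0" "k20 \<in> P 1"
    using II_diag_units(1,2) k(2) unfolding k' by (auto simp: m3_II)
  show ?thesis
  proof (cases "even (length ws)"; cases "even (length ws')")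
    assume "even (length ws)" "even (length ws')"
    moreover then have "l00 * a = a' * k00"
      using eq' by (simp add: ac ac' l k' diag3_m3 m3_mult m3_eq_iff)
    then have "v (l00 * a) = v (a' * k00)" by simp
    then have "v a = v a'" using ul uk ac ac' by (simp add: v_mult unit_def)
    ultimately show ?thesis using word_val_inj[OF ws] ac ac' by simp
  next
    assume "odd (length ws)" "odd (length ws')"
    moreover then have "l00 * a = a' * k22"
      using eq' by (simp add: ac ac' l k' anti3_def m3_mult m3_eq_iff)
    then have "v (l00 * a) = v (a' * k22)" by simp
    then have "v a = v a'" using ul uk ac ac' by (simp add: v_mult unit_def)
    ultimately show ?thesis using word_val_inj[OF ws] ac ac' by simp
  next
    \<comment> \<open>One entry gives \<open>word_val ws \<ge> word_val ws' + 1\<close>, the other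
      \<open>word_val ws \<le> word_val ws'\<close>.\<close>
    assume "even (length ws)" "odd (length ws')"
    then have 1: "l00 * a = a' * k20" "l22 * c = c' * k02"
      using eq' by (simp_all add: ac ac' l k' diag3_m3 anti3_def m3_mult m3_eq_iff)
    then have nz: "k20 \<noteq> 0" "k02 \<noteq> 0" using ul ac by (auto simp: unit_def)
    have "v (l00 * a) = v (a' * k20)" "v (l22 * c) = v (c' * k02)" using 1 by simp_all
    then show ?thesis using v_P[OF nz(1) uk(4)] v_P[OF nz(2) uk(3)] ul ac ac' nz
      by (simp add: v_mult unit_def)
  next
    assume "odd (length ws)" "even (length ws')"
    then have 1: "l02 * c = a' * k00" "l20 * a = c' * k22"
      using eq' by (simp_all add: ac ac' l k' diag3_m3 anti3_def m3_mult m3_eq_iff)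
    then have nz: "l02 \<noteq> 0" "l20 \<noteq> 0" using uk ac' by (auto simp: unit_def)
    have "v (l02 * c) = v (a' * k00)" "v (l20 * a) = v (c' * k22)" using 1 by simp_all
    then show ?thesis using v_P[OF nz(1) ul(3)] v_P[OF nz(2) ul(4)] uk ac ac' nz
      by (simp add: v_mult unit_def)
  qed
qed

section \<open>Covering the unitary group by double cosets\<close>

definition covered :: "'e mat \<Rightarrow> bool" where
  "covered g \<longleftrightarrow> (\<exists>ws. \<exists>k\<in>II. \<exists>k'\<in>II. distinct_adj ws \<and> g = k * word_prod 3 nn ws * k')"

lemma covered_mult:
  assumes g: "covered g" and l: "l \<in> II" "l' \<in> II" shows "covered (l * g * l')"
proof -
  obtain ws k k' where k: "k \<in> II" "k' \<in> II" "distinct_adj ws" "g = k * word_prod 3 nn ws * k'"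
    using g by (auto simp: covered_def)
  let ?n = "word_prod 3 nn ws"
  have c: "l \<in> carrier_mat 3 3" "l' \<in> carrier_mat 3 3" "k \<in> carrier_mat 3 3" "k' \<in> carrier_mat 3 3"
    "?n \<in> carrier_mat 3 3" "l * k \<in> carrier_mat 3 3" "k * ?n \<in> carrier_mat 3 3" "l * k * ?n \<in> carrier_mat 3 3"
    using l k II_GG GG_carrier word_GG GG_mult by auto
  have "l * g * l' = l * (k * ?n) * k' * l'" unfolding k(4) assoc_mult_mat[OF c(1,7,4)] ..
  also have "\<dots> = (l * k * ?n) * k' * l'" unfolding assoc_mult_mat[OF c(1,3,5)] ..
  also have "\<dots> = (l * k) * ?n * (k' * l')" by (rule assoc_mult_mat[OF c(8,4,2)])
  finally show ?thesis unfolding covered_def using k II_mult l by blast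
qed

lemma covered_left: "covered g \<Longrightarrow> g \<in> carrier_mat 3 3 \<Longrightarrow> l \<in> II \<Longrightarrow> covered (l * g)"
  using covered_mult[of g l "1\<^sub>m 3"] one_II right_mult_one_mat[of "l * g" 3 3]
  by (simp add: GG_carrier II_GG mult_carrier_mat[of l 3 3 g 3])

lemma covered_right: "covered g \<Longrightarrow> g \<in> carrier_mat 3 3 \<Longrightarrow> l \<in> II \<Longrightarrow> covered (g * l)"
  using covered_mult[of g "1\<^sub>m 3" l] one_II left_mult_one_mat[of g 3 3] by simp

lemma coveredI: "distinct_adj ws \<Longrightarrow> k \<in> II \<Longrightarrow> g = k * word_prod 3 nn ws \<Longrightarrow> covered g"
  unfolding covered_def using one_II right_mult_one_mat[OF GG_carrier[OF GG_mult[OF II_GG word_GG]]] by metis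

text \<open>Unitarity makes the outer valuations opposite and the middle entry a unit.
  \<open>word_val_surj\<close> supplies a word of the same shape and valuation, and the quotient is
  a diagonal matrix in \<open>I\<close>.\<close>

lemma covered_monomial:
  assumes "m3 x 0 0 0 d 0 0 0 z \<in> GG" shows "covered (m3 x 0 0 0 d 0 0 0 z)"
    and "m3 0 0 x 0 d 0 z 0 0 \<in> GG \<Longrightarrow> covered (m3 0 0 x 0 d 0 z 0 0)"
proof -
  have eqs: "sg z * x = 1" "sg d * d = 1" using assms by (auto simp: m3_Ggrp)
  then have nz: "x \<noteq> 0" "z \<noteq> 0" "d \<noteq> 0" by auto
  have "v (sg z * x) = 0" "v (sg d * d) = 0" unfolding eqs by simp_all
  then have vs: "v z = - v x" "v d = 0" using nz by (simp_all add: v_mult)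
  have t: "m3 (x / a) 0 0 0 d 0 0 0 (z / c) \<in> II"
    if "a \<noteq> 0" "c \<noteq> 0" "v a = v x" "v c = - v x" "m3 (x / a) 0 0 0 d 0 0 0 (z / c) \<in> GG" for a c
    using that nz vs by (simp add: m3_II P_iff v_divide)
  show "covered (m3 x 0 0 0 d 0 0 0 z)"
  proof -
    obtain ws where ws: "distinct_adj ws" "even (length ws) = True" "word_val ws = v x"
      using word_val_surj by blast
    obtain a c where ac: "a \<noteq> 0" "c \<noteq> 0" "v a = word_val ws" "v c = - word_val ws"
      "word_prod 3 nn ws = (if even (length ws) then diag3 a 1 c else anti3 a c)" by (rule word_form)
    have eq: "m3 x 0 0 0 d 0 0 0 z = m3 (x / a) 0 0 0 d 0 0 0 (z / c) * word_prod 3 nn ws"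
      using ac ws by (simp add: diag3_m3 m3_mult)
    have "m3 (x / a) 0 0 0 d 0 0 0 (z / c) \<in> II"
      by (rule t[OF ac(1,2) _ _ GG_cancel_right[OF word_GG assms m3_carrier eq]]) (use ac ws in simp_all)
    then show ?thesis using coveredI[OF ws(1) _ eq] by blast
  qed
  show "covered (m3 0 0 x 0 d 0 z 0 0)" if M: "m3 0 0 x 0 d 0 z 0 0 \<in> GG"
  proof -
    obtain ws where ws: "distinct_adj ws" "even (length ws) = False" "word_val ws = v x"
      using word_val_surj by blast
    obtain a c where ac: "a \<noteq> 0" "c \<noteq> 0" "v a = word_val ws" "v c = - word_val ws"
      "word_prod 3 nn ws = (if even (length ws) then diag3 a 1 c else anti3 a c)" by (rule word_form)
    have eq: "m3 0 0 x 0 d 0 z 0 0 = m3 (x / a) 0 0 0 d 0 0 0 (z / c) * word_prod 3 nn ws"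
      using ac ws by (simp add: anti3_def m3_mult)
    have "m3 (x / a) 0 0 0 d 0 0 0 (z / c) \<in> II"
      by (rule t[OF ac(1,2) _ _ GG_cancel_right[OF word_GG M m3_carrier eq]]) (use ac ws in simp_all)
    then show ?thesis using coveredI[OF ws(1) _ eq] by blast
  qed
qed

text \<open>The norm of \<open>x\<close> is minus the trace of \<open>y\<close>. Thus the corner
  alone decides membership in \<open>I\<close>, and the commutation lemmas below track nothing
  else.\<close>

lemma heisenberg_corner:
  assumes "y + sg y + x * sg x = 0" shows "y \<in> P 0 \<Longrightarrow> x \<in> P 0" "y \<in> P 1 \<Longrightarrow> x \<in> P 1"
proof -
  have N: "x * sg x = - (y + sg y)" using assms add_eq_0_iff by blast
  show "y \<in> P 0 \<Longrightarrow> x \<in> P 0" "y \<in> P 1 \<Longrightarrow> x \<in> P 1"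
    by (rule P0_of_norm P1_of_norm, simp add: N P_add del: minus_add_distrib)+
qed

lemma uu_II_corner: "uu x y \<in> GG \<Longrightarrow> y \<in> P 0 \<Longrightarrow> uu x y \<in> II"
  using heisenberg_corner(1) by (simp add: uu_II uu_GG)

lemma lo_II_corner: "lo x y \<in> GG \<Longrightarrow> y \<in> P 1 \<Longrightarrow> lo x y \<in> II"
  using heisenberg_corner(2) by (simp add: lo_II lo_GG)

lemma diag_uu:
  assumes t: "m3 x 0 0 0 d 0 0 0 z \<in> GG" and u: "uu a b \<in> GG"
  obtains a' where "uu a' (x * b / z) \<in> GG"
    "m3 x 0 0 0 d 0 0 0 z * uu a b = uu a' (x * b / z) * m3 x 0 0 0 d 0 0 0 z"
proof -
  have eqs: "sg z * x = 1" "sg d * d = 1" "sg x * z = 1" using t by (auto simp: m3_Ggrp)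
  then have nz: "x \<noteq> 0" "z \<noteq> 0" "d \<noteq> 0" by auto
  have sx: "sg x = 1 / z" "sg d = 1 / d" using eqs nz by (simp_all add: field_simps)
  have eq: "m3 x 0 0 0 d 0 0 0 z * uu a b = uu (x * a / d) (x * b / z) * m3 x 0 0 0 d 0 0 0 z"
    using nz sx by (simp add: uu_def m3_mult mult_ac)
  have "uu (x * a / d) (x * b / z) \<in> GG"
    by (rule GG_cancel_right[OF t GG_mult[OF t u] _ eq]) (simp add: uu_def)
  then show ?thesis using eq that by blast
qed

lemma diag_lo:
  assumes t: "m3 x 0 0 0 d 0 0 0 z \<in> GG" and u: "lo a b \<in> GG"
  obtains a' where "lo a' (z * b / x) \<in> GG"
    "m3 x 0 0 0 d 0 0 0 z * lo a b = lo a' (z * b / x) * m3 x 0 0 0 d 0 0 0 z"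
proof -
  have eqs: "sg z * x = 1" "sg d * d = 1" "sg x * z = 1" using t by (auto simp: m3_Ggrp)
  then have nz: "x \<noteq> 0" "z \<noteq> 0" "d \<noteq> 0" by auto
  have sx: "sg x = 1 / z" "sg d = 1 / d" using eqs nz by (simp_all add: field_simps)
  have eq: "m3 x 0 0 0 d 0 0 0 z * lo a b = lo (d * a / x) (z * b / x) * m3 x 0 0 0 d 0 0 0 z"
    using nz sx by (simp add: lo_def m3_mult mult_ac)
  have "lo (d * a / x) (z * b / x) \<in> GG"
    by (rule GG_cancel_right[OF t GG_mult[OF t u] _ eq]) (simp add: lo_def)
  then show ?thesis using eq that by blast
qed

lemma nS_uu:
  assumes u: "uu a b \<in> GG"
  obtains a' where "lo a' (- (eps * b)) \<in> GG" "nn True * uu a b = lo a' (- (eps * b)) * nn True"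
proof -
  have eq: "nn True * uu a b = lo (seps * sg a) (- (eps * b)) * nn True"
    by (simp add: nn_anti anti3_def uu_def lo_def m3_mult m3_eq_iff seps_sq[symmetric])
  have "lo (seps * sg a) (- (eps * b)) \<in> GG"
    by (rule GG_cancel_right[OF nn_GG GG_mult[OF nn_GG u] _ eq]) (simp add: lo_def)
  then show ?thesis using eq that by blast
qed

lemma nS_lo:
  assumes u: "lo a b \<in> GG"
  obtains a' where "uu a' (- (b / eps)) \<in> GG" "nn True * lo a b = uu a' (- (b / eps)) * nn True"
proof -
  have eq: "nn True * lo a b = uu (sg a / seps) (- (b / eps)) * nn True"
    using eps0 by (simp add: nn_anti anti3_def uu_def lo_def m3_mult m3_eq_iff seps_sq[symmetric] field_simps)
  have "uu (sg a / seps) (- (b / eps)) \<in> GG"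
    by (rule GG_cancel_right[OF nn_GG GG_mult[OF nn_GG u] _ eq]) (simp add: uu_def)
  then show ?thesis using eq that by blast
qed

text \<open>In rank one, \<open>uu a b\<close> with \<open>b\<close> nonzero lies in the big cell of the opposite Borel subgroup.\<close>

lemma uu_big_cell:
  assumes u: "uu a b \<in> GG" and b: "b \<noteq> 0"
  shows "lo (- (sg a / b)) (1 / b) \<in> GG" "lo (- (sg a / sg b)) (1 / b) \<in> GG"
    "m3 0 0 b 0 (- (sg b / b)) 0 (1 / sg b) 0 0 \<in> GG"
    "uu a b = lo (- (sg a / b)) (1 / b) * (m3 0 0 b 0 (- (sg b / b)) 0 (1 / sg b) 0 0 * lo (- (sg a / sg b)) (1 / b))"
proof -
  have N: "b + sg b + a * sg a = 0" using u by (simp add: uu_GG)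
  have sb: "sg b \<noteq> 0" using b by simp
  have 1: "1 / b + 1 / sg b + a * sg a / (b * sg b) = (b + sg b + a * sg a) / (b * sg b)"
    using b by (simp add: field_simps)
  show "lo (- (sg a / b)) (1 / b) \<in> GG" "lo (- (sg a / sg b)) (1 / b) \<in> GG"
    using 1 N by (simp_all add: lo_GG mult.commute)
  show "m3 0 0 b 0 (- (sg b / b)) 0 (1 / sg b) 0 0 \<in> GG" using b by (simp add: m3_Ggrp)
  have N2: "- (a * sg a) = b + sg b" using N by (simp add: neg_eq_iff_add_eq_0 ac_simps)
  show "uu a b = lo (- (sg a / b)) (1 / b) * (m3 0 0 b 0 (- (sg b / b)) 0 (1 / sg b) 0 0 * lo (- (sg a / sg b)) (1 / b))"
    using b sb by (simp add: uu_def lo_def m3_mult m3_eq_iff) (use N N2 in \<open>simp add: field_simps\<close>)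
qed

lemma monomial_GG: "m3 0 0 x 0 d 0 z 0 0 \<in> GG \<longleftrightarrow> m3 x 0 0 0 d 0 0 0 z \<in> GG"
  by (auto simp: m3_Ggrp)

lemmas covered_diag = covered_monomial(1)

lemma covered_anti: "m3 0 0 x 0 d 0 z 0 0 \<in> GG \<Longrightarrow> covered (m3 0 0 x 0 d 0 z 0 0)"
  using covered_monomial(2) monomial_GG by blast

lemma GG_assoc: "a \<in> GG \<Longrightarrow> b \<in> GG \<Longrightarrow> c \<in> GG \<Longrightarrow> a * b * c = a * (b * c)"
  by (meson GG_carrier assoc_mult_mat)

text \<open>If \<open>b\<close> is not integral, the right factor of the big cell lies in
  \<open>I\<close>. On the left, either \<open>uu a b\<close> or the left factor of the big cell is
  moved past the monomial part; their corners become inverse to each other up to a unit, so one of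
  the two moves lands in \<open>I\<close>.\<close>

lemma covered_borel:
  assumes t: "m3 x 0 0 0 d 0 0 0 z \<in> GG" and u: "uu a b \<in> GG"
  shows "covered (m3 x 0 0 0 d 0 0 0 z * uu a b)"
    and "covered (nn True * (m3 x 0 0 0 d 0 0 0 z * uu a b))"
proof -
  let ?D = "m3 x 0 0 0 d 0 0 0 z" and ?S = "nn True" and ?u = "uu a b"
  have S: "?S \<in> GG" by (rule nn_GG)
  have eqs: "sg z * x = 1" using t by (auto simp: m3_Ggrp)
  then have nz: "x \<noteq> 0" "z \<noteq> 0" by auto
  have D: "covered ?D" by (rule covered_diag[OF t])
  have SD_eq: "?S * ?D = m3 0 0 (- (inverse seps * z)) 0 d 0 (seps * x) 0 0"
    by (simp add: nn_anti anti3_def m3_mult)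
  have SD: "covered (?S * ?D)"
    using GG_mult[OF S t] unfolding SD_eq by (rule covered_anti)
  have "covered (?D * ?u) \<and> covered (?S * (?D * ?u))"
  proof (cases "b \<in> P 0")
    case True
    then have uI: "?u \<in> II" using u uu_II_corner by blast
    have "?S * (?D * ?u) = ?S * ?D * ?u" using S t u by (simp add: GG_assoc)
    then show ?thesis
      using covered_right[OF D GG_carrier[OF t] uI] covered_right[OF SD GG_carrier[OF GG_mult[OF S t]] uI] by simp
  next
    case False
    then have b: "b \<noteq> 0" "v b < 0" by (auto simp: pEk_def)
    let ?l = "lo (- (sg a / b)) (1 / b)" and ?l2 = "lo (- (sg a / sg b)) (1 / b)"
      and ?M = "m3 0 0 b 0 (- (sg b / b)) 0 (1 / sg b) 0 0"
    note cell = uu_big_cell[OF u b(1)]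
    have l2: "?l2 \<in> II" by (rule lo_II_corner[OF cell(2)]) (use b in \<open>simp add: P_div\<close>, simp add: P_iff)
    have DM: "?D * ?M \<in> GG" "?S * (?D * ?M) \<in> GG" by (intro GG_mult t S cell)+
    have DM_eq: "?D * ?M = m3 0 0 (x * b) 0 (- (d * sg b / b)) 0 (z / sg b) 0 0" by (simp add: m3_mult)
    have cDM: "covered (?D * ?M)" using DM(1) unfolding DM_eq by (rule covered_anti)
    have SDM_eq: "?S * (?D * ?M) = m3 (- (inverse seps * (z / sg b))) 0 0 0 (- (d * sg b / b)) 0 0 0 (seps * (x * b))"
      unfolding DM_eq by (simp add: nn_anti anti3_def m3_mult)
    have cSDM: "covered (?S * (?D * ?M))" using DM(2) unfolding SDM_eq by (rule covered_diag)
    obtain a1 where a1: "uu a1 (x * b / z) \<in> GG" "?D * ?u = uu a1 (x * b / z) * ?D"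
      using diag_uu[OF t u] by blast
    obtain a2 where a2: "lo a2 (z * (1 / b) / x) \<in> GG" "?D * ?l = lo a2 (z * (1 / b) / x) * ?D"
      using diag_lo[OF t cell(1)] by blast
    obtain a3 where a3: "lo a3 (- (eps * (x * b / z))) \<in> GG"
      "?S * uu a1 (x * b / z) = lo a3 (- (eps * (x * b / z))) * ?S" using nS_uu[OF a1(1)] by blast
    obtain a4 where a4: "uu a4 (- (z * (1 / b) / x / eps)) \<in> GG"
      "?S * lo a2 (z * (1 / b) / x) = uu a4 (- (z * (1 / b) / x / eps)) * ?S" using nS_lo[OF a2(1)] by blast
    have Du: "?D * ?u = lo a2 (z * (1 / b) / x) * ((?D * ?M) * ?l2)"
    proof -
      have "?D * ?u = (?D * ?l) * (?M * ?l2)"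
        unfolding cell(4) using t cell(1-3) GG_mult by (simp add: GG_assoc)
      then show ?thesis unfolding a2(2) using t cell(1-3) a2(1) GG_mult by (simp add: GG_assoc)
    qed
    have v1: "v (x * b / z) = v x + v b - v z" "v (z * (1 / b) / x) = - (v x + v b - v z)"
      using nz b by (simp_all add: v_mult v_divide)
    have nz1: "x * b / z \<noteq> 0" "z * (1 / b) / x \<noteq> 0" using nz b by simp_all
    have SDu: "?S * (?D * ?u) = lo a3 (- (eps * (x * b / z))) * (?S * ?D)"
    proof -
      have "?S * (?D * ?u) = (?S * uu a1 (x * b / z)) * ?D"
        unfolding a1(2) using S a1(1) t by (simp add: GG_assoc)
      then show ?thesis unfolding a3(2) using S a3(1) t by (simp add: GG_assoc)
    qed
    have SDu': "?S * (?D * ?u) = uu a4 (- (z * (1 / b) / x / eps)) * (?S * (?D * ?M) * ?l2)"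
    proof -
      have "?S * (?D * ?u) = (?S * lo a2 (z * (1 / b) / x)) * ((?D * ?M) * ?l2)"
        unfolding Du using S a2(1) DM(1) cell(2) GG_mult by (simp add: GG_assoc)
      then show ?thesis unfolding a4(2) using S a4(1) DM(1) cell(2) GG_mult by (simp add: GG_assoc)
    qed
    have c: "(?D * ?M) * ?l2 \<in> carrier_mat 3 3" "?S * (?D * ?M) * ?l2 \<in> carrier_mat 3 3"
      by (intro GG_carrier GG_mult DM cell)+
    have "covered (?D * ?u)"
    proof (cases "0 \<le> v x + v b - v z")
      case True
      then have "uu a1 (x * b / z) \<in> II" using uu_II_corner[OF a1(1)] nz1 v1 by (simp add: P_iff)
      then show ?thesis unfolding a1(2) by (rule covered_left[OF D GG_carrier[OF t]])
    next
      case False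
      then have "lo a2 (z * (1 / b) / x) \<in> II" using lo_II_corner[OF a2(1)] nz1 v1 by (simp add: P_iff)
      then show ?thesis unfolding Du
        by (rule covered_left[OF covered_right[OF cDM GG_carrier[OF DM(1)] l2] c(1)])
    qed
    \<comment> \<open>\<open>n_s\<close> exchanges upper and lower unipotents, which shifts the
      threshold from 0 to 1.\<close>
    moreover have "covered (?S * (?D * ?u))"
    proof (cases "1 \<le> v x + v b - v z")
      case True
      then have "x * b / z \<in> P 1" unfolding P_iff[OF nz1(1)] v1 .
      then have "- (eps * (x * b / z)) \<in> P 1" by (simp only: P_minus unit_mult_P[OF unit_eps])
      then have "lo a3 (- (eps * (x * b / z))) \<in> II" using lo_II_corner[OF a3(1)] by blast
      then show ?thesis unfolding SDu by (rule covered_left[OF SD GG_carrier[OF GG_mult[OF S t]]])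
    next
      case False
      then have "z * (1 / b) / x \<in> P 0" unfolding P_iff[OF nz1(2)] v1 by simp
      then have "- (z * (1 / b) / x / eps) \<in> P 0" by (simp only: P_minus unit_divide_P[OF unit_eps])
      then have "uu a4 (- (z * (1 / b) / x / eps)) \<in> II" using uu_II_corner[OF a4(1)] by blast
      then show ?thesis unfolding SDu'
        by (rule covered_left[OF covered_right[OF cSDM GG_carrier[OF DM(2)] l2] c(2)])
    qed
    ultimately show ?thesis by blast
  qed
  then show "covered (?D * ?u)" "covered (?S * (?D * ?u))" by blast+
qed

lemma borel_form:
  assumes g: "m3 x b c 0 e f 0 h i \<in> GG" and x: "x \<noteq> 0"
  obtains a' b' where "m3 x 0 0 0 e 0 0 0 i \<in> GG" "uu a' b' \<in> GG"
    "m3 x b c 0 e f 0 h i = m3 x 0 0 0 e 0 0 0 i * uu a' b'"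
proof -
  have h: "h = 0" using g x by (auto simp: m3_Ggrp)
  have eqs: "sg e * e = 1" "sg x * i = 1" "sg i * x = 1" "sg e * f + sg b * i = 0"
    using g by (auto simp: m3_Ggrp h)
  then have nz: "e \<noteq> 0" "i \<noteq> 0" by auto
  have t: "m3 x 0 0 0 e 0 0 0 i \<in> GG" using eqs by (simp add: m3_Ggrp)
  have f: "f = - (e * sg (b / x))"
  proof -
    have "e * (sg e * f + sg b * i) = 0" by (simp only: eqs(4) mult_zero_right)
    then have "(sg e * e) * f = - (e * sg b * i)" by (simp add: algebra_simps eq_neg_iff_add_eq_0)
    moreover have "i = 1 / sg x" using eqs(2) x by (simp add: field_simps)
    ultimately show ?thesis by (simp add: eqs(1))
  qed
  have eq: "m3 x b c 0 e f 0 h i = m3 x 0 0 0 e 0 0 0 i * uu (b / x) (c / x)"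
    using x nz by (simp add: uu_def m3_mult h f)
  have "uu (b / x) (c / x) \<in> GG"
  proof -
    have "iv (m3 x 0 0 0 e 0 0 0 i) * m3 x b c 0 e f 0 h i = uu (b / x) (c / x)"
      using x eqs by (simp add: uinv_m3 m3_mult uu_def h f m3_eq_iff) (simp add: field_simps)
    then show ?thesis using GG_mult[OF GG_iv[OF t] g] by simp
  qed
  then show ?thesis using that t eq by blast
qed

text \<open>The first column is cleared by a unipotent from \<open>I\<close>, with pivot
  \<open>z\<close> if \<open>x / z\<close> is integral and with pivot \<open>x\<close> otherwise.
  Isotropy of the column makes the coefficients satisfy the Heisenberg equation. What remains is
  upper triangular, preceded by \<open>n_s\<close> for the pivot \<open>z\<close>.\<close>

lemma GG_covered: assumes "g \<in> GG" shows "covered g"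
proof -
  obtain x b c y e f z h i where g: "g = m3 x b c y e f z h i" and gG: "m3 x b c y e f z h i \<in> GG"
    by (rule Ggrp_E[OF assms])
  have N: "sg z * x + sg y * y + sg x * z = 0" and one: "sg z * c + sg y * f + sg x * i = 1"
    using gG by (auto simp: m3_Ggrp)
  show ?thesis
  proof (cases "z \<noteq> 0 \<and> x / z \<in> P 0")
    case True
    let ?u = "uu (sg y / sg z) (sg x / sg z)"
    have "sg x / sg z + sg (sg x / sg z) + sg y / sg z * sg (sg y / sg z) =
        (sg z * x + sg y * y + sg x * z) / (z * sg z)"
      using True by (simp add: field_simps)
    then have uG: "?u \<in> GG" unfolding uu_GG by (simp add: N)
    have "sg (x / z) \<in> P 0" using True by (simp only: P_sg)
    then have uI: "?u \<in> II" using uu_II_corner[OF uG] by simp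
    have z: "z \<noteq> 0" using True by simp
    have col: "x + sg y / sg z * y + sg x / sg z * z = 0"
    proof -
      have "x + sg y / sg z * y + sg x / sg z * z = (sg z * x + sg y * y + sg x * z) / sg z"
        using z by (simp add: field_simps)
      then show ?thesis by (simp add: N)
    qed
    obtain b' c' e' f' h' i' where g': "?u * g = m3 0 b' c' 0 e' f' z h' i'"
      using z col by (simp add: g uu_def m3_mult m3_eq_iff)
    have ug: "?u * g \<in> GG" by (rule GG_mult[OF uG assms])
    have "iv (nn True) * (?u * g) = m3 (z / seps) (h' / seps) (i' / seps) 0 e' f' 0 (- (seps * b')) (- (seps * c'))"
      unfolding g' by (simp add: nn_anti anti3_def uinv_m3 m3_mult m3_eq_iff divide_inverse mult.commute)
    with GG_mult[OF GG_iv[OF nn_GG[of True]] ug] have B: "m3 (z / seps) (h' / seps) (i' / seps) 0 e' f' 0 (- (seps * b')) (- (seps * c')) \<in> GG"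
      by simp
    have eq: "?u * g = nn True * m3 (z / seps) (h' / seps) (i' / seps) 0 e' f' 0 (- (seps * b')) (- (seps * c'))"
      by (simp add: g' nn_anti anti3_def m3_mult m3_eq_iff)
    have "z / seps \<noteq> 0" using z by simp
    then have "covered (?u * g)" unfolding eq using borel_form[OF B] covered_borel(2) by metis
    then have "covered (iv ?u * (?u * g))"
      by (rule covered_left[OF _ GG_carrier[OF ug] II_iv[OF uI]])
    moreover have "iv ?u * (?u * g) = g"
      using GG_assoc[OF GG_iv[OF uG] uG assms] uinv_left[OF uG] left_mult_one_mat[OF GG_carrier[OF assms]] by simp
    ultimately show ?thesis by simp
  next
    case False
    have x: "x \<noteq> 0"
    proof
      assume "x = 0"
      then have "z = 0" using False by auto
      then have "y = 0" using N by simp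
      then show False using one \<open>x = 0\<close> \<open>z = 0\<close> by simp
    qed
    let ?u = "lo (- (y / x)) (sg z / sg x)"
    have "sg z / sg x + sg (sg z / sg x) + (- (y / x)) * sg (- (y / x)) =
        (sg z * x + sg y * y + sg x * z) / (x * sg x)"
      using x by (simp add: field_simps)
    then have uG: "?u \<in> GG" unfolding lo_GG by (simp add: N)
    have "z / x \<in> P 1" using False x by (cases "z = 0") (auto simp: P_iff v_divide)
    then have "sg (z / x) \<in> P 1" by (simp only: P_sg)
    then have uI: "?u \<in> II" using lo_II_corner[OF uG] by simp
    have col: "sg z / sg x * x + sg y / sg x * y + z = 0"
    proof -
      have "sg z / sg x * x + sg y / sg x * y + z = (sg z * x + sg y * y + sg x * z) / sg x"
        using x by (simp add: field_simps)
      then show ?thesis by (simp add: N)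
    qed
    obtain b' c' e' f' h' i' where g': "?u * g = m3 x b' c' 0 e' f' 0 h' i'"
      using x col by (simp add: g lo_def m3_mult m3_eq_iff)
    have ug: "?u * g \<in> GG" by (rule GG_mult[OF uG assms])
    then have "covered (?u * g)" unfolding g' using borel_form[OF _ x] covered_borel(1) by metis
    then have "covered (iv ?u * (?u * g))"
      by (rule covered_left[OF _ GG_carrier[OF ug] II_iv[OF uI]])
    moreover have "iv ?u * (?u * g) = g"
      using GG_assoc[OF GG_iv[OF uG] uG assms] uinv_left[OF uG] left_mult_one_mat[OF GG_carrier[OF assms]] by simp
    ultimately show ?thesis by simp
  qed
qed

end

section \<open>Values of the structure constants\<close>

context unramified_character
begin

sublocale dihedral_cosets 3 GG II chi iv nn UU cff
proof
  show "\<exists>k\<in>II. chi k = 1 \<and> u * word_prod 3 nn ws = word_prod 3 nn ws * k"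
    if "distinct_adj (b # ws)" "u \<in> UU b" for b ws u
    using word_conjugate[OF that] chi_Iw1 by (auto simp: Iw1_def)
  show "\<exists>ws. \<exists>k\<in>II. \<exists>k'\<in>II. distinct_adj ws \<and> g = k * word_prod 3 nn ws * k'" if "g \<in> GG" for g
    using GG_covered[OF that] by (simp add: covered_def)
qed (rule double_cosets_disjoint)

lemma lincoef_UU_True: "lincoef True = of_nat q - of_nat q ^ 2"
proof -
  have "cff True (1\<^sub>m 3) = 0" by (simp add: cff_def PP_def unit_def)
  then have "lincoef True = (\<Sum>u\<in>UU True. cff True u)"
    unfolding lincoef_def using sum.remove[OF finite_UU one_UU, of "cff True" True] by simp
  also have "\<dots> = (\<Sum>z\<in>(R \<times> R) \<times> R. cff True (ut z))"
    by (simp add: UU_def sum.reindex[OF inj_ut])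
  also have "\<dots> = (\<Sum>z\<in>R \<times> R. \<Sum>t\<in>R. PP (seps * (- (pt z * sg (pt z)) / 2 + t * seps)))"
    unfolding sum.cartesian_product by (rule sum.cong) (auto simp: cff_def ut_def uu_def)
  finally show ?thesis by (simp only: sum_heisenberg)
qed

lemma lincoef_UU_False: "lincoef False = of_nat q - 1"
proof -
  have "card (UU False - {1\<^sub>m 3}) = q - 1" by (simp add: card_Diff_singleton one_UU card_UU)
  moreover have "q \<ge> 1" using zero_R finite_R card_R card_gt_0_iff[of R] by auto
  ultimately show ?thesis by (simp add: lincoef_def cff_def of_nat_diff)
qed

sublocale unramified_hecke 3 GG II chi iv nn UU cff q
  by unfold_locales (simp_all add: lincoef_UU_True lincoef_UU_False concoef_def card_UU)

end

theorem mainTheorem4: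
  fixes v :: "'e::field \<Rightarrow> int" and sg :: "'e \<Rightarrow> 'e" and eps seps w :: 'e
    and p q :: nat and chi :: "'e mat \<Rightarrow> 'c::field"
  assumes hyp_field: "unram_local_data v sg eps seps w p q"
    and alg_closed: "\<forall>P :: 'c poly. 0 < degree P \<longrightarrow> (\<exists>x. poly P x = 0)"
    and char: "of_nat ((q^2 - 1) * (q + 1)) \<noteq> (0 :: 'c)"
    and chi_char: "H_char v sg chi"
    and chi_s: "chi_s_fixed v sg chi"
    and not_det: "\<not> chi_factors_det v sg chi"
  shows "(\<exists>TX. is_Tn (Ggrp sg) (Iw v sg) chi (nS seps) TX) \<and>
         (\<exists>TY. is_Tn (Ggrp sg) (Iw v sg) chi (nS' seps w) TY) \<and>
         (\<forall>TX TY. is_Tn (Ggrp sg) (Iw v sg) chi (nS seps) TX \<longrightarrow>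
                  is_Tn (Ggrp sg) (Iw v sg) chi (nS' seps w) TY \<longrightarrow>
           (let G = Ggrp sg; I = Iw v sg; V = cind G I chi; A = Hend G I chi in
             hecke_presentation V A q TX TY \<and>
             ecenter A = epolys V (Zelt V q TX TY) \<and>
             (\<forall>(scale :: 'c \<Rightarrow> 'm::ab_group_add \<Rightarrow> 'm) act.
                rmod V A scale act \<and> fin_dim scale \<and> simple_rmod A scale act \<longrightarrow>
                (\<exists>th th'. th \<in> {- (of_nat q ^ 2), of_nat q} \<and> th' \<in> {-1, of_nat q} \<and>
                          iso_to_mu V A TX TY scale act th th') \<or>
                (\<exists>lam. lam \<noteq> of_nat q ^ 3 + of_nat q \<and> lam \<noteq> - 2 * of_nat q ^ 2 \<and>
                          iso_to_M V A q TX TY scale act lam))))"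
proof -
  interpret unramified_character v sg eps seps w p q chi
    using assms by unfold_locales
  have n: "nS seps = nn True" "nS' seps w = nn False" by (simp_all add: nn_def)
  have "hecke_presentation V A q TX TY \<and> ecenter A = epolys V (Zelt V q TX TY) \<and>
      (\<forall>(scale :: 'c \<Rightarrow> 'm \<Rightarrow> 'm) act. rmod V A scale act \<and> fin_dim scale \<and> simple_rmod A scale act \<longrightarrow>
        (\<exists>th th'. th \<in> {- (of_nat q ^ 2), of_nat q} \<and> th' \<in> {-1, of_nat q} \<and>
                  iso_to_mu V A TX TY scale act th th') \<or>
        (\<exists>lam. lam \<noteq> of_nat q ^ 3 + of_nat q \<and> lam \<noteq> - 2 * of_nat q ^ 2 \<and>
                  iso_to_M V A q TX TY scale act lam))"
    if "is_Tn GG II chi (nn True) TX" "is_Tn GG II chi (nn False) TY" for TX TY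
    unfolding is_Tn_unique[OF that(1)] is_Tn_unique[OF that(2)] Zelt_eq
    using hecke_presentation_hop center_eq_epolys simple_module_classification[OF _ _ alg_closed] by blast
  then show ?thesis unfolding n Let_def using is_Tn_hop by blast
qed

end
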